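(* Let $b$ be a positive odd integer. Let $G$ be a connected graph of even order $n$ with minimum degree $\delta\ge 3$, where $n\ge\max\left\{2b\delta^2,\ \left(\frac{3}{b}+5+2b\right)\delta+1+\frac{3(b+1)}{b^2}\right\}$. If $\mu(G)\le \mu\big(K_{\delta}\vee (K_{n-(b+1)\delta-1}+(b\delta+1)K_1)\big)$, then $G$ has an odd $[1,b]$-factor unless $G\cong K_{\delta}\vee (K_{n-(b+1)\delta-1}+(b\delta+1)K_1)$.
   Context: All graphs are finite and simple. An odd $[1,b]$-factor of a graph $G$ is a spanning subgraph $G_0$ of $G$ such that, for every $v\in V(G)$, the degree $d_{G_0}(v)$ is odd and $1\le d_{G_0}(v)\le b$. For a connected graph $G$ with vertices $v_1,\dots,v_n$, the distance matrix is $D(G)=(d_{ij})_{n\times n}$, where $d_{ij}$ is the length of a shortest path between $v_i$ and $v_j$; the distance spectral radius $\mu(G)$ is the largest eigenvalue of $D(G)$. $K_m$ is the complete graph on $m$ vertices; $G_1+G_2$ is the disjoint union of $G_1$ and $G_2$; $mK_1$ is the disjoint union of $m$ copies of $K_1$; the join $G_1\vee G_2$ is obtained from $G_1+G_2$ by adding all possible edges between $V(G_1)$ and $V(G_2)$. *)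

theory Defs
  imports
    "Graph_Theory.Graph_Theory"
    "Jordan_Normal_Form.Spectral_Radius"
begin

text \<open>
  A finite simple graph is a \<open>pair_graph\<close>: a finite, loop-free, symmetric digraph whose arcs are
  pairs of vertices, so that an undirected edge \<open>uv\<close> is the pair of arcs \<open>(u, v)\<close>, \<open>(v, u)\<close>.
  The degree of a vertex is therefore its out-degree.
\<close>

abbreviation vertex_degree :: "'a pair_pre_digraph \<Rightarrow> 'a \<Rightarrow> nat" where
  "vertex_degree G v \<equiv> out_degree (with_proj G) v"

definition min_degree :: "'a pair_pre_digraph \<Rightarrow> nat" where
  "min_degree G = Min (vertex_degree G ` pverts G)"

definition odd_factor :: "nat \<Rightarrow> 'a pair_pre_digraph \<Rightarrow> 'a pair_pre_digraph \<Rightarrow> bool" where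
  "odd_factor b G H \<longleftrightarrow>
     pair_graph H \<and> spanning (with_proj H) (with_proj G) \<and>
     (\<forall>v \<in> pverts G. odd (vertex_degree H v) \<and> 1 \<le> vertex_degree H v \<and> vertex_degree H v \<le> b)"


subsection \<open>Distance matrix and distance spectral radius\<close>

text \<open>Only meaningful if some path joins \<open>u\<close> and \<open>v\<close>, in particular in connected graphs.\<close>

definition graph_dist :: "'a pair_pre_digraph \<Rightarrow> 'a \<Rightarrow> 'a \<Rightarrow> nat" where
  "graph_dist G u v = (LEAST k. \<exists>p. pre_digraph.apath (with_proj G) u p v \<and> length p = k)"

definition distance_mat :: "'a pair_pre_digraph \<Rightarrow> 'a list \<Rightarrow> real mat" where
  "distance_mat G vs =
     mat (length vs) (length vs) (\<lambda>(i, j). real (graph_dist G (vs ! i) (vs ! j)))"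

text \<open>
  The vertices are listed in an arbitrary order; the lemma \<open>distance_spectral_radius_eq\<close> below shows
  that the order is irrelevant. As the distance matrix of a connected graph is real symmetric, its
  spectrum over the reals is its full spectrum.
\<close>

definition vertex_list :: "'a pair_pre_digraph \<Rightarrow> 'a list" where
  "vertex_list G = (SOME vs. distinct vs \<and> set vs = pverts G)"

definition distance_spectral_radius :: "'a pair_pre_digraph \<Rightarrow> real" where
  "distance_spectral_radius G = Max (spectrum (distance_mat G (vertex_list G)))"

lemma eigenvalue_distance_mat_reorder:
  assumes "distinct vs" "distinct ws" "set vs = set ws" "eigenvalue (distance_mat G vs) k"
  shows "eigenvalue (distance_mat G ws) k"
proof -
  let ?n = "length vs"
  have "mset ws = mset vs"
    using assms by (simp add: set_eq_iff_mset_eq_distinct)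
  then obtain p where p: "p permutes {..<?n}" "permute_list p vs = ws"
    by (rule mset_eq_permutation)
  have len: "length ws = ?n"
    using p(2) by auto
  have nth: "ws ! i = vs ! p i" if "i < ?n" for i
    using permute_list_nth[OF p(1) that] p(2) by simp
  have plt: "p i < ?n" if "i < ?n" for i
    using permutes_in_image[OF p(1), of i] that by simp
  obtain x where x: "x \<in> carrier_vec ?n" "x \<noteq> 0\<^sub>v ?n" "distance_mat G vs *\<^sub>v x = k \<cdot>\<^sub>v x"
    using assms(4) by (auto simp: eigenvalue_def eigenvector_def distance_mat_def)
  define y where "y = vec ?n (\<lambda>i. x $ p i)"
  have row: "(\<Sum>j<?n. real (graph_dist G (vs ! i) (vs ! j)) * x $ j) = k * x $ i" if "i < ?n" for i
  proof -
    have "(distance_mat G vs *\<^sub>v x) $ i = (k \<cdot>\<^sub>v x) $ i"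
      by (simp only: x(3))
    then show ?thesis
      using that x(1) by (simp add: distance_mat_def scalar_prod_def atLeast0LessThan)
  qed
  have "distance_mat G ws *\<^sub>v y = k \<cdot>\<^sub>v y"
  proof (rule eq_vecI)
    fix i assume "i < dim_vec (k \<cdot>\<^sub>v y)"
    then have i: "i < ?n"
      by (simp add: y_def)
    have "(distance_mat G ws *\<^sub>v y) $ i =
        (\<Sum>j<?n. real (graph_dist G (vs ! p i) (vs ! p j)) * x $ p j)"
      using i len by (simp add: distance_mat_def scalar_prod_def atLeast0LessThan y_def nth)
    also have "\<dots> = (\<Sum>j<?n. real (graph_dist G (vs ! p i) (vs ! j)) * x $ j)"
      using sum.permute[OF p(1), of "\<lambda>j. real (graph_dist G (vs ! p i) (vs ! j)) * x $ j"]
      by (simp add: o_def)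
    also have "\<dots> = k * x $ p i"
      by (rule row[OF plt[OF i]])
    finally show "(distance_mat G ws *\<^sub>v y) $ i = (k \<cdot>\<^sub>v y) $ i"
      using i by (simp add: y_def)
  qed (simp add: distance_mat_def y_def len)
  moreover have "y \<noteq> 0\<^sub>v ?n"
  proof
    assume y0: "y = 0\<^sub>v ?n"
    have "x $ i = 0" if "i < ?n" for i
    proof -
      obtain j where j: "j < ?n" "p j = i"
        using permutes_image[OF p(1)] \<open>i < ?n\<close> by (metis imageE lessThan_iff)
      then have "y $ j = x $ i"
        by (simp add: y_def)
      then show ?thesis
        using y0 j by simp
    qed
    then have "x = 0\<^sub>v ?n"
      using x(1) by (intro eq_vecI) auto
    then show False
      using x(2) by simp
  qed
  moreover have "y \<in> carrier_vec ?n"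
    by (simp add: y_def)
  ultimately show ?thesis
    unfolding eigenvalue_def eigenvector_def
    by (intro exI[of _ y]) (simp add: distance_mat_def len)
qed

lemma distance_spectral_radius_eq:
  assumes "distinct vs" "set vs = pverts G"
  shows "distance_spectral_radius G = Max (spectrum (distance_mat G vs))"
proof -
  have "distinct (vertex_list G) \<and> set (vertex_list G) = pverts G"
    unfolding vertex_list_def by (rule someI[of _ vs]) (use assms in simp)
  then have "eigenvalue (distance_mat G (vertex_list G)) k \<longleftrightarrow> eigenvalue (distance_mat G vs) k" for k
    using assms eigenvalue_distance_mat_reorder[of "vertex_list G" vs]
      eigenvalue_distance_mat_reorder[of vs "vertex_list G"] by auto
  then have "spectrum (distance_mat G (vertex_list G)) = spectrum (distance_mat G vs)"
    unfolding spectrum_def by (intro Collect_cong)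
  then show ?thesis
    by (simp add: distance_spectral_radius_def)
qed


subsection \<open>Graph constructions\<close>

definition complete_graph :: "nat \<Rightarrow> nat pair_pre_digraph" where
  "complete_graph m = \<lparr>pverts = {..<m}, parcs = {(i, j). i < m \<and> j < m \<and> i \<noteq> j}\<rparr>"

definition graph_sum ::
    "'a pair_pre_digraph \<Rightarrow> 'b pair_pre_digraph \<Rightarrow> ('a + 'b) pair_pre_digraph" where
  "graph_sum G H =
     \<lparr>pverts = pverts G <+> pverts H,
      parcs = map_prod Inl Inl ` parcs G \<union> map_prod Inr Inr ` parcs H\<rparr>"

definition graph_copies :: "nat \<Rightarrow> 'a pair_pre_digraph \<Rightarrow> (nat \<times> 'a) pair_pre_digraph" where
  "graph_copies m G =
     \<lparr>pverts = {..<m} \<times> pverts G,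
      parcs = {((i, u), (i, v)) | i u v. i < m \<and> (u, v) \<in> parcs G}\<rparr>"

definition graph_join ::
    "'a pair_pre_digraph \<Rightarrow> 'b pair_pre_digraph \<Rightarrow> ('a + 'b) pair_pre_digraph" where
  "graph_join G H =
     \<lparr>pverts = pverts (graph_sum G H),
      parcs = parcs (graph_sum G H) \<union>
        (Inl ` pverts G) \<times> (Inr ` pverts H) \<union> (Inr ` pverts H) \<times> (Inl ` pverts G)\<rparr>"

definition extremal_graph :: "nat \<Rightarrow> nat \<Rightarrow> nat \<Rightarrow> (nat + nat + nat \<times> nat) pair_pre_digraph" where
  "extremal_graph b d n =
     graph_join (complete_graph d)
       (graph_sum (complete_graph (n - (b + 1) * d - 1))
          (graph_copies (b * d + 1) (complete_graph 1)))"

lemma pair_graph_iff: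
  "pair_graph G \<longleftrightarrow> finite (pverts G) \<and> parcs G \<subseteq> pverts G \<times> pverts G \<and>
     irrefl (parcs G) \<and> sym (parcs G)"
proof
  assume "pair_graph G"
  then interpret pair_graph G .
  show "finite (pverts G) \<and> parcs G \<subseteq> pverts G \<times> pverts G \<and> irrefl (parcs G) \<and> sym (parcs G)"
    using pair_finite_verts in_arcsD1 in_arcsD2 no_loops' pair_sym_arcs
    by (fastforce simp: irrefl_def symmetric_def)
next
  assume *: "finite (pverts G) \<and> parcs G \<subseteq> pverts G \<times> pverts G \<and>
     irrefl (parcs G) \<and> sym (parcs G)"
  then have "finite (parcs G)"
    using finite_subset by blast
  with * show "pair_graph G"
    by unfold_locales (auto simp: irrefl_def symmetric_def)
qed

lemma complete_graph_pair_graph: "pair_graph (complete_graph m)"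
  by (auto simp: pair_graph_iff complete_graph_def irrefl_def sym_def)

lemma graph_sum_pair_graph:
  "pair_graph G \<Longrightarrow> pair_graph H \<Longrightarrow> pair_graph (graph_sum G H)"
  by (auto simp: pair_graph_iff graph_sum_def irrefl_def sym_def)

lemma graph_copies_pair_graph: "pair_graph G \<Longrightarrow> pair_graph (graph_copies m G)"
  by (auto simp: pair_graph_iff graph_copies_def irrefl_def sym_def)

lemma graph_join_pair_graph:
  "pair_graph G \<Longrightarrow> pair_graph H \<Longrightarrow> pair_graph (graph_join G H)"
  using graph_sum_pair_graph[of G H]
  by (auto simp: pair_graph_iff graph_join_def irrefl_def sym_def graph_sum_def)

lemma extremal_graph_pair_graph: "pair_graph (extremal_graph b d n)"
  unfolding extremal_graph_def
  by (intro graph_join_pair_graph graph_sum_pair_graph graph_copies_pair_graph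
      complete_graph_pair_graph)

lemma card_extremal_graph:
  assumes "(b + 1) * d + 1 \<le> n"
  shows "card (pverts (extremal_graph b d n)) = n"
  using assms
  by (simp add: extremal_graph_def graph_join_def graph_sum_def graph_copies_def
      complete_graph_def card_Plus card_cartesian_product)

end

theory Submission
  imports Defs "HOL-Analysis.Function_Topology" "HOL-Analysis.Convex" "HOL-Library.Disjoint_Sets"
begin

text \<open>
The proof joins a criterion for odd factors to a comparison of Rayleigh quotients.

\<^emph>\<open>Factors.\<close> If \<open>G\<close> has no odd \<open>[1,b]\<close>-factor, then some vertex set \<open>S\<close> leaves more than \<open>b |S|\<close> odd
components in \<open>G - S\<close>. This is a special case of a theorem on subgraphs with prescribed parities and
upper bounds of the degrees (\<open>parity_tough_imp_parity_factor\<close>), which generalises Tutte's theorem and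
is proved here in the same spirit: a largest set \<open>S\<close> for which the condition is tight is matched into
the odd components, and induction provides the factor inside each component. For even \<open>n\<close> and odd
\<open>b\<close>, a parity argument yields one more component, so \<open>V - S\<close> splits into \<open>b |S| + 2\<close> nonempty parts without
edges between different parts; the largest of them is called \<open>R\<close> (\<open>odd_barrier_partition\<close>).

\<^emph>\<open>Spectra.\<close> The distance spectral radius is the maximum of the Rayleigh quotient of the distance
matrix, so every test vector bounds \<open>\<mu>(G)\<close> from below. A good test vector comes from the
extremal graph, whose principal eigenvector takes a value \<open>x\<close> on \<open>K\<^sub>\<delta>\<close>, the value \<open>1\<close> on the
large clique and a value \<open>z\<close> on the isolated vertices, where \<open>0 < x \<le> 1 \<le> z < 2\<close>
(\<open>split_join_principal_values\<close>). These values are placed on \<open>V(G)\<close> with the same multiplicities.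
Vertices in different parts of \<open>V - S\<close> have distance at least \<open>2\<close> and all other distinct vertices
distance at least \<open>1\<close>; distances in the extremal graph are exactly \<open>1\<close> or \<open>2\<close>. Hence comparing the
two quadratic forms amounts to comparing the total weight of the pairs of vertices that are separated.

Separating more pairs pays off. Moving excess weight from the other parts into the largest part \<open>R\<close> does not increase
the weight of the separated pairs (\<open>multipartite_weight_concentrate\<close>), so it is enough to look at
parts of the smallest possible size \<open>h\<close>. If \<open>|S| \<ge> \<delta>\<close>, then \<open>h = 1\<close>, \<open>x\<close> is placed inside \<open>S\<close>
and \<open>z\<close> on single vertices of \<open>b \<delta> + 1\<close> parts. If \<open>|S| < \<delta>\<close>, the minimum degree forces \<open>h = \<delta> + 1 - |S|\<close>, and the
copies of \<open>x\<close> that do not fit into \<open>S\<close> move to the parts, where each of them is separated from all of \<open>R\<close>. In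
both cases the lower bounds on \<open>n\<close> make the form of \<open>G\<close> larger than that of the extremal graph
(\<open>large_barrier_margin\<close>, \<open>small_barrier_margin\<close>), except if \<open>|S| = \<delta>\<close>. In that case the hypothesis
\<open>\<mu>(G) \<le> \<mu>(K\<^sub>\<delta> \<or> \<dots>)\<close> forces equality everywhere: all parts other than \<open>R\<close> are single vertices, all
pairs that are not separated are adjacent, and \<open>G\<close> is the extremal graph.
\<close>

section \<open>A marriage theorem with capacities\<close>

lemma sum_fun_upd_diff:
  fixes f :: "'v \<Rightarrow> nat"
  assumes "finite X" "k \<le> f c"
  shows "sum f X = sum (f(c := f c - k)) X + (if c \<in> X then k else 0)"
proof (cases "c \<in> X")
  case True
  then have "sum f X = f c + sum f (X - {c})"
    "sum (f(c := f c - k)) X = f c - k + sum (f(c := f c - k)) (X - {c})"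
    using assms(1) by (simp_all add: sum.remove)
  moreover have "sum (f(c := f c - k)) (X - {c}) = sum f (X - {c})"
    by (intro sum.cong) auto
  ultimately show ?thesis using True assms(2) by simp
next
  case False
  then have "sum (f(c := f c - k)) X = sum f X" by (intro sum.cong) auto
  then show ?thesis using False by simp
qed

text \<open>
Hall's theorem in which a point \<open>s\<close> may serve up to \<open>f s\<close> clients. As in the proof of Halmos and Vaughan,
either some proper subset \<open>T\<close> exhausts the capacity of its neighbourhood, and then \<open>T\<close> and the
rest are served separately, or there is slack everywhere, and one client can be served arbitrarily.
\<close>

lemma capacity_marriage:
  fixes N :: "'i \<Rightarrow> 's set" and f :: "'s \<Rightarrow> nat"
  assumes "finite I" "finite S" and "\<And>i. i \<in> I \<Longrightarrow> N i \<subseteq> S"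
    and "\<And>T. T \<subseteq> I \<Longrightarrow> card T \<le> sum f (\<Union>(N ` T))"
  shows "\<exists>\<phi>. (\<forall>i\<in>I. \<phi> i \<in> N i) \<and> (\<forall>s\<in>S. card {i \<in> I. \<phi> i = s} \<le> f s)"
  using assms(1,3,4)
proof (induction "card I" arbitrary: I f rule: less_induct)
  case less
  note fin = less.prems(1) and sub = less.prems(2) and hall = less.prems(3)
  have finN: "finite (\<Union>(N ` T))" if "T \<subseteq> I" for T
    using sub that \<open>finite S\<close> by (meson UN_least finite_subset subset_iff)
  consider "I = {}" | T where "T \<subseteq> I" "T \<noteq> {}" "T \<noteq> I" "card T = sum f (\<Union>(N ` T))"
    | "I \<noteq> {}" "\<And>T. T \<subseteq> I \<Longrightarrow> T \<noteq> {} \<Longrightarrow> T \<noteq> I \<Longrightarrow> card T < sum f (\<Union>(N ` T))"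
    using hall by (metis le_neq_implies_less)
  then show ?case
  proof cases
    case 1
    then show ?thesis by simp
  next
    case (2 T)
    let ?M = "\<Union>(N ` T)"
    have finT: "finite T" using 2(1) fin finite_subset by blast
    have "card T < card I" using 2(1,3) fin by (metis psubsetI psubset_card_mono)
    moreover have "\<And>i. i \<in> T \<Longrightarrow> N i \<subseteq> S" using 2(1) sub by blast
    moreover have "\<And>U. U \<subseteq> T \<Longrightarrow> card U \<le> sum f (\<Union>(N ` U))" using 2(1) hall by blast
    ultimately obtain \<phi> where \<phi>: "\<forall>i\<in>T. \<phi> i \<in> N i" "\<forall>s\<in>S. card {i \<in> T. \<phi> i = s} \<le> f s"
      using less.hyps[of T f] finT by blast
    \<comment> \<open>The points of \<open>?M\<close> are exhausted by \<open>T\<close>.\<close>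
    define g where "g s = (if s \<in> ?M then 0 else f s)" for s
    have "card (I - T) < card I"
      using 2 fin by (metis Diff_subset Diff_cancel Diff_empty double_diff psubsetI psubset_card_mono subset_refl)
    moreover have "card U \<le> sum g (\<Union>(N ` U))" if U: "U \<subseteq> I - T" for U
    proof -
      have "finite U" using U fin by (meson finite_Diff finite_subset)
      have "card U + card T = card (U \<union> T)"
        using U finT \<open>finite U\<close> by (subst card_Un_disjoint) auto
      also have "\<dots> \<le> sum f (\<Union>(N ` (U \<union> T)))" using U 2(1) by (intro hall) blast
      also have "\<Union>(N ` (U \<union> T)) = (\<Union>(N ` U) - ?M) \<union> ?M" by blast
      also have "sum f \<dots> = sum f (\<Union>(N ` U) - ?M) + sum f ?M"
        using finN[of U] finN[of T] U 2(1) by (intro sum.union_disjoint) auto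
      also have "sum f (\<Union>(N ` U) - ?M) = sum g (\<Union>(N ` U))"
        using finN[of U] U by (intro sum.mono_neutral_cong_left) (auto simp: g_def)
      finally show ?thesis using 2(4) by simp
    qed
    moreover have "\<And>i. i \<in> I - T \<Longrightarrow> N i \<subseteq> S" using sub by blast
    ultimately obtain \<psi> where \<psi>: "\<forall>i\<in>I-T. \<psi> i \<in> N i" "\<forall>s\<in>S. card {i \<in> I-T. \<psi> i = s} \<le> g s"
      using less.hyps[of "I - T" g] fin by blast
    let ?h = "\<lambda>i. if i \<in> T then \<phi> i else \<psi> i"
    have "card {i \<in> I. ?h i = s} \<le> f s" if "s \<in> S" for s
    proof (cases "s \<in> ?M")
      case True
      then have "g s = 0" by (simp add: g_def)
      then have "card {i \<in> I-T. \<psi> i = s} = 0" using \<psi>(2) that by fastforce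
      then have "{i \<in> I-T. \<psi> i = s} = {}" using fin by simp
      then have "{i \<in> I. ?h i = s} = {i \<in> T. \<phi> i = s}" using 2(1) by auto
      then show ?thesis using \<phi>(2) that by simp
    next
      case False
      then have "{i \<in> I. ?h i = s} = {i \<in> I-T. \<psi> i = s}" using \<phi>(1) by auto
      then show ?thesis using \<psi>(2) that False by (auto simp: g_def)
    qed
    moreover have "\<forall>i\<in>I. ?h i \<in> N i" using \<phi> \<psi> by auto
    ultimately show ?thesis by (intro exI[of _ ?h]) blast
  next
    case 3
    then obtain i where i: "i \<in> I" by blast
    have "0 < sum f (N i)" using hall[of "{i}"] i by simp
    then obtain s where s: "s \<in> N i" "0 < f s"
      by (metis gr0I less_numeral_extra(3) sum.neutral)
    define g where "g = f(s := f s - 1)"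
    have "card U \<le> sum g (\<Union>(N ` U))" if U: "U \<subseteq> I - {i}" for U
    proof (cases "U = {}")
      case False
      then have "card U < sum f (\<Union>(N ` U))" using 3(2)[of U] U i by auto
      also have "sum f (\<Union>(N ` U)) \<le> sum g (\<Union>(N ` U)) + 1"
      proof -
        have "U \<subseteq> I" using U by blast
        then have "finite (\<Union>(N ` U))" by (rule finN)
        from sum_fun_upd_diff[OF this, of 1 f s] show ?thesis using s(2) unfolding g_def by simp
      qed
      finally show ?thesis by simp
    qed simp
    moreover have "card (I - {i}) < card I" using card_Diff1_less[OF fin i] .
    ultimately obtain \<phi> where \<phi>: "\<forall>j\<in>I-{i}. \<phi> j \<in> N j"
      "\<forall>r\<in>S. card {j \<in> I-{i}. \<phi> j = r} \<le> g r"
      using less.hyps[of "I - {i}" g] fin sub by blast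
    let ?h = "\<phi>(i := s)"
    have "card {j \<in> I. ?h j = r} \<le> f r" if "r \<in> S" for r
    proof (cases "r = s")
      case True
      then have "{j \<in> I. ?h j = r} = insert i {j \<in> I-{i}. \<phi> j = s}" using i by auto
      then have "card {j \<in> I. ?h j = r} = Suc (card {j \<in> I-{i}. \<phi> j = s})"
        using fin by (simp add: card_insert_if)
      then show ?thesis using \<phi>(2) that True s(2) by (auto simp: g_def)
    next
      case False
      then have "{j \<in> I. ?h j = r} = {j \<in> I-{i}. \<phi> j = r}" by auto
      then show ?thesis using \<phi>(2) that False by (auto simp: g_def)
    qed
    moreover have "\<forall>j\<in>I. ?h j \<in> N j" using \<phi>(1) s(1) by auto
    ultimately show ?thesis by (intro exI[of _ ?h]) blast
  qed
qed

section \<open>Barriers in parity factor problems\<close>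

text \<open>
An odd island is a set of odd weight that no edge leaves within \<open>W\<close>. Every odd island contains a
connected component of odd weight, so the largest cardinality of a family of odd islands is the
number of odd components of the graph induced on \<open>W\<close>. Islands need not be connected, which makes it
possible to split, merge and discard them freely.
\<close>

definition odd_islands :: "('v \<times> 'v) set \<Rightarrow> ('v \<Rightarrow> nat) \<Rightarrow> 'v set \<Rightarrow> 'v set set \<Rightarrow> bool" where
  "odd_islands E f W \<O> \<longleftrightarrow> \<Union>\<O> \<subseteq> W \<and> disjoint \<O> \<and> (\<forall>P\<in>\<O>. odd (sum f P) \<and> E `` P \<inter> W \<subseteq> P)"

text \<open>
For \<open>f = 1\<close> this is Tutte's condition. The name recalls toughness, which bounds the number of all components
instead of the odd ones.
\<close>

definition parity_tough :: "('v \<times> 'v) set \<Rightarrow> ('v \<Rightarrow> nat) \<Rightarrow> 'v set \<Rightarrow> bool" where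
  "parity_tough E f V \<longleftrightarrow>
     (\<forall>S \<O>. S \<subseteq> V \<longrightarrow> odd_islands E f (V - S) \<O> \<longrightarrow> card \<O> \<le> sum f S)"

lemma odd_islandsD:
  assumes "odd_islands E f W \<O>"
  shows "\<Union>\<O> \<subseteq> W" "disjoint \<O>" "P \<in> \<O> \<Longrightarrow> odd (sum f P)" "P \<in> \<O> \<Longrightarrow> E `` P \<inter> W \<subseteq> P"
    "P \<in> \<O> \<Longrightarrow> P \<subseteq> W"
  using assms unfolding odd_islands_def by blast+

lemma odd_islandsI:
  assumes "\<Union>\<O> \<subseteq> W" "disjoint \<O>" "\<And>P. P \<in> \<O> \<Longrightarrow> odd (sum f P)" "\<And>P. P \<in> \<O> \<Longrightarrow> E `` P \<inter> W \<subseteq> P"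
  shows "odd_islands E f W \<O>"
  using assms unfolding odd_islands_def by blast

lemma odd_islands_finite:
  "finite W \<Longrightarrow> odd_islands E f W \<O> \<Longrightarrow> finite \<O>"
  unfolding odd_islands_def by (metis finite_UnionD finite_subset)

lemma odd_islands_sum_parity:
  assumes "finite W" "odd_islands E f W \<O>"
  shows "even (sum f (\<Union>\<O>)) \<longleftrightarrow> even (card \<O>)"
proof -
  have "finite \<O>" using odd_islands_finite assms .
  moreover have "\<forall>P\<in>\<O>. finite P"
    using assms unfolding odd_islands_def by (meson Union_upper finite_subset)
  moreover have "\<forall>P\<in>\<O>. \<forall>Q\<in>\<O>. P \<noteq> Q \<longrightarrow> P \<inter> Q = {}"
    using assms(2) unfolding odd_islands_def disjoint_def by blast
  ultimately have "sum f (\<Union>\<O>) = (\<Sum>P\<in>\<O>. sum f P)"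
    by (subst sum.Union_disjoint) auto
  moreover have "even (\<Sum>P\<in>\<O>. sum f P) \<longleftrightarrow> even (card {P\<in>\<O>. odd (sum f P)})"
    using \<open>finite \<O>\<close> by (simp add: even_sum_iff)
  moreover have "{P\<in>\<O>. odd (sum f P)} = \<O>"
    using assms(2) unfolding odd_islands_def by blast
  ultimately show ?thesis by simp
qed

lemma closed_Diff:
  assumes "sym E" "E `` U \<inter> W \<subseteq> U"
  shows "E `` (W - U) \<inter> W \<subseteq> W - U"
  using assms unfolding sym_def by blast

lemma odd_islands_Union_closed:
  assumes "odd_islands E f W \<O>"
  shows "E `` (\<Union>\<O>) \<inter> W \<subseteq> \<Union>\<O>"
  using odd_islandsD(4)[OF assms] by blast

text \<open>
What a family of odd islands leaves uncovered is again closed under adjacency. If its weight is odd,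
it is an island too.
\<close>

lemma odd_islands_insert_rest:
  assumes "sym E" "odd_islands E f W \<O>" "odd (sum f (W - \<Union>\<O>))"
  shows "odd_islands E f W (insert (W - \<Union>\<O>) \<O>)" "W - \<Union>\<O> \<notin> \<O>"
proof -
  have "W - \<Union>\<O> \<noteq> {}" using assms(3) by force
  then show "W - \<Union>\<O> \<notin> \<O>" by blast
  have "E `` (W - \<Union>\<O>) \<inter> W \<subseteq> W - \<Union>\<O>"
    by (rule closed_Diff[OF assms(1) odd_islands_Union_closed[OF assms(2)]])
  moreover have "disjoint (insert (W - \<Union>\<O>) \<O>)"
    using odd_islandsD(2)[OF assms(2)] by (auto simp: disjoint_def)
  ultimately show "odd_islands E f W (insert (W - \<Union>\<O>) \<O>)"
    using odd_islandsD(1,3,4)[OF assms(2)] assms(3) by (intro odd_islandsI) blast+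
qed

text \<open>
Barriers can be nested: inside a closed set \<open>U\<close>, deleting a further set \<open>X\<close> produces islands of \<open>U - X\<close>,
and these coexist with the islands that avoid \<open>U\<close>. The islands in \<open>U\<close> may come from another
weight \<open>g\<close>; only their parities with respect to \<open>f\<close> matter.
\<close>

lemma odd_islands_refine:
  assumes isl: "odd_islands E f W \<O>" and Q: "odd_islands E g (U - X) \<Q>"
    and odd: "\<And>P. P \<in> \<Q> \<Longrightarrow> odd (sum f P)"
    and U: "U \<subseteq> W" "X \<subseteq> U" "E `` U \<inter> W \<subseteq> U" and sub: "\<O>' \<subseteq> \<O>" "U \<inter> \<Union>\<O>' = {}"
  shows "odd_islands E f (W - X) (\<O>' \<union> \<Q>)" "\<O>' \<inter> \<Q> = {}"
proof -
  have QU: "\<Union>\<Q> \<subseteq> U" using odd_islandsD(1)[OF Q] by blast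
  have disj: "\<Union>\<O>' \<inter> \<Union>\<Q> = {}" using QU sub(2) by blast
  show "\<O>' \<inter> \<Q> = {}"
  proof (rule ccontr)
    assume "\<O>' \<inter> \<Q> \<noteq> {}"
    then obtain P where P: "P \<in> \<O>'" "P \<in> \<Q>" by blast
    then have "P = {}" using disj by blast
    then show False using odd[OF P(2)] by simp
  qed
  show "odd_islands E f (W - X) (\<O>' \<union> \<Q>)"
  proof (rule odd_islandsI)
    have "\<Union>\<O>' \<subseteq> W" using odd_islandsD(1)[OF isl] sub(1) by (meson Union_mono subset_trans)
    then show "\<Union>(\<O>' \<union> \<Q>) \<subseteq> W - X" using odd_islandsD(1)[OF Q] U(1,2) sub(2) by blast
    have "disjoint \<O>'" using odd_islandsD(2)[OF isl] sub(1) by (rule pairwise_subset)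
    then show "disjoint (\<O>' \<union> \<Q>)" using odd_islandsD(2)[OF Q] disj by (rule disjoint_union)
  next
    fix P assume P: "P \<in> \<O>' \<union> \<Q>"
    show "odd (sum f P)" using P odd odd_islandsD(3)[OF isl] sub(1) by blast
    show "E `` P \<inter> (W - X) \<subseteq> P"
    proof (cases "P \<in> \<Q>")
      case True
      then have "E `` P \<subseteq> E `` U" using QU by (intro Image_mono) auto
      then have "E `` P \<inter> (W - X) \<subseteq> E `` P \<inter> (U - X)" using U(3) by blast
      also have "\<dots> \<subseteq> P" by (rule odd_islandsD(4)[OF Q True])
      finally show ?thesis .
    next
      case False
      then have "E `` P \<inter> W \<subseteq> P" using P sub(1) odd_islandsD(4)[OF isl] by blast
      then show ?thesis by blast
    qed
  qed
qed

lemma odd_islands_rest_odd: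
  assumes "finite W" "odd_islands E f W \<O>" "odd (sum f W + card \<O>)"
  shows "odd (sum f (W - \<Union>\<O>))"
proof -
  have "sum f W = sum f (W - \<Union>\<O>) + sum f (\<Union>\<O>)"
    using assms(1) odd_islandsD(1)[OF assms(2)] by (simp add: sum.subset_diff)
  then show ?thesis using odd_islands_sum_parity[OF assms(1,2)] assms(3) by (metis even_add)
qed

text \<open>
The number of odd islands has the parity of the total weight unless the uncovered rest is itself
odd, so a wrong parity can always be repaired by one more island.
\<close>

lemma odd_islands_extend:
  assumes "sym E" "finite W" "odd_islands E f W \<O>" "odd (sum f W + card \<O>)"
  obtains \<O>' where "odd_islands E f W \<O>'" "card \<O>' = Suc (card \<O>)"
proof -
  from odd_islands_insert_rest[OF assms(1,3) odd_islands_rest_odd[OF assms(2-4)]]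
  have "odd_islands E f W (insert (W - \<Union>\<O>) \<O>)"
    "card (insert (W - \<Union>\<O>) \<O>) = Suc (card \<O>)"
    using odd_islands_finite[OF assms(2,3)] by (simp_all add: card_insert_if)
  then show thesis by (rule that)
qed

text \<open>
Nonemptiness of \<open>S\<close> matters: the induction passes to subsets of \<open>V - S\<close>, which have to be smaller.
\<close>

definition tight_barrier ::
    "('v \<times> 'v) set \<Rightarrow> ('v \<Rightarrow> nat) \<Rightarrow> 'v set \<Rightarrow> 'v set \<Rightarrow> 'v set set \<Rightarrow> bool" where
  "tight_barrier E f V S \<O> \<longleftrightarrow>
     S \<subseteq> V \<and> S \<noteq> {} \<and> odd_islands E f (V - S) \<O> \<and> card \<O> = sum f S"

lemma tight_barrierD:
  assumes "tight_barrier E f V S \<O>"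
  shows "S \<subseteq> V" "S \<noteq> {}" "odd_islands E f (V - S) \<O>" "card \<O> = sum f S"
  using assms unfolding tight_barrier_def by blast+

lemma parity_toughD:
  assumes "parity_tough E f V" "S \<subseteq> V" "odd_islands E f (V - S) \<O>"
  shows "card \<O> \<le> sum f S"
  using assms unfolding parity_tough_def by blast

text \<open>
The case \<open>S = {}\<close> of the condition.
\<close>

lemma parity_tough_even:
  assumes "parity_tough E f V"
  shows "even (sum f V)"
proof (rule ccontr)
  assume "odd (sum f V)"
  then have "odd_islands E f (V - {}) {V}"
    by (auto simp: odd_islands_def disjoint_def)
  then have "card {V} \<le> sum f {}"
    by (intro parity_toughD[OF assms]) auto
  then show False by simp
qed

text \<open>
Source of tight barriers. Lowering \<open>f w\<close> by \<open>2\<close> preserves all parities; if this destroys the condition,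
then the violating set contains \<open>w\<close> and misses tightness for \<open>f\<close> by at most one island, which parity
supplies. For \<open>f w = 1\<close> the set \<open>{w}\<close> is tight, since the rest has odd weight.
\<close>

lemma parity_tough_tight:
  assumes "sym E" "finite V" "parity_tough E f V" "w \<in> V" "0 < f w"
    and step: "f w = 1 \<or> \<not> parity_tough E (f(w := f w - 2)) V"
  obtains S \<O> where "tight_barrier E f V S \<O>"
proof (cases "f w = 1")
  case True
  have "sum f V = f w + sum f (V - {w})" using assms(2,4) by (simp add: sum.remove)
  then have "odd (sum f (V - {w}))" using parity_tough_even[OF assms(3)] True by simp
  then have "tight_barrier E f V {w} {V - {w}}"
    using True assms(4) by (auto simp: tight_barrier_def odd_islands_def disjoint_def)
  then show thesis by (rule that)
next
  case False
  let ?g = "f(w := f w - 2)"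
  have "2 \<le> f w" using assms(5) False by simp
  then have upd: "sum f X = sum ?g X + (if w \<in> X then 2 else 0)" if "X \<subseteq> V" for X
    using sum_fun_upd_diff[OF finite_subset[OF that assms(2)]] by blast
  obtain S \<O> where S: "S \<subseteq> V" "odd_islands E ?g (V - S) \<O>" "\<not> card \<O> \<le> sum ?g S"
    using step False unfolding parity_tough_def by blast
  have "odd (sum f P)" if "P \<in> \<O>" for P
  proof -
    have "P \<subseteq> V" using odd_islandsD(5)[OF S(2) that] by blast
    from upd[OF this] show ?thesis using odd_islandsD(3)[OF S(2) that] by auto
  qed
  then have isl: "odd_islands E f (V - S) \<O>"
    using odd_islandsD[OF S(2)] by (intro odd_islandsI) auto
  have le: "card \<O> \<le> sum f S" by (rule parity_toughD[OF assms(3) S(1) isl])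
  have "w \<in> S" using upd[OF S(1)] S(3) le by (auto split: if_splits)
  then have ne: "S \<noteq> {}" by blast
  show thesis
  proof (cases "card \<O> = sum f S")
    case True
    then have "tight_barrier E f V S \<O>" using isl S(1) ne unfolding tight_barrier_def by simp
    then show thesis by (rule that)
  next
    case False
    then have card: "Suc (card \<O>) = sum f S" using le upd[OF S(1)] S(3) \<open>w \<in> S\<close> by simp
    have "sum f V = sum f (V - S) + sum f S" using S(1) assms(2) by (simp add: sum.subset_diff)
    then have "odd (sum f (V - S) + card \<O>)"
      using parity_tough_even[OF assms(3)] card by (metis even_Suc even_add)
    then obtain \<O>' where "odd_islands E f (V - S) \<O>'" "card \<O>' = Suc (card \<O>)"
      using odd_islands_extend[OF assms(1) _ isl] assms(2) by blast
    then have "tight_barrier E f V S \<O>'" using card S(1) ne unfolding tight_barrier_def by simp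
    then show thesis by (rule that)
  qed
qed

text \<open>
Maximality of \<open>S\<close> makes the islands behave well under further deletions. Minimality of the covered
set makes each island connected.
\<close>

definition optimal_barrier ::
    "('v \<times> 'v) set \<Rightarrow> ('v \<Rightarrow> nat) \<Rightarrow> 'v set \<Rightarrow> 'v set \<Rightarrow> 'v set set \<Rightarrow> bool" where
  "optimal_barrier E f V S \<O> \<longleftrightarrow> tight_barrier E f V S \<O> \<and>
     (\<forall>S' \<O>'. tight_barrier E f V S' \<O>' \<longrightarrow>
        card S' \<le> card S \<and> (S' = S \<longrightarrow> card (\<Union>\<O>) \<le> card (\<Union>\<O>')))"

lemma optimal_barrierD:
  assumes "optimal_barrier E f V S \<O>"
  shows "tight_barrier E f V S \<O>" "tight_barrier E f V S' \<O>' \<Longrightarrow> card S' \<le> card S"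
    "tight_barrier E f V S \<O>' \<Longrightarrow> card (\<Union>\<O>) \<le> card (\<Union>\<O>')"
  using assms unfolding optimal_barrier_def by blast+

lemma optimal_barrier_exists:
  assumes "finite V" "tight_barrier E f V S\<^sub>0 \<O>\<^sub>0"
  obtains S \<O> where "optimal_barrier E f V S \<O>"
proof -
  define P where "P S \<longleftrightarrow> (\<exists>\<O>. tight_barrier E f V S \<O>)" for S
  have "\<forall>S. P S \<longrightarrow> card S < Suc (card V)"
    using assms(1) unfolding P_def by (auto simp: tight_barrier_def card_mono less_Suc_eq_le)
  then obtain S where S: "P S" "\<forall>S'. P S' \<longrightarrow> card S' \<le> card S"
    using ex_has_greatest_nat[of P S\<^sub>0 card "Suc (card V)"] assms(2) unfolding P_def by blast
  define Q where "Q = tight_barrier E f V S"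
  obtain \<O>\<^sub>1 where "Q \<O>\<^sub>1" using S(1) unfolding P_def Q_def by blast
  then obtain \<O> where "Q \<O>" "\<forall>\<O>'. Q \<O>' \<longrightarrow> card (\<Union>\<O>) \<le> card (\<Union>\<O>')"
    using ex_has_least_nat[of Q \<O>\<^sub>1 "\<lambda>\<O>. card (\<Union>\<O>)"] by blast
  then have "optimal_barrier E f V S \<O>"
    using S(2) unfolding optimal_barrier_def P_def Q_def by blast
  then show thesis by (rule that)
qed

text \<open>
The islands of \<open>S\<close> use up the whole budget \<open>f(S)\<close>, so further deletions \<open>X\<close> outside them obey the condition on their own.
\<close>

lemma parity_tough_rest:
  assumes "sym E" "finite V" "parity_tough E f V" "tight_barrier E f V S \<O>"
  shows "parity_tough E f (V - S - \<Union>\<O>)"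
  unfolding parity_tough_def
proof (intro allI impI)
  let ?R = "V - S - \<Union>\<O>"
  fix X \<Q>
  assume X: "X \<subseteq> ?R" and Q: "odd_islands E f (?R - X) \<Q>"
  note S = tight_barrierD[OF assms(4)]
  have closed: "E `` ?R \<inter> (V - S) \<subseteq> ?R"
    by (intro closed_Diff odd_islands_Union_closed[OF S(3)] assms(1))
  have "?R \<inter> \<Union>\<O> = {}" "?R \<subseteq> V - S" by blast+
  note ref = odd_islands_refine[OF S(3) Q odd_islandsD(3)[OF Q] this(2) X closed order_refl this(1)]
  have VSX: "V - S - X = V - (S \<union> X)" "S \<union> X \<subseteq> V" "S \<inter> X = {}" using X S(1) by blast+
  have fin: "finite S" "finite X" using finite_subset[OF VSX(2) assms(2)] by simp_all
  have "card (\<O> \<union> \<Q>) \<le> sum f (S \<union> X)"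
    using parity_toughD[OF assms(3) VSX(2)] ref(1) VSX(1) by simp
  moreover have "finite \<O>" "finite \<Q>"
    using odd_islands_finite[OF _ S(3)] odd_islands_finite[OF _ Q] assms(2) by auto
  ultimately have "card \<O> + card \<Q> \<le> sum f S + sum f X"
    using fin VSX(3) ref(2) by (simp add: card_Un_disjoint sum.union_disjoint)
  then show "card \<Q> \<le> sum f X" using S(4) by simp
qed

text \<open>
Deleting \<open>X \<subseteq> C\<close> in addition to \<open>S\<close> trades the island \<open>C\<close> for the islands \<open>\<Q>\<close> of \<open>C - X\<close>.
\<close>

lemma tight_barrier_replace_island:
  assumes "finite V" "tight_barrier E f V S \<O>" "C \<in> \<O>"
    and X: "X \<subseteq> C" and Q: "odd_islands E f (C - X) \<Q>"
  shows "odd_islands E f (V - (S \<union> X)) ((\<O> - {C}) \<union> \<Q>)"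
    and "card ((\<O> - {C}) \<union> \<Q>) + 1 = sum f S + card \<Q>"
    and "sum f (S \<union> X) = sum f S + sum f X" and "S \<inter> X = {}"
proof -
  note S = tight_barrierD[OF assms(2)]
  note C = odd_islandsD(5,4)[OF S(3) assms(3)]
  have finC: "finite C" and fin: "finite S" "finite X"
    using C(1) S(1) X assms(1) by (meson finite_Diff finite_subset)+
  show SX: "S \<inter> X = {}" using C(1) X by blast
  then show "sum f (S \<union> X) = sum f S + sum f X" using fin by (simp add: sum.union_disjoint)
  have disj: "C \<inter> \<Union>(\<O> - {C}) = {}"
    using odd_islandsD(2)[OF S(3)] assms(3) unfolding disjoint_def by blast
  note ref = odd_islands_refine[OF S(3) Q odd_islandsD(3)[OF Q] C(1) X C(2) Diff_subset disj]
  have "V - S - X = V - (S \<union> X)" by blast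
  then show "odd_islands E f (V - (S \<union> X)) ((\<O> - {C}) \<union> \<Q>)" using ref(1) by simp
  have "finite \<O>" "finite \<Q>"
    using odd_islands_finite[OF _ S(3)] odd_islands_finite[OF _ Q] assms(1) finC by auto
  then have "card ((\<O> - {C}) \<union> \<Q>) = card (\<O> - {C}) + card \<Q>"
    using ref(2) by (simp add: card_Un_disjoint)
  moreover have "card (\<O> - {C}) + 1 = card \<O>"
    using \<open>finite \<O>\<close> assms(3) by (metis Suc_eq_plus1 card.remove)
  ultimately show "card ((\<O> - {C}) \<union> \<Q>) + 1 = sum f S + card \<Q>" using S(4) by simp
qed

text \<open>
The condition alone would give only \<open>card \<Q> \<le> f(X) + 1\<close>. The value \<open>f(X) + 1\<close> would make \<open>S \<union> X\<close> a
larger tight barrier, and the value \<open>f(X)\<close> has the wrong parity, so it could be raised to \<open>f(X) + 1\<close>.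
\<close>

lemma optimal_barrier_island_strict:
  assumes "sym E" "finite V" "parity_tough E f V" and opt: "optimal_barrier E f V S \<O>"
    and "C \<in> \<O>" and X: "X \<subseteq> C" "X \<noteq> {}" and Q: "odd_islands E f (C - X) \<Q>"
  shows "card \<Q> < sum f X"
proof -
  note tight = optimal_barrierD(1)[OF opt]
  note S = tight_barrierD[OF tight]
  note C = odd_islandsD(5,3)[OF S(3) assms(5)]
  have fin: "finite S" "finite X" "finite C"
    using S(1) X C(1) assms(2) by (meson finite_Diff finite_subset)+
  have sub: "S \<union> X \<subseteq> V" using S(1) X C(1) by blast
  have main: "card \<Q>' < sum f X + 1" if Q': "odd_islands E f (C - X) \<Q>'" for \<Q>'
  proof -
    note rep = tight_barrier_replace_island[OF assms(2) tight assms(5) X(1) Q']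
    have "card ((\<O> - {C}) \<union> \<Q>') \<noteq> sum f (S \<union> X)"
    proof
      assume "card ((\<O> - {C}) \<union> \<Q>') = sum f (S \<union> X)"
      then have "tight_barrier E f V (S \<union> X) ((\<O> - {C}) \<union> \<Q>')"
        using rep(1) sub S(2) unfolding tight_barrier_def by simp
      then have "card (S \<union> X) \<le> card S" by (rule optimal_barrierD(2)[OF opt])
      then show False using fin rep(4) X(2) by (simp add: card_Un_disjoint card_0_eq)
    qed
    moreover have "card ((\<O> - {C}) \<union> \<Q>') \<le> sum f (S \<union> X)"
      by (rule parity_toughD[OF assms(3) sub rep(1)])
    ultimately show ?thesis using rep(2,3) by linarith
  qed
  have "card \<Q> \<noteq> sum f X"
  proof
    assume eq: "card \<Q> = sum f X"
    have "sum f C = sum f (C - X) + sum f X" using X(1) fin by (simp add: sum.subset_diff)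
    then have "odd (sum f (C - X) + card \<Q>)" using C(2) eq by simp
    then obtain \<Q>' where "odd_islands E f (C - X) \<Q>'" "card \<Q>' = Suc (card \<Q>)"
      using odd_islands_extend[OF assms(1) _ Q] fin by blast
    then show False using main[of \<Q>'] eq by simp
  qed
  then show ?thesis using main[OF Q] by simp
qed

text \<open>
If a proper part \<open>Q\<close> of \<open>C\<close> were closed, then \<open>Q\<close> or \<open>C - Q\<close> would have odd weight and
could replace \<open>C\<close> as a smaller island.
\<close>

lemma optimal_barrier_island_connected:
  assumes "sym E" "finite V" and opt: "optimal_barrier E f V S \<O>" and "C \<in> \<O>"
    and Q: "Q \<subseteq> C" "Q \<noteq> {}" "E `` Q \<inter> C \<subseteq> Q"
  shows "Q = C"
proof (rule ccontr)
  assume "Q \<noteq> C"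
  note tight = optimal_barrierD(1)[OF opt]
  note S = tight_barrierD[OF tight]
  note C = odd_islandsD(5,3)[OF S(3) assms(4)]
  have finU: "finite (\<Union>\<O>)"
    using finite_subset[OF odd_islandsD(1)[OF S(3)]] assms(2) by simp
  have even: "even (sum f P)" if P: "P \<subseteq> C" "P \<noteq> C" "E `` P \<inter> C \<subseteq> P" for P
  proof (rule ccontr)
    assume odd: "odd (sum f P)"
    have islP: "odd_islands E f (C - {}) {P}"
      by (rule odd_islandsI) (use P odd in simp_all)
    note rep = tight_barrier_replace_island[OF assms(2) tight assms(4) empty_subsetI islP]
    have "tight_barrier E f V S ((\<O> - {C}) \<union> {P})"
      using rep(1,2) S unfolding tight_barrier_def by simp
    then have "card (\<Union>\<O>) \<le> card (\<Union>((\<O> - {C}) \<union> {P}))" by (rule optimal_barrierD(3)[OF opt])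
    moreover have "\<Union>((\<O> - {C}) \<union> {P}) \<subset> \<Union>\<O>"
    proof -
      define A where "A = \<Union>(\<O> - {C})"
      have "C \<inter> A = {}"
        using odd_islandsD(2)[OF S(3)] assms(4) unfolding disjoint_def A_def by blast
      moreover have "\<not> C \<subseteq> P" using P(1,2) by (metis subset_antisym)
      ultimately have "A \<union> P \<subset> A \<union> C" using P(1) by blast
      moreover have "\<Union>((\<O> - {C}) \<union> {P}) = A \<union> P" unfolding A_def by (simp add: Un_commute)
      moreover have "\<Union>\<O> = A \<union> C"
        using insert_Diff[OF assms(4)] unfolding A_def by (metis Union_insert Un_commute)
      ultimately show ?thesis by simp
    qed
    ultimately show False using psubset_card_mono[OF finU] by (meson not_less)
  qed
  have "E `` (C - Q) \<inter> C \<subseteq> C - Q" by (rule closed_Diff[OF assms(1) Q(3)])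
  moreover have "C - Q \<noteq> C" using Q(1,2) by auto
  ultimately have "even (sum f (C - Q))" by (intro even Diff_subset)
  moreover have "even (sum f Q)" by (rule even[OF Q(1) \<open>Q \<noteq> C\<close> Q(3)])
  moreover have "sum f C = sum f (C - Q) + sum f Q"
    using Q(1) C(1) assms(2) by (metis finite_Diff finite_subset sum.subset_diff)
  ultimately show False using C(2) by simp
qed

text \<open>
One edge from \<open>c\<close> to \<open>S\<close> is going to be chosen, so inside \<open>C\<close> the demand at \<open>c\<close> drops by one. Only the island
that contains \<open>c\<close> changes its parity, and the strict inequality above absorbs it. For
\<open>X = {}\<close> the connectedness of \<open>C\<close> is used: its weight has become even.
\<close>

lemma parity_tough_island:
  assumes "sym E" "finite V" "parity_tough E f V" and opt: "optimal_barrier E f V S \<O>"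
    and "C \<in> \<O>" and c: "c \<in> C" "0 < f c"
  shows "parity_tough E (f(c := f c - 1)) C"
  unfolding parity_tough_def
proof (intro allI impI)
  let ?g = "f(c := f c - 1)"
  fix X \<Q>
  assume X: "X \<subseteq> C" and Q: "odd_islands E ?g (C - X) \<Q>"
  note C = odd_islandsD(5,3)[OF tight_barrierD(3)[OF optimal_barrierD(1)[OF opt]] assms(5)]
  have finC: "finite C" using C(1) assms(2) by (meson finite_Diff finite_subset)
  have "1 \<le> f c" using c(2) by simp
  then have upd: "sum f Y = sum ?g Y + (if c \<in> Y then 1 else 0)" if "Y \<subseteq> C" for Y
    using sum_fun_upd_diff[OF finite_subset[OF that finC]] by blast
  note Qsub = odd_islandsD(5)[OF Q]
  show "card \<Q> \<le> sum ?g X"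
  proof (cases "X = {}")
    case True
    have "P \<notin> \<Q>" for P
    proof
      assume P: "P \<in> \<Q>"
      have "P \<noteq> {}" using odd_islandsD(3)[OF Q P] by auto
      then have "P = C"
        using odd_islandsD(4,5)[OF Q P] True
        by (intro optimal_barrier_island_connected[OF assms(1,2) opt assms(5)]) auto
      then show False using odd_islandsD(3)[OF Q P] upd[of C] C(2) c(1) by simp
    qed
    then have "\<Q> = {}" by blast
    then show ?thesis by simp
  next
    case False
    define \<Q>' where "\<Q>' = {P \<in> \<Q>. c \<notin> P}"
    have "odd_islands E f (C - X) \<Q>'"
    proof (rule odd_islandsI)
      show "\<Union>\<Q>' \<subseteq> C - X" using Qsub unfolding \<Q>'_def by blast
      have "\<Q>' \<subseteq> \<Q>" unfolding \<Q>'_def by blast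
      then show "disjoint \<Q>'" by (rule pairwise_subset[OF odd_islandsD(2)[OF Q]])
      fix P assume P: "P \<in> \<Q>'"
      then have PQ: "P \<in> \<Q>" "c \<notin> P" unfolding \<Q>'_def by auto
      show "E `` P \<inter> (C - X) \<subseteq> P" by (rule odd_islandsD(4)[OF Q PQ(1)])
      have "P \<subseteq> C" using Qsub[OF PQ(1)] by blast
      then show "odd (sum f P)" using odd_islandsD(3)[OF Q PQ(1)] upd PQ(2) by simp
    qed
    then have less: "card \<Q>' < sum f X"
      by (rule optimal_barrier_island_strict[OF assms(1-3) opt assms(5) X False])
    have finQ: "finite \<Q>" using odd_islands_finite[OF _ Q] finC by blast
    show ?thesis
    proof (cases "c \<in> X")
      case True
      then have "\<Q>' = \<Q>" using Qsub unfolding \<Q>'_def by blast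
      then show ?thesis using less upd[OF X] True by simp
    next
      case False
      have "P = P'" if "P \<in> \<Q> - \<Q>'" "P' \<in> \<Q> - \<Q>'" for P P'
        using odd_islandsD(2)[OF Q] that unfolding disjoint_def \<Q>'_def by blast
      then have "card (\<Q> - \<Q>') \<le> 1"
        using finQ by (metis (no_types, lifting) card_le_Suc0_iff_eq finite_Diff One_nat_def)
      moreover have "card \<Q> = card \<Q>' + card (\<Q> - \<Q>')"
      proof -
        have "\<Q>' \<subseteq> \<Q>" unfolding \<Q>'_def by blast
        then show ?thesis using finQ by (simp add: card_Diff_subset card_mono finite_subset)
      qed
      ultimately show ?thesis using less upd[OF X] False by simp
    qed
  qed
qed

section \<open>The parity factor theorem\<close>

text \<open>
A zero demand forces an isolated vertex, and an odd demand a positive degree.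
\<close>

definition parity_factor :: "('v \<times> 'v) set \<Rightarrow> ('v \<Rightarrow> nat) \<Rightarrow> 'v set \<Rightarrow> ('v \<times> 'v) set \<Rightarrow> bool" where
  "parity_factor E f V H \<longleftrightarrow> H \<subseteq> E \<inter> V \<times> V \<and> sym H \<and>
     (\<forall>v\<in>V. card (H `` {v}) \<le> f v \<and> (even (card (H `` {v})) \<longleftrightarrow> even (f v)))"

text \<open>
Islands that have only \<open>N \<subseteq> S\<close> as neighbours in \<open>S\<close> remain islands when just \<open>N\<close> is deleted, so the
condition for \<open>N\<close> is Hall's condition. Tightness turns the capacity bounds into equalities.
\<close>

lemma tight_barrier_matching:
  assumes "finite V" "parity_tough E f V" "tight_barrier E f V S \<O>"
  obtains \<phi> where "\<forall>C\<in>\<O>. \<phi> C \<in> E `` C \<inter> S"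
    "\<forall>s\<in>S. card {C \<in> \<O>. \<phi> C = s} = f s"
proof -
  note S = tight_barrierD[OF assms(3)]
  have finS: "finite S" by (rule finite_subset[OF S(1) assms(1)])
  have finO: "finite \<O>" using odd_islands_finite[OF _ S(3)] assms(1) by simp
  let ?N = "\<lambda>C. E `` C \<inter> S"
  have "card T \<le> sum f (\<Union>(?N ` T))" if T: "T \<subseteq> \<O>" for T
  proof (rule parity_toughD[OF assms(2)])
    show "\<Union>(?N ` T) \<subseteq> V" using S(1) by blast
    show "odd_islands E f (V - \<Union>(?N ` T)) T"
    proof (rule odd_islandsI)
      show "\<Union>T \<subseteq> V - \<Union>(?N ` T)" using odd_islandsD(1)[OF S(3)] T by blast
      show "disjoint T" using pairwise_subset[OF odd_islandsD(2)[OF S(3)] T] .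
      fix P assume "P \<in> T"
      then have P: "P \<in> \<O>" using T by blast
      show "odd (sum f P)" by (rule odd_islandsD(3)[OF S(3) P])
      show "E `` P \<inter> (V - \<Union>(?N ` T)) \<subseteq> P" using odd_islandsD(4)[OF S(3) P] \<open>P \<in> T\<close> by blast
    qed
  qed
  then obtain \<phi> where \<phi>: "\<forall>C\<in>\<O>. \<phi> C \<in> ?N C" "\<forall>s\<in>S. card {C \<in> \<O>. \<phi> C = s} \<le> f s"
    using capacity_marriage[OF finO finS, of ?N f] by blast
  have "card \<O> = (\<Sum>s\<in>S. card {C \<in> \<O>. \<phi> C = s})"
    using \<phi>(1) finO finS by (subst card_eq_sum, subst sum.group[symmetric, of _ S \<phi>]) auto
  then have "(\<Sum>s\<in>S. card {C \<in> \<O>. \<phi> C = s}) = sum f S" using S(4) by simp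
  then have "card {C \<in> \<O>. \<phi> C = s} = f s" if "s \<in> S" for s
    using sum_mono_inv[of "\<lambda>s. card {C \<in> \<O>. \<phi> C = s}" S f s] \<phi>(2) that finS by simp
  then show thesis using \<phi>(1) by (intro that[of \<phi>]) auto
qed

text \<open>
Each island \<open>C\<close> sends the edge from \<open>c C\<close> to \<open>\<phi> C\<close>. This adds the missing unit at \<open>c C\<close> and gives every \<open>s \<in> S\<close>
exactly the degree \<open>f s\<close>.
\<close>

lemma parity_factor_glue:
  assumes "sym E" "finite V" and tight: "tight_barrier E f V S \<O>"
    and R: "parity_factor E f (V - S - \<Union>\<O>) H\<^sub>R"
    and C: "\<And>C. C \<in> \<O> \<Longrightarrow> c C \<in> C" "\<And>C. C \<in> \<O> \<Longrightarrow> (c C, \<phi> C) \<in> E" "\<And>C. C \<in> \<O> \<Longrightarrow> \<phi> C \<in> S"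
    and f1: "\<And>C. C \<in> \<O> \<Longrightarrow> 0 < f (c C)"
    and HC: "\<And>C. C \<in> \<O> \<Longrightarrow> parity_factor E (f(c C := f (c C) - 1)) C (K C)"
    and deg: "\<And>s. s \<in> S \<Longrightarrow> card {C \<in> \<O>. \<phi> C = s} = f s"
  shows "\<exists>H. parity_factor E f V H"
proof -
  note S = tight_barrierD[OF tight]
  have CV: "C \<subseteq> V" "C \<inter> S = {}" if "C \<in> \<O>" for C
    using odd_islandsD(5)[OF S(3) that] by auto
  have finC: "finite C" if "C \<in> \<O>" for C using finite_subset[OF CV(1)[OF that] assms(2)] .
  have same: "C = D" if "C \<in> \<O>" "D \<in> \<O>" "v \<in> C" "v \<in> D" for C D v
    using odd_islandsD(2)[OF S(3)] that unfolding disjoint_def by blast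
  have KC: "K C \<subseteq> E \<inter> C \<times> C" "sym (K C)" if "C \<in> \<O>" for C
    using HC[OF that] unfolding parity_factor_def by auto
  have HR: "H\<^sub>R \<subseteq> E \<inter> (V - S - \<Union>\<O>) \<times> (V - S - \<Union>\<O>)" "sym H\<^sub>R"
    using R unfolding parity_factor_def by auto
  define M where "M = (\<lambda>C. (c C, \<phi> C)) ` \<O>"
  define H where "H = H\<^sub>R \<union> (\<Union>C\<in>\<O>. K C) \<union> M \<union> M\<inverse>"
  have M: "M \<subseteq> (\<Union>\<O>) \<times> S" using C unfolding M_def by auto
  have UK: "(\<Union>C\<in>\<O>. K C) \<subseteq> (\<Union>\<O>) \<times> (\<Union>\<O>)" using KC(1) by blast
  have US: "\<Union>\<O> \<inter> S = {}" using CV(2) by blast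
  have "M \<subseteq> E" using C(2) unfolding M_def by auto
  have "H \<subseteq> E"
  proof -
    have "M\<inverse> \<subseteq> E" using \<open>M \<subseteq> E\<close> assms(1) by (metis converse_mono sym_conv_converse_eq)
    moreover have "(\<Union>C\<in>\<O>. K C) \<subseteq> E" using KC(1) by blast
    ultimately show ?thesis using \<open>M \<subseteq> E\<close> HR(1) unfolding H_def by simp
  qed
  moreover have "H \<subseteq> V \<times> V"
  proof -
    have "\<Union>\<O> \<subseteq> V" using CV(1) by blast
    then have "M \<subseteq> V \<times> V" "(\<Union>C\<in>\<O>. K C) \<subseteq> V \<times> V" using M UK S(1) by blast+
    moreover from this have "M\<inverse> \<subseteq> V \<times> V" by blast
    moreover have "H\<^sub>R \<subseteq> V \<times> V" using HR(1) by blast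
    ultimately show ?thesis unfolding H_def by simp
  qed
  moreover have "sym H"
  proof -
    have "sym (\<Union>C\<in>\<O>. K C)" using KC(2) by (intro sym_UNION) auto
    moreover have "sym (M \<union> M\<inverse>)" by (rule sym_Un_converse)
    ultimately show ?thesis using HR(2) unfolding H_def by (metis Un_assoc sym_Un)
  qed
  moreover have "card (H `` {v}) \<le> f v \<and> (even (card (H `` {v})) \<longleftrightarrow> even (f v))" if v: "v \<in> V" for v
  proof -
    have Himg: "H `` {v} = H\<^sub>R `` {v} \<union> (\<Union>C\<in>\<O>. K C) `` {v} \<union> M `` {v} \<union> M\<inverse> `` {v}"
      unfolding H_def by (simp add: Un_Image)
    consider "v \<in> S" | "v \<in> V - S - \<Union>\<O>" | D where "D \<in> \<O>" "v \<in> D" using v by blast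
    then show ?thesis
    proof cases
      case 1
      then have "H\<^sub>R `` {v} = {}" "(\<Union>C\<in>\<O>. K C) `` {v} = {}" "M `` {v} = {}"
        using HR(1) UK M US by blast+
      moreover have "M\<inverse> `` {v} = c ` {C \<in> \<O>. \<phi> C = v}" unfolding M_def by auto
      ultimately have "H `` {v} = c ` {C \<in> \<O>. \<phi> C = v}" using Himg by simp
      moreover have "inj_on c \<O>" using same C(1) by (intro inj_onI) metis
      then have "inj_on c {C \<in> \<O>. \<phi> C = v}" by (rule inj_on_subset) blast
      ultimately show ?thesis using deg[OF 1] by (simp add: card_image)
    next
      case 2
      then have "(\<Union>C\<in>\<O>. K C) `` {v} = {}" "M `` {v} = {}" "M\<inverse> `` {v} = {}"
        using UK M by blast+
      then have "H `` {v} = H\<^sub>R `` {v}" using Himg by simp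
      then show ?thesis using R 2 unfolding parity_factor_def by simp
    next
      case 3
      have "H\<^sub>R `` {v} = {}" "M\<inverse> `` {v} = {}" using 3 HR(1) M US by blast+
      moreover have "(\<Union>C\<in>\<O>. K C) `` {v} = K D `` {v}"
        using KC(1) same 3 by blast
      moreover have "M `` {v} = (if v = c D then {\<phi> D} else {})"
      proof -
        have CD: "C = D" if "C \<in> \<O>" "v = c C" for C
          using same[OF that(1) 3(1) _ 3(2)] C(1)[OF that(1)] that(2) by simp
        have "{C \<in> \<O>. c C = v} = (if v = c D then {D} else {})"
        proof (cases "v = c D")
          case True
          then show ?thesis using 3(1) CD by fastforce
        next
          case False
          then show ?thesis using CD by fastforce
        qed
        moreover have "M `` {v} = \<phi> ` {C \<in> \<O>. c C = v}" unfolding M_def by auto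
        ultimately show ?thesis by simp
      qed
      ultimately have H: "H `` {v} = K D `` {v} \<union> (if v = c D then {\<phi> D} else {})"
        using Himg by simp
      have sub: "K D `` {v} \<subseteq> D" using KC(1)[OF 3(1)] by blast
      then have "finite (K D `` {v})" "\<phi> D \<notin> K D `` {v}"
        using finC[OF 3(1)] finite_subset CV(2)[OF 3(1)] C(3)[OF 3(1)] by blast+
      then have "card (H `` {v}) = card (K D `` {v}) + (if v = c D then 1 else 0)"
        unfolding H by (cases "v = c D") simp_all
      moreover have "card (K D `` {v}) \<le> (f(c D := f (c D) - 1)) v"
        "even (card (K D `` {v})) \<longleftrightarrow> even ((f(c D := f (c D) - 1)) v)"
        using HC[OF 3(1)] 3(2) unfolding parity_factor_def by blast+
      ultimately show ?thesis using f1[OF 3(1)] by (cases "v = c D") auto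
    qed
  qed
  ultimately have "parity_factor E f V H" unfolding parity_factor_def by simp
  then show ?thesis ..
qed

text \<open>
A theorem of Tutte type: \<open>f = 1\<close> gives perfect matchings, and a constant odd \<open>f = b\<close> gives
odd \<open>[1,b]\<close>-factors. The proof is by induction on \<open>|V| + f(V)\<close>: vertices of demand \<open>0\<close> are removed and a
demand is lowered by \<open>2\<close> as long as the condition survives. Otherwise there is a tight barrier,
and an optimal one reduces the problem to the islands and to the rest.
\<close>

theorem parity_tough_imp_parity_factor:
  assumes "sym E" "finite V" "parity_tough E f V"
  shows "\<exists>H. parity_factor E f V H"
  using assms(2,3)
proof (induction "card V + sum f V" arbitrary: V f rule: less_induct)
  case less
  note fin = less.prems(1) and tough = less.prems(2)
  consider "V = {}" | v where "v \<in> V" "f v = 0" | w where "w \<in> V" "\<And>v. v \<in> V \<Longrightarrow> 0 < f v"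
    by blast
  then show ?case
  proof cases
    case 1
    then have "parity_factor E f V {}" by (simp add: parity_factor_def sym_def)
    then show ?thesis ..
  next
    case (2 v)
    have "parity_tough E f (V - {v})"
      unfolding parity_tough_def
    proof (intro allI impI)
      fix S \<O> assume S: "S \<subseteq> V - {v}" and isl: "odd_islands E f (V - {v} - S) \<O>"
      have "V - {v} - S = V - insert v S" "insert v S \<subseteq> V" using S 2(1) by blast+
      then have "card \<O> \<le> sum f (insert v S)"
        using parity_toughD[OF tough] isl by metis
      also have "\<dots> = sum f S"
        using 2(2) S finite_subset[OF S] fin by (subst sum.insert) auto
      finally show "card \<O> \<le> sum f S" .
    qed
    moreover have "card (V - {v}) + sum f (V - {v}) < card V + sum f V"
      using card_Diff1_less[OF fin 2(1)] sum.remove[OF fin 2(1), of f] by linarith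
    ultimately obtain H where H: "parity_factor E f (V - {v}) H"
      using less.hyps[of "V - {v}" f] fin by blast
    have "H `` {v} = {}" using H unfolding parity_factor_def by blast
    then have "parity_factor E f V H"
      using H 2(2) unfolding parity_factor_def by auto
    then show ?thesis ..
  next
    case (3 w)
    show ?thesis
    proof (cases "f w \<noteq> 1 \<and> parity_tough E (f(w := f w - 2)) V")
      case True
      let ?g = "f(w := f w - 2)"
      have "2 \<le> f w" using True 3(2)[OF 3(1)] by simp
      then have "sum f V = sum ?g V + 2" using sum_fun_upd_diff[OF fin, of 2 f w] 3(1) by simp
      then obtain H where "parity_factor E ?g V H"
        using less.hyps[of V ?g] fin True by auto
      then have "parity_factor E f V H"
        using \<open>2 \<le> f w\<close> unfolding parity_factor_def by (auto simp: fun_upd_def split: if_splits)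
      then show ?thesis ..
    next
      case False
      then obtain S\<^sub>0 \<O>\<^sub>0 where "tight_barrier E f V S\<^sub>0 \<O>\<^sub>0"
        using parity_tough_tight[OF assms(1) fin tough 3(1) 3(2)[OF 3(1)]] by blast
      then obtain S \<O> where opt: "optimal_barrier E f V S \<O>"
        by (rule optimal_barrier_exists[OF fin])
      note tight = optimal_barrierD(1)[OF opt]
      note S = tight_barrierD[OF tight]
      have smaller: "\<exists>H. parity_factor E g W H"
        if W: "W \<subseteq> V - S" "\<And>v. g v \<le> f v" "parity_tough E g W" for W g
      proof -
        have "W \<subset> V" using W(1) S(1,2) by blast
        then have "card W < card V" "finite W" using fin by (auto intro: psubset_card_mono finite_subset)
        moreover have "sum g W \<le> sum f W" by (rule sum_mono) (rule W(2))
        moreover have "sum f W \<le> sum f V" using \<open>W \<subset> V\<close> fin by (intro sum_mono2) auto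
        ultimately have "card W + sum g W < card V + sum f V" by linarith
        then show ?thesis using \<open>finite W\<close> W(3) by (rule less.hyps)
      qed
      obtain H\<^sub>R where R: "parity_factor E f (V - S - \<Union>\<O>) H\<^sub>R"
        using smaller[of "V - S - \<Union>\<O>" f] parity_tough_rest[OF assms(1) fin tough tight] by blast
      obtain \<phi> where \<phi>: "\<forall>C\<in>\<O>. \<phi> C \<in> E `` C \<inter> S"
        "\<forall>s\<in>S. card {C \<in> \<O>. \<phi> C = s} = f s"
        by (rule tight_barrier_matching[OF fin tough tight])
      have "\<exists>x. x \<in> C \<and> (x, \<phi> C) \<in> E" if "C \<in> \<O>" for C using \<phi>(1) that by blast
      then obtain c where c: "\<And>C. C \<in> \<O> \<Longrightarrow> c C \<in> C" "\<And>C. C \<in> \<O> \<Longrightarrow> (c C, \<phi> C) \<in> E"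
        by metis
      have CV: "C \<subseteq> V - S" if "C \<in> \<O>" for C by (rule odd_islandsD(5)[OF S(3) that])
      have pos: "0 < f (c C)" if "C \<in> \<O>" for C using 3(2) CV[OF that] c(1)[OF that] by blast
      have "\<exists>H. parity_factor E (f(c C := f (c C) - 1)) C H" if "C \<in> \<O>" for C
        using parity_tough_island[OF assms(1) fin tough opt that c(1)[OF that] pos[OF that]]
        by (intro smaller[OF CV[OF that]]) auto
      then obtain K where K: "\<And>C. C \<in> \<O> \<Longrightarrow> parity_factor E (f(c C := f (c C) - 1)) C (K C)"
        by metis
      show ?thesis
        by (rule parity_factor_glue[OF assms(1) fin tight R c _ pos K]) (use \<phi> in auto)
    qed
  qed
qed

section \<open>Rayleigh quotients of symmetric kernels\<close>

definition quad_form :: "('v \<Rightarrow> 'v \<Rightarrow> real) \<Rightarrow> 'v set \<Rightarrow> ('v \<Rightarrow> real) \<Rightarrow> real" where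
  "quad_form D V f = (\<Sum>u\<in>V. \<Sum>v\<in>V. D u v * f u * f v)"

lemma quad_form_scale: "quad_form D V (\<lambda>v. c * f v) = c\<^sup>2 * quad_form D V f"
  unfolding quad_form_def sum_distrib_left
  by (intro sum.cong refl) (simp add: power2_eq_square algebra_simps)

lemma quad_form_cong: "(\<And>v. v \<in> V \<Longrightarrow> f v = g v) \<Longrightarrow> quad_form D V f = quad_form D V g"
  unfolding quad_form_def by (intro sum.cong) auto

lemma quad_form_add:
  assumes "\<And>u v. u \<in> V \<Longrightarrow> v \<in> V \<Longrightarrow> D u v = D v u"
  shows "quad_form D V (\<lambda>v. f v + c * h v) =
    quad_form D V f + 2 * c * (\<Sum>u\<in>V. h u * (\<Sum>v\<in>V. D u v * f v)) + c\<^sup>2 * quad_form D V h"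
proof -
  define s where "s = (\<Sum>u\<in>V. h u * (\<Sum>v\<in>V. D u v * f v))"
  have s1: "(\<Sum>u\<in>V. \<Sum>v\<in>V. D u v * h u * f v) = s"
    unfolding s_def sum_distrib_left by (intro sum.cong refl) simp
  have s2: "(\<Sum>u\<in>V. \<Sum>v\<in>V. D u v * f u * h v) = s"
    unfolding s1[symmetric] by (subst sum.swap) (intro sum.cong refl, simp add: assms)
  have "quad_form D V (\<lambda>v. f v + c * h v) = (\<Sum>u\<in>V. \<Sum>v\<in>V. D u v * f u * f v
      + c * (D u v * f u * h v) + c * (D u v * h u * f v) + c\<^sup>2 * (D u v * h u * h v))"
    unfolding quad_form_def
    by (intro sum.cong refl) (simp add: power2_eq_square algebra_simps)
  also have "\<dots> = quad_form D V f + c * (\<Sum>u\<in>V. \<Sum>v\<in>V. D u v * f u * h v)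
      + c * (\<Sum>u\<in>V. \<Sum>v\<in>V. D u v * h u * f v) + c\<^sup>2 * quad_form D V h"
    by (simp only: sum.distrib quad_form_def sum_distrib_left)
  finally show ?thesis unfolding s1 s2 s_def[symmetric] by simp
qed

text \<open>
Functions \<open>'v \<Rightarrow> real\<close> carry the product topology. Pinning the values outside \<open>V\<close> to \<open>0\<close> makes the box a
product of compact sets, so Tychonoff's theorem applies.
\<close>

lemma compact_box_functions:
  "compact {f :: 'v \<Rightarrow> real. \<forall>v. f v \<in> (if v \<in> V then {-1..1} else {0})}"
proof -
  have "compactin (product_topology (\<lambda>_. euclidean) UNIV)
      (PiE UNIV (\<lambda>v :: 'v. if v \<in> V then {-1..1 :: real} else {0}))"
    by (simp add: compactin_PiE)
  moreover have "PiE UNIV (\<lambda>v :: 'v. if v \<in> V then {-1..1 :: real} else {0}) =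
      {f. \<forall>v. f v \<in> (if v \<in> V then {-1..1} else {0})}"
    by (auto simp: PiE_def Pi_def)
  ultimately show ?thesis by (simp add: euclidean_product_topology)
qed

text \<open>
The unit sphere of functions supported on \<open>V\<close> is compact; scaling extends the bound to all functions.
\<close>

lemma quad_form_max_attained:
  fixes V :: "'v set"
  assumes "finite V" "V \<noteq> {}"
  obtains f \<mu> where "(\<Sum>v\<in>V. (f v)\<^sup>2) = 1" "quad_form D V f = \<mu>"
    "\<And>g. quad_form D V g \<le> \<mu> * (\<Sum>v\<in>V. (g v)\<^sup>2)"
proof -
  define B where "B = {f :: 'v \<Rightarrow> real. \<forall>v. f v \<in> (if v \<in> V then {-1..1} else {0})}"
  define K where "K = B \<inter> {f. (\<Sum>v\<in>V. (f v)\<^sup>2) = 1}"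
  have cont: "continuous_on UNIV (\<lambda>f :: 'v \<Rightarrow> real. f v)" for v by simp
  have "closed {f :: 'v \<Rightarrow> real. (\<Sum>v\<in>V. (f v)\<^sup>2) = 1}"
    by (intro closed_Collect_eq continuous_intros cont)
  then have compact: "compact K"
    unfolding K_def B_def by (intro compact_Int_closed compact_box_functions)
  obtain w where w: "w \<in> V" using assms(2) by blast
  have "(\<Sum>v\<in>V. (if v = w then 1 else 0 :: real)\<^sup>2) = (\<Sum>v\<in>V. if v = w then 1 else 0)"
    by (intro sum.cong) auto
  then have "(\<lambda>v. if v = w then 1 else 0) \<in> K"
    using w assms(1) unfolding K_def B_def by (auto simp: sum.delta)
  then have ne: "K \<noteq> {}" by blast
  have "continuous_on K (quad_form D V)"
    unfolding quad_form_def
    by (intro continuous_intros continuous_on_subset[OF cont]) auto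
  then obtain f where f: "f \<in> K" "\<And>g. g \<in> K \<Longrightarrow> quad_form D V g \<le> quad_form D V f"
    using continuous_attains_sup[OF compact ne] by blast
  have "quad_form D V g \<le> quad_form D V f * (\<Sum>v\<in>V. (g v)\<^sup>2)" for g
  proof (cases "(\<Sum>v\<in>V. (g v)\<^sup>2) = 0")
    case True
    then have "\<And>v. v \<in> V \<Longrightarrow> g v = 0" using assms(1) by (simp add: sum_nonneg_eq_0_iff)
    then have "quad_form D V g = quad_form D V (\<lambda>v. 0)" by (intro quad_form_cong) auto
    then show ?thesis using True by (simp add: quad_form_def)
  next
    case False
    define s where "s = sqrt (\<Sum>v\<in>V. (g v)\<^sup>2)"
    have s2: "s\<^sup>2 = (\<Sum>v\<in>V. (g v)\<^sup>2)" unfolding s_def by (simp add: sum_nonneg)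
    have s0: "s > 0" using False unfolding s_def by (simp add: less_le sum_nonneg)
    define h where "h v = (if v \<in> V then g v / s else 0)" for v
    have hsum: "(\<Sum>v\<in>V. (h v)\<^sup>2) = 1"
    proof -
      have "(\<Sum>v\<in>V. (h v)\<^sup>2) = (\<Sum>v\<in>V. (g v)\<^sup>2 / s\<^sup>2)"
        unfolding h_def by (intro sum.cong) (auto simp: power_divide)
      also have "\<dots> = 1" unfolding sum_divide_distrib[symmetric] s2 using False by simp
      finally show ?thesis .
    qed
    have "\<bar>h v\<bar> \<le> 1" if "v \<in> V" for v
    proof -
      have "(h v)\<^sup>2 \<le> 1" using member_le_sum[of v V "\<lambda>v. (h v)\<^sup>2"] that assms(1) hsum by simp
      then show ?thesis by (simp add: abs_square_le_1)
    qed
    then have "h v \<in> {-1..1}" if "v \<in> V" for v using that abs_le_iff[of "h v" 1] by auto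
    moreover have "h v = 0" if "v \<notin> V" for v using that by (simp add: h_def)
    ultimately have "h \<in> K" using hsum unfolding K_def B_def by simp
    then have "quad_form D V h \<le> quad_form D V f" by (rule f(2))
    moreover have "quad_form D V g = quad_form D V (\<lambda>v. s * h v)"
      using s0 by (intro quad_form_cong) (auto simp: h_def)
    then have "quad_form D V g = s\<^sup>2 * quad_form D V h" by (simp add: quad_form_scale)
    ultimately show ?thesis using s2 by (metis mult.commute mult_left_mono zero_le_power2)
  qed
  then show thesis using f(1) by (intro that[of f "quad_form D V f"]) (auto simp: K_def)
qed

text \<open>
First-order optimality: perturbing \<open>f\<close> by \<open>e\<close> at the vertex \<open>u\<close> changes \<open>quad_form D V f - \<mu> |f|\<^sup>2\<close> by \<open>2 e r + e\<^sup>2 c\<close>,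
where \<open>r\<close> is the defect of the eigenvalue equation at \<open>u\<close>. As this is never positive, \<open>r = 0\<close>.
\<close>

lemma quad_form_maximizer_eigenvector:
  assumes "finite V" and sym: "\<And>u v. u \<in> V \<Longrightarrow> v \<in> V \<Longrightarrow> D u v = D v u"
    and max: "\<And>g. quad_form D V g \<le> \<mu> * (\<Sum>v\<in>V. (g v)\<^sup>2)"
    and eq: "quad_form D V f = \<mu> * (\<Sum>v\<in>V. (f v)\<^sup>2)"
    and "u \<in> V"
  shows "(\<Sum>v\<in>V. D u v * f v) = \<mu> * f u"
proof -
  define r where "r = (\<Sum>v\<in>V. D u v * f v) - \<mu> * f u"
  define h where "h v = (if v = u then 1 else 0 :: real)" for v
  define c where "c = quad_form D V h - \<mu>"
  have h1: "(\<Sum>v\<in>V. h v * g v) = g u" for g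
  proof -
    have "(\<Sum>v\<in>V. h v * g v) = (\<Sum>v\<in>V. if v = u then g v else 0)"
      by (intro sum.cong) (auto simp: h_def)
    then show ?thesis using assms(1,5) by simp
  qed
  \<comment> \<open>Perturb \<open>f\<close> at \<open>u\<close> by \<open>e\<close>.\<close>
  have key: "2 * e * r + e\<^sup>2 * c \<le> 0" for e
  proof -
    have "(\<Sum>v\<in>V. (f v + e * h v)\<^sup>2) =
        (\<Sum>v\<in>V. (f v)\<^sup>2) + 2 * e * (\<Sum>v\<in>V. h v * f v) + e\<^sup>2 * (\<Sum>v\<in>V. h v * h v)"
      by (simp add: power2_eq_square algebra_simps sum.distrib sum_distrib_left)
    also have "\<dots> = (\<Sum>v\<in>V. (f v)\<^sup>2) + 2 * e * f u + e\<^sup>2"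
      unfolding h1 by (simp add: h_def)
    finally have "quad_form D V f + 2 * e * (\<Sum>v\<in>V. D u v * f v) + e\<^sup>2 * quad_form D V h
        \<le> \<mu> * ((\<Sum>v\<in>V. (f v)\<^sup>2) + 2 * e * f u + e\<^sup>2)"
      using max[of "\<lambda>v. f v + e * h v"] quad_form_add[of V D f e h, OF sym] h1 by simp
    then show ?thesis using eq unfolding r_def c_def by (simp add: algebra_simps)
  qed
  \<comment> \<open>With \<open>e = r / k\<close> the linear term dominates, whatever the sign of \<open>c\<close>.\<close>
  define k where "k = \<bar>c\<bar> + 1"
  have k: "k > 0" "2 * k + c > 0" unfolding k_def by auto
  have "k\<^sup>2 * (2 * (r / k) * r + (r / k)\<^sup>2 * c) \<le> 0"
    using key[of "r / k"] by (simp add: mult_le_0_iff)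
  moreover have "k\<^sup>2 * (2 * (r / k) * r + (r / k)\<^sup>2 * c) = r\<^sup>2 * (2 * k + c)"
    using k(1) by (simp add: power2_eq_square field_simps)
  ultimately have "r\<^sup>2 * (2 * k + c) \<le> 0" by linarith
  then have "r\<^sup>2 \<le> 0" using k(2) by (metis mult_le_0_iff not_less zero_le_power2)
  then show ?thesis unfolding r_def by simp
qed

text \<open>
For a nonnegative kernel the absolute values of a maximiser form a maximiser as well. This is the part of the
Perron-Frobenius theorem that is needed here.
\<close>

lemma nonneg_symmetric_principal_eigenvector:
  assumes "finite V" "V \<noteq> {}" and sym: "\<And>u v. u \<in> V \<Longrightarrow> v \<in> V \<Longrightarrow> D u v = D v u"
    and nonneg: "\<And>u v. u \<in> V \<Longrightarrow> v \<in> V \<Longrightarrow> 0 \<le> D u v"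
  obtains f \<mu> where "\<forall>v. 0 \<le> f v" "\<exists>v\<in>V. f v \<noteq> 0"
    "\<forall>u\<in>V. (\<Sum>v\<in>V. D u v * f v) = \<mu> * f u"
    "\<forall>g. quad_form D V g \<le> \<mu> * (\<Sum>v\<in>V. (g v)\<^sup>2)"
proof -
  obtain f \<mu> where f: "(\<Sum>v\<in>V. (f v)\<^sup>2) = 1" "quad_form D V f = \<mu>"
    "\<And>g. quad_form D V g \<le> \<mu> * (\<Sum>v\<in>V. (g v)\<^sup>2)"
    using quad_form_max_attained[OF assms(1,2), of D] by blast
  let ?h = "\<lambda>v. \<bar>f v\<bar>"
  have h1: "(\<Sum>v\<in>V. (?h v)\<^sup>2) = 1" using f(1) by simp
  have "quad_form D V f \<le> quad_form D V ?h"
    unfolding quad_form_def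
    by (intro sum_mono) (metis abs_ge_self abs_mult abs_of_nonneg nonneg)
  then have "quad_form D V ?h = \<mu> * (\<Sum>v\<in>V. (?h v)\<^sup>2)"
    using f(2) f(3)[of ?h] h1 by simp
  then have "(\<Sum>v\<in>V. D u v * ?h v) = \<mu> * ?h u" if "u \<in> V" for u
    by (intro quad_form_maximizer_eigenvector[OF assms(1) sym f(3) _ that]) auto
  moreover have "\<exists>v\<in>V. ?h v \<noteq> 0"
    by (rule ccontr) (use h1 in simp)
  ultimately show thesis using f(3) by (intro that[of ?h \<mu>]) auto
qed

section \<open>The distance spectral radius as a maximal Rayleigh quotient\<close>

text \<open>
Eigenvectors as functions on the vertex set, independent of an enumeration of the vertices.
\<close>

lemma eigenvalue_distance_mat_iff:
  assumes "distinct vs"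
  shows "eigenvalue (distance_mat G vs) k \<longleftrightarrow> (\<exists>f. (\<exists>v\<in>set vs. f v \<noteq> 0) \<and>
    (\<forall>u\<in>set vs. (\<Sum>v\<in>set vs. real (graph_dist G u v) * f v) = k * f u))"
proof -
  let ?n = "length vs" and ?A = "distance_mat G vs"
  have bij: "bij_betw ((!) vs) {..<?n} (set vs)" using assms by (rule bij_betw_nth) auto
  have reindex: "(\<Sum>v\<in>set vs. h v) = (\<Sum>j<?n. h (vs ! j))" for h :: "_ \<Rightarrow> real"
    by (rule sum.reindex_bij_betw[OF bij, symmetric])
  have row: "(?A *\<^sub>v x) $ i = (\<Sum>j<?n. real (graph_dist G (vs ! i) (vs ! j)) * x $ j)"
    if "x \<in> carrier_vec ?n" "i < ?n" for x i
    using that by (simp add: distance_mat_def scalar_prod_def atLeast0LessThan)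
  show ?thesis
  proof
    assume "eigenvalue ?A k"
    then obtain x where x: "x \<in> carrier_vec ?n" "x \<noteq> 0\<^sub>v ?n" "?A *\<^sub>v x = k \<cdot>\<^sub>v x"
      by (auto simp: eigenvalue_def eigenvector_def distance_mat_def)
    define f where "f v = x $ (the_inv_into {..<?n} ((!) vs) v)" for v
    have f: "f (vs ! i) = x $ i" if "i < ?n" for i
      using the_inv_into_f_f[OF bij_betw_imp_inj_on[OF bij]] that unfolding f_def by simp
    have "(\<Sum>v\<in>set vs. real (graph_dist G u v) * f v) = k * f u" if u: "u \<in> set vs" for u
    proof -
      obtain i where i: "i < ?n" "u = vs ! i" using u unfolding in_set_conv_nth by blast
      have "(\<Sum>v\<in>set vs. real (graph_dist G u v) * f v) = (?A *\<^sub>v x) $ i"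
        unfolding reindex row[OF x(1) i(1)] i(2) by (intro sum.cong) (auto simp: f)
      also have "\<dots> = k * f u" using x(1,3) i by (simp add: f)
      finally show ?thesis .
    qed
    moreover have "\<exists>v\<in>set vs. f v \<noteq> 0"
    proof (rule ccontr)
      assume "\<not> ?thesis"
      then have "x $ i = 0" if "i < ?n" for i using f[OF that] that by force
      then have "x = 0\<^sub>v ?n" using x(1) by (intro eq_vecI) auto
      then show False using x(2) by simp
    qed
    ultimately show "\<exists>f. (\<exists>v\<in>set vs. f v \<noteq> 0) \<and>
      (\<forall>u\<in>set vs. (\<Sum>v\<in>set vs. real (graph_dist G u v) * f v) = k * f u)" by blast
  next
    assume "\<exists>f. (\<exists>v\<in>set vs. f v \<noteq> 0) \<and>
      (\<forall>u\<in>set vs. (\<Sum>v\<in>set vs. real (graph_dist G u v) * f v) = k * f u)"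
    then obtain f where f: "\<exists>v\<in>set vs. f v \<noteq> 0"
      "\<forall>u\<in>set vs. (\<Sum>v\<in>set vs. real (graph_dist G u v) * f v) = k * f u" by blast
    define x where "x = vec ?n (\<lambda>i. f (vs ! i))"
    have x: "x \<in> carrier_vec ?n" unfolding x_def by simp
    obtain i where "i < ?n" "f (vs ! i) \<noteq> 0" using f(1) by (metis in_set_conv_nth)
    then have "x $ i \<noteq> 0\<^sub>v ?n $ i" unfolding x_def by simp
    then have "x \<noteq> 0\<^sub>v ?n" by metis
    moreover have "?A *\<^sub>v x = k \<cdot>\<^sub>v x"
    proof (rule eq_vecI)
      fix i assume "i < dim_vec (k \<cdot>\<^sub>v x)"
      then have i: "i < ?n" unfolding x_def by simp
      have "(?A *\<^sub>v x) $ i = (\<Sum>v\<in>set vs. real (graph_dist G (vs ! i) v) * f v)"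
        unfolding reindex row[OF x i] by (intro sum.cong) (auto simp: x_def)
      also have "\<dots> = k * f (vs ! i)" using f(2) i by simp
      finally show "(?A *\<^sub>v x) $ i = (k \<cdot>\<^sub>v x) $ i" using i by (simp add: x_def)
    qed (simp add: distance_mat_def x_def)
    ultimately show "eigenvalue ?A k"
      unfolding eigenvalue_def eigenvector_def using x
      by (intro exI[of _ x]) (simp add: distance_mat_def)
  qed
qed

lemma graph_dist_sym:
  assumes "pair_graph G"
  shows "graph_dist G u v = graph_dist G v u"
proof -
  interpret pair_graph G by (rule assms)
  have len: "length (rev_path p) = length p" for p :: "('a \<times> 'a) list" by (induction p) auto
  have rev: "apath y (rev_path p) x" if "apath x p y" for x p y
    using that awalk_verts_rev_path by (auto simp: apath_def)
  have "(\<exists>p. apath u p v \<and> length p = k) \<longleftrightarrow> (\<exists>p. apath v p u \<and> length p = k)" for k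
    using rev len by metis
  then show ?thesis unfolding graph_dist_def by simp
qed

text \<open>
The maximal Rayleigh quotient is an eigenvalue and bounds every eigenvalue, so it is the distance
spectral radius; it has a nonnegative eigenvector.
\<close>

lemma distance_spectral_radius_principal:
  assumes "pair_graph G" "pverts G \<noteq> {}"
  defines "d \<equiv> \<lambda>u v. real (graph_dist G u v)"
  shows "quad_form d (pverts G) g \<le> distance_spectral_radius G * (\<Sum>v\<in>pverts G. (g v)\<^sup>2)"
    and "\<exists>f. (\<forall>v. 0 \<le> f v) \<and> (\<exists>v\<in>pverts G. f v \<noteq> 0) \<and>
      (\<forall>u\<in>pverts G. (\<Sum>v\<in>pverts G. d u v * f v) = distance_spectral_radius G * f u)"
proof -
  let ?V = "pverts G"
  have fin: "finite ?V" using assms(1) by (simp add: pair_graph_iff)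
  then obtain vs where vs: "distinct vs" "set vs = ?V" by (metis finite_distinct_list)
  have "d u v = d v u" for u v unfolding d_def by (simp add: graph_dist_sym[OF assms(1)])
  moreover have "0 \<le> d u v" for u v unfolding d_def by simp
  ultimately obtain f \<mu> where f: "\<forall>v. 0 \<le> f v" "\<exists>v\<in>?V. f v \<noteq> 0"
    "\<forall>u\<in>?V. (\<Sum>v\<in>?V. d u v * f v) = \<mu> * f u"
    "\<forall>g. quad_form d ?V g \<le> \<mu> * (\<Sum>v\<in>?V. (g v)\<^sup>2)"
    by (rule nonneg_symmetric_principal_eigenvector[OF fin assms(2), of d])
  have ev: "eigenvalue (distance_mat G vs) k \<longleftrightarrow> (\<exists>f. (\<exists>v\<in>?V. f v \<noteq> 0) \<and>
    (\<forall>u\<in>?V. (\<Sum>v\<in>?V. d u v * f v) = k * f u))" for k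
    using eigenvalue_distance_mat_iff[OF vs(1), of G k] unfolding vs(2) d_def .
  have "\<mu> \<in> spectrum (distance_mat G vs)"
    using f(2,3) unfolding spectrum_def mem_Collect_eq ev by blast
  moreover have "k \<le> \<mu>" if "k \<in> spectrum (distance_mat G vs)" for k
  proof -
    obtain h where h: "\<exists>v\<in>?V. h v \<noteq> 0" "\<forall>u\<in>?V. (\<Sum>v\<in>?V. d u v * h v) = k * h u"
      using \<open>k \<in> spectrum _\<close> unfolding spectrum_def mem_Collect_eq ev by blast
    have "quad_form d ?V h = (\<Sum>u\<in>?V. h u * (\<Sum>v\<in>?V. d u v * h v))"
      unfolding quad_form_def sum_distrib_left by (intro sum.cong refl) simp
    also have "\<dots> = (\<Sum>u\<in>?V. h u * (k * h u))" using h(2) by (intro sum.cong refl) simp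
    also have "\<dots> = k * (\<Sum>v\<in>?V. (h v)\<^sup>2)"
      unfolding sum_distrib_left by (intro sum.cong refl) (simp add: power2_eq_square)
    finally have "k * (\<Sum>v\<in>?V. (h v)\<^sup>2) \<le> \<mu> * (\<Sum>v\<in>?V. (h v)\<^sup>2)" using f(4) by (metis (no_types))
    moreover have "(\<Sum>v\<in>?V. (h v)\<^sup>2) > 0"
      using h(1) fin by (metis (no_types, lifting) sum_pos2 zero_le_power2 zero_less_power2)
    ultimately show ?thesis by simp
  qed
  moreover have "finite (spectrum (distance_mat G vs))"
    by (rule card_finite_spectrum[of _ "length vs"]) (simp add: distance_mat_def)
  ultimately have "distance_spectral_radius G = \<mu>"
    unfolding distance_spectral_radius_eq[OF vs] by (intro Max_eqI) auto
  then show "quad_form d ?V g \<le> distance_spectral_radius G * (\<Sum>v\<in>?V. (g v)\<^sup>2)"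
    and "\<exists>f. (\<forall>v. 0 \<le> f v) \<and> (\<exists>v\<in>?V. f v \<noteq> 0) \<and>
      (\<forall>u\<in>?V. (\<Sum>v\<in>?V. d u v * f v) = distance_spectral_radius G * f u)"
    using f by auto
qed

section \<open>Small distances\<close>

lemma graph_dist_self:
  assumes "pair_graph G" "u \<in> pverts G"
  shows "graph_dist G u u = 0"
proof -
  interpret pair_graph G by (rule assms(1))
  have "\<exists>p. apath u p u \<and> length p = 0" using assms(2) by (simp add: apath_Nil_iff)
  then show ?thesis unfolding graph_dist_def by (intro Least_eq_0)
qed

lemma graph_dist_attained:
  assumes "pair_graph G" "reachable (with_proj G) u v"
  obtains p where "pre_digraph.apath (with_proj G) u p v" "length p = graph_dist G u v"
proof -
  interpret pair_graph G by (rule assms(1))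
  obtain p where "apath u p v" using assms(2) by (metis reachable_apath)
  then have "\<exists>k p. apath u p v \<and> length p = k" by blast
  then show thesis using that LeastI_ex[of "\<lambda>k. \<exists>p. apath u p v \<and> length p = k"]
    unfolding graph_dist_def by blast
qed

lemma graph_dist_ge:
  assumes "pair_graph G" "reachable (with_proj G) u v" "u \<noteq> v"
  shows "1 \<le> graph_dist G u v" "(u, v) \<notin> parcs G \<Longrightarrow> 2 \<le> graph_dist G u v"
proof -
  interpret pair_graph G by (rule assms(1))
  obtain p where p: "apath u p v" "length p = graph_dist G u v"
    using graph_dist_attained[OF assms(1,2)] .
  then show 1: "1 \<le> graph_dist G u v" using assms(3) by (cases p) (auto simp: apath_Nil_iff)
  assume uv: "(u, v) \<notin> parcs G"
  have "length p \<noteq> 1"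
  proof
    assume "length p = 1"
    then obtain e where "p = [e]" by (metis One_nat_def length_0_conv length_Suc_conv)
    then show False using p(1) uv by (auto simp: apath_Cons_iff apath_Nil_iff)
  qed
  then show "2 \<le> graph_dist G u v" using 1 p(2) by linarith
qed

lemma graph_dist_arc:
  assumes "pair_graph G" "(u, v) \<in> parcs G"
  shows "graph_dist G u v = 1"
proof -
  interpret pair_graph G by (rule assms(1))
  have ne: "u \<noteq> v" using no_loops' assms(2) by blast
  have path: "apath u [(u, v)] v"
    using assms(2) ne in_arcsD2 by (auto simp: apath_Cons_iff apath_Nil_iff)
  then have "reachable (with_proj G) u v" by (metis reachable_apath)
  then have "1 \<le> graph_dist G u v" using graph_dist_ge(1)[OF assms(1)] ne by blast
  moreover have "graph_dist G u v \<le> 1" unfolding graph_dist_def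
    by (rule Least_le) (use path in force)
  ultimately show ?thesis by simp
qed

lemma graph_dist_two:
  assumes "pair_graph G" "(u, w) \<in> parcs G" "(w, v) \<in> parcs G" "u \<noteq> v" "(u, v) \<notin> parcs G"
  shows "graph_dist G u v = 2"
proof -
  interpret pair_graph G by (rule assms(1))
  have ne: "u \<noteq> w" "w \<noteq> v" using no_loops' assms(2,3) by blast+
  have path: "apath u [(u, w), (w, v)] v"
    using assms ne in_arcsD2 by (auto simp: apath_Cons_iff apath_Nil_iff)
  then have "reachable (with_proj G) u v" by (metis reachable_apath)
  then have "2 \<le> graph_dist G u v" using graph_dist_ge(2)[OF assms(1)] assms(4,5) by blast
  moreover have "graph_dist G u v \<le> 2" unfolding graph_dist_def
    by (rule Least_le) (use path in force)
  ultimately show ?thesis by simp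
qed

section \<open>The extremal graph and its principal eigenvector\<close>

text \<open>
The graph is the join of a clique on \<open>X\<close> with the disjoint union of a clique on \<open>Y\<close> and isolated
vertices \<open>Z\<close>. Naming the three classes inside the vertex set makes it easy to recognise \<open>G\<close> as extremal.
\<close>

definition split_join :: "'a pair_pre_digraph \<Rightarrow> 'a set \<Rightarrow> 'a set \<Rightarrow> 'a set \<Rightarrow> bool" where
  "split_join G X Y Z \<longleftrightarrow> pverts G = X \<union> Y \<union> Z \<and> X \<inter> Y = {} \<and> X \<inter> Z = {} \<and> Y \<inter> Z = {} \<and>
     (\<forall>u v. (u, v) \<in> parcs G \<longleftrightarrow> u \<in> pverts G \<and> v \<in> pverts G \<and> u \<noteq> v \<and>
        (u \<in> X \<or> v \<in> X \<or> u \<in> Y \<and> v \<in> Y))"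

lemma extremal_graph_split_join:
  obtains X Y Z where "split_join (extremal_graph b d n) X Y Z"
    "card X = d" "card Y = n - (b + 1) * d - 1" "card Z = b * d + 1"
proof
  let ?m = "n - (b + 1) * d - 1"
  show "split_join (extremal_graph b d n) (Inl ` {..<d}) (Inr ` Inl ` {..<?m})
      (Inr ` Inr ` ({..<b * d + 1} \<times> {0}))"
    unfolding split_join_def extremal_graph_def graph_join_def graph_sum_def graph_copies_def
      complete_graph_def by auto
qed (simp_all add: card_image card_cartesian_product inj_on_def)

text \<open>
The three cardinalities determine the graph: adjacency depends only on the classes of two distinct vertices,
so any bijection that respects the classes is an isomorphism.
\<close>

lemma split_join_iso:
  assumes "pair_graph G" "pair_graph G'" and G: "split_join G X Y Z" and G': "split_join G' X' Y' Z'"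
    and "card X = card X'" "card Y = card Y'" "card Z = card Z'"
  shows "digraph_iso (with_proj G) (with_proj G')"
proof -
  have fin: "finite (pverts G)" "finite (pverts G')" using assms(1,2) by (simp_all add: pair_graph_iff)
  have V: "pverts G = X \<union> Y \<union> Z" using G unfolding split_join_def by blast
  have V': "pverts G' = X' \<union> Y' \<union> Z'" using G' unfolding split_join_def by blast
  have disj: "X \<inter> Y = {}" "X \<inter> Z = {}" "Y \<inter> Z = {}"
    using G unfolding split_join_def by blast+
  have disj': "X' \<inter> Y' = {}" "X' \<inter> Z' = {}" "Y' \<inter> Z' = {}"
    using G' unfolding split_join_def by blast+
  have fs: "finite X" "finite Y" "finite Z" "finite X'" "finite Y'" "finite Z'"
    using fin V V' by simp_all
  obtain p q r where p: "bij_betw p X X'" and q: "bij_betw q Y Y'" and r: "bij_betw r Z Z'"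
    using finite_same_card_bij fs assms(5-7) by metis
  define h where "h v = (if v \<in> X then p v else if v \<in> Y then q v else r v)" for v
  have hX: "bij_betw h X X'" using p by (rule bij_betw_cong[THEN iffD1, rotated]) (simp add: h_def)
  have hY: "bij_betw h Y Y'" using q
    by (rule bij_betw_cong[THEN iffD1, rotated]) (use disj in \<open>auto simp: h_def\<close>)
  have hZ: "bij_betw h Z Z'" using r
    by (rule bij_betw_cong[THEN iffD1, rotated]) (use disj in \<open>auto simp: h_def\<close>)
  have hXY: "bij_betw h (X \<union> Y) (X' \<union> Y')" by (rule bij_betw_combine[OF hX hY disj'(1)])
  have hV: "bij_betw h (pverts G) (pverts G')"
    unfolding V V' by (rule bij_betw_combine[OF hXY hZ]) (use disj' in blast)
  have inj: "inj_on h (pverts G)" and img: "h ` pverts G = pverts G'"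
    using hV by (auto simp: bij_betw_def)
  have memX: "h v \<in> X' \<longleftrightarrow> v \<in> X" and memY: "h v \<in> Y' \<longleftrightarrow> v \<in> Y" if "v \<in> pverts G" for v
    using that hX hY hZ disj disj' unfolding V bij_betw_def by blast+
  have arc: "(h u, h v) \<in> parcs G' \<longleftrightarrow> (u, v) \<in> parcs G" if "u \<in> pverts G" "v \<in> pverts G" for u v
  proof -
    have "h u = h v \<longleftrightarrow> u = v" using inj that by (simp add: inj_on_eq_iff)
    moreover have "h u \<in> pverts G'" "h v \<in> pverts G'" using that img by blast+
    ultimately show ?thesis
      using G G' memX[OF that(1)] memX[OF that(2)] memY[OF that(1)] memY[OF that(2)] that
      unfolding split_join_def by simp
  qed
  have sub: "parcs G \<subseteq> pverts G \<times> pverts G" "parcs G' \<subseteq> pverts G' \<times> pverts G'"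
    using assms(1,2) by (simp_all add: pair_graph_iff)
  have arcs: "map_prod h h ` parcs G = parcs G'"
  proof
    show "map_prod h h ` parcs G \<subseteq> parcs G'" using arc sub(1) by auto
    show "parcs G' \<subseteq> map_prod h h ` parcs G"
    proof
      fix e assume e: "e \<in> parcs G'"
      then obtain u v where uv: "e = (h u, h v)" "u \<in> pverts G" "v \<in> pverts G"
      proof -
        obtain u' v' where e': "e = (u', v')" by (cases e)
        then have "u' \<in> h ` pverts G" "v' \<in> h ` pverts G" using e sub(2) img by auto
        then show thesis using that e' by blast
      qed
      then have "(u, v) \<in> parcs G" using arc e by blast
      then show "e \<in> map_prod h h ` parcs G" using uv(1) by force
    qed
  qed
  let ?\<phi> = "\<lparr>iso_verts = h, iso_arcs = map_prod h h, iso_head = snd, iso_tail = fst\<rparr>"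
  interpret pair_graph G by (rule assms(1))
  have "inj_on (map_prod h h) (parcs G)"
    by (rule inj_on_subset[OF map_prod_inj_on[OF inj inj] sub(1)])
  then have "digraph_isomorphism ?\<phi>"
    unfolding digraph_isomorphism_def using inj wf_digraph_axioms by simp
  moreover have "with_proj G' = app_iso ?\<phi> (with_proj G)"
    unfolding app_iso_def using img arcs by (simp add: with_proj_def)
  ultimately show ?thesis unfolding digraph_iso_def by blast
qed

lemma sum_except_diag:
  fixes f :: "'a \<Rightarrow> real"
  assumes "finite A" "\<And>v. v \<in> A \<Longrightarrow> D v = (if v = u then 0 else c)"
  shows "(\<Sum>v\<in>A. D v * f v) = c * sum f A - (if u \<in> A then c * f u else 0)"
proof -
  have "(\<Sum>v\<in>A. D v * f v) = (\<Sum>v\<in>A. c * f v - (if u = v then c * f u else 0))"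
    using assms(2) by (intro sum.cong) auto
  also have "\<dots> = c * sum f A - (if u \<in> A then c * f u else 0)"
    using assms(1) by (simp add: sum_subtractf sum_distrib_left)
  finally show ?thesis .
qed

text \<open>
Any vertex of \<open>X\<close> is a common neighbour of two nonadjacent vertices.
\<close>

lemma split_join_dist:
  assumes "pair_graph G" and G: "split_join G X Y Z" and "X \<noteq> {}"
    and uv: "u \<in> pverts G" "v \<in> pverts G"
  shows "graph_dist G u v =
    (if v = u then 0 else if u \<in> X \<or> v \<in> X \<or> u \<in> Y \<and> v \<in> Y then 1 else 2)"
proof -
  have arc: "(u, v) \<in> parcs G \<longleftrightarrow> u \<in> pverts G \<and> v \<in> pverts G \<and> u \<noteq> v \<and>
        (u \<in> X \<or> v \<in> X \<or> u \<in> Y \<and> v \<in> Y)" for u v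
    using G unfolding split_join_def by blast
  obtain w where w: "w \<in> X" "w \<in> pverts G" using assms(3) G unfolding split_join_def by blast
  consider "u = v" | "u \<noteq> v" "u \<in> X \<or> v \<in> X \<or> u \<in> Y \<and> v \<in> Y"
    | "u \<noteq> v" "\<not> (u \<in> X \<or> v \<in> X \<or> u \<in> Y \<and> v \<in> Y)" by blast
  then show ?thesis
  proof cases
    case 1
    then show ?thesis using graph_dist_self[OF assms(1) uv(1)] by simp
  next
    case 2
    then have "(u, v) \<in> parcs G" using uv by (simp add: arc)
    then show ?thesis using graph_dist_arc[OF assms(1)] 2 by auto
  next
    case 3
    then have "u \<noteq> w" "w \<noteq> v" using w(1) by blast+
    then have "(u, w) \<in> parcs G" "(w, v) \<in> parcs G" using w uv by (simp_all add: arc)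
    moreover have "(u, v) \<notin> parcs G" using 3 by (simp add: arc)
    ultimately have "graph_dist G u v = 2" by (rule graph_dist_two[OF assms(1) _ _ 3(1)])
    then show ?thesis using 3 by auto
  qed
qed

text \<open>
All entries of a row of the distance matrix within one class agree, except for the diagonal. Moving the
diagonal term to the other side shows that \<open>f u\<close> depends only on the class of \<open>u\<close>.
\<close>

lemma split_join_eigen_equations:
  assumes "pair_graph G" and G: "split_join G X Y Z" and "X \<noteq> {}"
    and eig: "\<And>u. u \<in> pverts G \<Longrightarrow> (\<Sum>v\<in>pverts G. real (graph_dist G u v) * f v) = \<mu> * f u"
  shows "u \<in> X \<Longrightarrow> (\<mu> + 1) * f u = sum f X + sum f Y + sum f Z"
    and "u \<in> Y \<Longrightarrow> (\<mu> + 1) * f u = sum f X + sum f Y + 2 * sum f Z"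
    and "u \<in> Z \<Longrightarrow> (\<mu> + 2) * f u = sum f X + 2 * sum f Y + 2 * sum f Z"
proof -
  have V: "pverts G = X \<union> Y \<union> Z" and disj: "X \<inter> Y = {}" "X \<inter> Z = {}" "Y \<inter> Z = {}"
    using G unfolding split_join_def by blast+
  have "finite (pverts G)" using assms(1) by (simp add: pair_graph_iff)
  then have fin: "finite X" "finite Y" "finite Z" unfolding V by simp_all
  have split: "(\<Sum>v\<in>pverts G. h v) = sum h X + sum h Y + sum h Z" for h :: "_ \<Rightarrow> real"
    unfolding V using fin disj by (subst sum.union_disjoint; (subst sum.union_disjoint)?) auto
  note dist = split_join_dist[OF assms(1) G assms(3)]
  let ?d = "\<lambda>u v. real (graph_dist G u v)"
  {
    assume u: "u \<in> X"
    have "(\<Sum>v\<in>X. ?d u v * f v) = 1 * sum f X - (if u \<in> X then 1 * f u else 0)"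
      "(\<Sum>v\<in>Y. ?d u v * f v) = 1 * sum f Y - (if u \<in> Y then 1 * f u else 0)"
      "(\<Sum>v\<in>Z. ?d u v * f v) = 1 * sum f Z - (if u \<in> Z then 1 * f u else 0)"
      by (rule sum_except_diag; use fin u dist[of u] V disj in auto)+
    moreover have "u \<notin> Y" "u \<notin> Z" using u disj by blast+
    ultimately show "(\<mu> + 1) * f u = sum f X + sum f Y + sum f Z"
      using eig[of u] u unfolding split by (simp add: V algebra_simps)
  next
    assume u: "u \<in> Y"
    have "(\<Sum>v\<in>X. ?d u v * f v) = 1 * sum f X - (if u \<in> X then 1 * f u else 0)"
      "(\<Sum>v\<in>Y. ?d u v * f v) = 1 * sum f Y - (if u \<in> Y then 1 * f u else 0)"
      "(\<Sum>v\<in>Z. ?d u v * f v) = 2 * sum f Z - (if u \<in> Z then 2 * f u else 0)"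
      by (rule sum_except_diag; use fin u dist[of u] V disj in auto)+
    moreover have "u \<notin> X" "u \<notin> Z" using u disj by blast+
    ultimately show "(\<mu> + 1) * f u = sum f X + sum f Y + 2 * sum f Z"
      using eig[of u] u unfolding split by (simp add: V algebra_simps)
  next
    assume u: "u \<in> Z"
    have "(\<Sum>v\<in>X. ?d u v * f v) = 1 * sum f X - (if u \<in> X then 1 * f u else 0)"
      "(\<Sum>v\<in>Y. ?d u v * f v) = 2 * sum f Y - (if u \<in> Y then 2 * f u else 0)"
      "(\<Sum>v\<in>Z. ?d u v * f v) = 2 * sum f Z - (if u \<in> Z then 2 * f u else 0)"
      by (rule sum_except_diag; use fin u dist[of u] V disj in auto)+
    moreover have "u \<notin> X" "u \<notin> Y" using u disj by blast+
    ultimately show "(\<mu> + 2) * f u = sum f X + 2 * sum f Y + 2 * sum f Z"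
      using eig[of u] u unfolding split by (simp add: V algebra_simps)
  }
qed

text \<open>
The principal eigenvector, scaled to \<open>1\<close> on \<open>Y\<close>. The last equation writes the eigenvalue equation as an identity
of quadratic forms: a distance is \<open>1\<close> plus the indicator of nonadjacency, and the last bracket is the weight
of the ordered nonadjacent pairs, namely \<open>Z\<close> with \<open>Y\<close> and \<open>Z\<close> with itself. The bound on \<open>1 - x\<close> says that \<open>x\<close> is close
to \<open>1\<close> if the graph is large compared with \<open>Z\<close>.
\<close>

lemma split_join_principal_values:
  assumes "pair_graph G" and G: "split_join G X Y Z"
    and card: "card X = d" "card Y = m" "card Z = t" and pos: "0 < d" "0 < m" "0 < t"
  obtains x z :: real where "0 < x" "x \<le> 1" "1 \<le> z" "z < 2"
    "(1 - x) * (real d + m + t) \<le> t * z"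
    "distance_spectral_radius G * (d * x\<^sup>2 + m + t * z\<^sup>2) =
       (d * x + m + t * z)\<^sup>2 - (d * x\<^sup>2 + m + t * z\<^sup>2) + (2 * real m * real t * z + (real t)\<^sup>2 * z\<^sup>2 - t * z\<^sup>2)"
proof -
  let ?\<mu> = "distance_spectral_radius G"
  have V: "pverts G = X \<union> Y \<union> Z" and disj: "X \<inter> Y = {}" "X \<inter> Z = {}" "Y \<inter> Z = {}"
    using G unfolding split_join_def by blast+
  have fin: "finite (pverts G)" using assms(1) by (simp add: pair_graph_iff)
  have ne: "X \<noteq> {}" "Y \<noteq> {}" "Z \<noteq> {}" using card pos by auto
  then have "pverts G \<noteq> {}" unfolding V by simp
  then obtain f where f: "\<forall>v. 0 \<le> f v" "\<exists>v\<in>pverts G. f v \<noteq> 0"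
    "\<forall>u\<in>pverts G. (\<Sum>v\<in>pverts G. real (graph_dist G u v) * f v) = ?\<mu> * f u"
    using distance_spectral_radius_principal(2)[OF assms(1)] by blast
  define \<alpha> \<beta> \<gamma> where "\<alpha> = sum f X" and "\<beta> = sum f Y" and "\<gamma> = sum f Z"
  note eqs = split_join_eigen_equations[OF assms(1) G ne(1), of f ?\<mu>, folded \<alpha>_def \<beta>_def \<gamma>_def]
  have eX: "(?\<mu> + 1) * f u = \<alpha> + \<beta> + \<gamma>" if "u \<in> X" for u using eqs(1) f(3) that by simp
  have eY: "(?\<mu> + 1) * f u = \<alpha> + \<beta> + 2 * \<gamma>" if "u \<in> Y" for u using eqs(2) f(3) that by simp
  have eZ: "(?\<mu> + 2) * f u = \<alpha> + 2 * \<beta> + 2 * \<gamma>" if "u \<in> Z" for u using eqs(3) f(3) that by simp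
  have fins: "finite X" "finite Y" "finite Z" using fin unfolding V by simp_all
  have nonneg: "0 \<le> \<alpha>" "0 \<le> \<beta>" "0 \<le> \<gamma>" unfolding \<alpha>_def \<beta>_def \<gamma>_def using f(1) by (simp_all add: sum_nonneg)
  have "0 < \<alpha> + \<beta> + \<gamma>"
  proof (rule ccontr)
    assume "\<not> ?thesis"
    then have "\<alpha> = 0" "\<beta> = 0" "\<gamma> = 0" using nonneg by linarith+
    then show False using f(1,2) fins unfolding \<alpha>_def \<beta>_def \<gamma>_def V
      by (auto simp: sum_nonneg_eq_0_iff)
  qed
  obtain u where u: "u \<in> X" using ne(1) by blast
  \<comment> \<open>The sum of all entries is positive and equals \<open>(\<mu> + 1) f u\<close> for \<open>u \<in> X\<close>, where \<open>f u \<ge> 0\<close>.\<close>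
  have \<mu>: "0 < ?\<mu> + 1"
  proof (rule ccontr)
    assume "\<not> ?thesis"
    then have "(?\<mu> + 1) * f u \<le> 0" using f(1) by (simp add: mult_nonpos_nonneg)
    then show False using eX[OF u] \<open>0 < \<alpha> + \<beta> + \<gamma>\<close> by simp
  qed
  define x\<^sub>0 y\<^sub>0 z\<^sub>0 where "x\<^sub>0 = (\<alpha> + \<beta> + \<gamma>) / (?\<mu> + 1)" and "y\<^sub>0 = (\<alpha> + \<beta> + 2 * \<gamma>) / (?\<mu> + 1)"
    and "z\<^sub>0 = (\<alpha> + 2 * \<beta> + 2 * \<gamma>) / (?\<mu> + 2)"
  have "f u = x\<^sub>0" if "u \<in> X" for u using eX[OF that] \<mu> unfolding x\<^sub>0_def by (simp add: field_simps)
  then have \<alpha>: "\<alpha> = d * x\<^sub>0" unfolding \<alpha>_def using card(1) by simp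
  have "f u = y\<^sub>0" if "u \<in> Y" for u using eY[OF that] \<mu> unfolding y\<^sub>0_def by (simp add: field_simps)
  then have \<beta>: "\<beta> = m * y\<^sub>0" unfolding \<beta>_def using card(2) by simp
  have "f u = z\<^sub>0" if "u \<in> Z" for u using eZ[OF that] \<mu> unfolding z\<^sub>0_def by (simp add: field_simps)
  then have \<gamma>: "\<gamma> = t * z\<^sub>0" unfolding \<gamma>_def using card(3) by simp
  have y0: "0 < y\<^sub>0" "0 < x\<^sub>0" using \<open>0 < \<alpha> + \<beta> + \<gamma>\<close> nonneg \<mu> unfolding y\<^sub>0_def x\<^sub>0_def by simp_all
  define x z where "x = x\<^sub>0 / y\<^sub>0" and "z = z\<^sub>0 / y\<^sub>0"
  have xz: "x\<^sub>0 = x * y\<^sub>0" "z\<^sub>0 = z * y\<^sub>0" using y0 unfolding x_def z_def by simp_all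
  \<comment> \<open>Divide the three eigenvalue equations by \<open>y\<^sub>0\<close>.\<close>
  have sc: "a = b" if "a * y\<^sub>0 = b * y\<^sub>0" for a b using that y0 by simp
  have 1: "(?\<mu> + 1) * x = d * x + m + t * z"
  proof (rule sc)
    have "(?\<mu> + 1) * x\<^sub>0 = \<alpha> + \<beta> + \<gamma>" using \<mu> unfolding x\<^sub>0_def by simp
    then show "(?\<mu> + 1) * x * y\<^sub>0 = (d * x + m + t * z) * y\<^sub>0"
      unfolding \<alpha> \<beta> \<gamma> xz by (simp add: algebra_simps)
  qed
  have 2: "?\<mu> + 1 = d * x + m + 2 * (t * z)"
  proof (rule sc)
    have "(?\<mu> + 1) * y\<^sub>0 = \<alpha> + \<beta> + 2 * \<gamma>" using \<mu> unfolding y\<^sub>0_def by simp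
    then show "(?\<mu> + 1) * y\<^sub>0 = (d * x + m + 2 * (t * z)) * y\<^sub>0"
      unfolding \<alpha> \<beta> \<gamma> xz by (simp add: algebra_simps)
  qed
  have 3: "(?\<mu> + 2) * z = d * x + 2 * m + 2 * (t * z)"
  proof (rule sc)
    have "(?\<mu> + 2) * z\<^sub>0 = \<alpha> + 2 * \<beta> + 2 * \<gamma>" using \<mu> unfolding z\<^sub>0_def by simp
    then show "(?\<mu> + 2) * z * y\<^sub>0 = (d * x + 2 * m + 2 * (t * z)) * y\<^sub>0"
      unfolding \<alpha> \<beta> \<gamma> xz by (simp add: algebra_simps)
  qed
  have x0: "0 < x" using y0 unfolding x_def by simp
  have m1: "1 \<le> real m" using pos by simp
  have z3: "(?\<mu> + 2) * z = (?\<mu> + 1) + m" using 2 3 by simp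
  have z1: "1 \<le> z"
  proof (rule ccontr)
    assume "\<not> 1 \<le> z"
    then have "(?\<mu> + 2) * z < (?\<mu> + 2) * 1" using \<mu> by (intro mult_strict_left_mono) auto
    then show False using z3 m1 by simp
  qed
  have tz: "0 \<le> t * z" using z1 by simp
  have dx: "0 \<le> d * x" using x0 by simp
  have z2: "z < 2"
  proof (rule ccontr)
    assume "\<not> z < 2"
    then have "(?\<mu> + 2) * 2 \<le> (?\<mu> + 2) * z" using \<mu> by (intro mult_left_mono) auto
    then have "2 * ?\<mu> + 4 \<le> ?\<mu> + 1 + m" unfolding z3 by simp
    moreover have "m \<le> ?\<mu> + 1" using 2 tz dx by linarith
    ultimately show False by linarith
  qed
  have diff: "(?\<mu> + 1) * (1 - x) = t * z" 
  proof -
    have "(?\<mu> + 1) * (1 - x) = (?\<mu> + 1) - (?\<mu> + 1) * x" by (simp only: right_diff_distrib mult_1_right)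
    then have "(?\<mu> + 1) * (1 - x) = (?\<mu> + 1) - (d * x + m + t * z)" unfolding 1 .
    then show ?thesis using 2 by linarith
  qed
  have x1: "x \<le> 1"
  proof (rule ccontr)
    assume "\<not> x \<le> 1"
    then have "(?\<mu> + 1) * (1 - x) < 0" using \<mu> by (intro mult_pos_neg) auto
    then show False using diff tz by simp
  qed
  \<comment> \<open>As \<open>x\<close> is the smallest entry, \<open>\<mu> + 1\<close> is at least the number of vertices.\<close>
  have "(real d + m + t) * x \<le> (?\<mu> + 1) * x"
  proof -
    have "real m * x \<le> real m * 1" using x1 by (intro mult_left_mono) auto
    moreover have "real t * x \<le> t * z" using x1 z1 by (intro mult_left_mono) auto
    ultimately show ?thesis unfolding 1 by (simp add: algebra_simps)
  qed
  then have "real d + m + t \<le> ?\<mu> + 1" using x0 by simp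
  then have "(1 - x) * (real d + m + t) \<le> (1 - x) * (?\<mu> + 1)" using x1 by (intro mult_left_mono) auto
  then have 4: "(1 - x) * (real d + m + t) \<le> t * z" using diff by (simp add: mult.commute)
  have "?\<mu> * (d * x\<^sup>2 + m + t * z\<^sup>2) = d * x * ((?\<mu> + 1) * x) + m * (?\<mu> + 1) + t * z * ((?\<mu> + 2) * z)
      - (d * x\<^sup>2 + m + t * z\<^sup>2) - t * z\<^sup>2"
    by (simp add: algebra_simps power2_eq_square)
  also have "\<dots> = d * x * (d * x + m + t * z) + m * (d * x + m + 2 * (t * z))
      + t * z * (d * x + 2 * m + 2 * (t * z)) - (d * x\<^sup>2 + m + t * z\<^sup>2) - t * z\<^sup>2"
    by (simp only: 1 2[symmetric] 3)
  also have "\<dots> = (d * x + m + t * z)\<^sup>2 - (d * x\<^sup>2 + m + t * z\<^sup>2) + (2 * real m * real t * z + (real t)\<^sup>2 * z\<^sup>2 - t * z\<^sup>2)"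
    by (simp add: algebra_simps power2_eq_square)
  finally show thesis by (rule that[OF x0 x1 z1 z2 4])
qed

section \<open>Distance forms and separated vertex sets\<close>

lemma pair_graph_connected_reachable:
  assumes "pair_graph G" "Digraph_Component.connected (with_proj G)" "u \<in> pverts G" "v \<in> pverts G"
  shows "reachable (with_proj G) u v"
proof -
  interpret pair_graph G by (rule assms(1))
  have "strongly_connected (with_proj G)"
    using symmetric_connected_imp_strongly_connected[OF sym_arcs assms(2)] .
  then show ?thesis using assms(3,4) unfolding strongly_connected_def by simp
qed

text \<open>
This excludes the empty set as a barrier.
\<close>

lemma pair_graph_connected_closed:
  assumes "pair_graph G" "Digraph_Component.connected (with_proj G)"
    and P: "P \<subseteq> pverts G" "P \<noteq> {}" "parcs G `` P \<subseteq> P"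
  shows "P = pverts G"
proof
  interpret pair_graph G by (rule assms(1))
  obtain u where u: "u \<in> P" using P(2) by blast
  show "pverts G \<subseteq> P"
  proof
    fix v assume "v \<in> pverts G"
    then have "reachable (with_proj G) u v"
      using pair_graph_connected_reachable[OF assms(1,2)] u P(1) by blast
    then show "v \<in> P"
    proof (induction rule: reachable_induct)
      case (step x y)
      then have "(x, y) \<in> parcs G" by (simp add: arcs_ends_def arc_to_ends_def)
      then show ?case using step P(3) by blast
    qed (rule u)
  qed
qed (rule P(1))

lemma sum_ind_mult:
  fixes f :: "'a \<Rightarrow> real"
  assumes "finite V" "P \<subseteq> V"
  shows "(\<Sum>v\<in>V. of_bool (v \<in> P) * f v) = sum f P"
proof -
  have "(\<Sum>v\<in>V. of_bool (v \<in> P) * f v) = (\<Sum>v\<in>V. if v \<in> P then f v else 0)"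
    by (intro sum.cong) auto
  also have "\<dots> = sum f (V \<inter> P)" using assms(1) by (simp add: sum.inter_restrict)
  finally show ?thesis using assms(2) by (simp add: Int_absorb1)
qed

text \<open>
The indicator of two vertices of \<open>W\<close> that lie in different parts of \<open>\<P>\<close>, as \<open>separation_eq\<close> shows, written as a combination of
kernels of rank one so that its quadratic form is a combination of squares.
\<close>

definition separation :: "'v set \<Rightarrow> 'v set set \<Rightarrow> 'v \<Rightarrow> 'v \<Rightarrow> real" where
  "separation W \<P> u v = of_bool (u \<in> W) * of_bool (v \<in> W) -
     (\<Sum>P\<in>\<P>. of_bool (u \<in> P) * of_bool (v \<in> P))"

lemma separation_eq:
  assumes "finite W" "partition_on W \<P>"
  shows "separation W \<P> u v =
    of_bool (u \<in> W \<and> v \<in> W \<and> (\<forall>P\<in>\<P>. u \<in> P \<longrightarrow> v \<notin> P))"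
proof (cases "u \<in> W \<and> v \<in> W")
  case True
  have fin: "finite \<P>" using assms by (rule finite_elements)
  obtain P where P: "P \<in> \<P>" "u \<in> P" using True partition_onD1[OF assms(2)] by blast
  have uniq: "Q = P" if "Q \<in> \<P>" "u \<in> Q" for Q
    using partition_onD2[OF assms(2)] P that unfolding disjoint_def by blast
  have "(\<Sum>Q\<in>\<P>. of_bool (u \<in> Q) * of_bool (v \<in> Q) :: real) =
      (\<Sum>Q\<in>\<P>. if Q = P then of_bool (v \<in> P) else 0)"
  proof (intro sum.cong refl)
    fix Q assume Q: "Q \<in> \<P>"
    show "of_bool (u \<in> Q) * of_bool (v \<in> Q) = (if Q = P then of_bool (v \<in> P) else 0 :: real)"
    proof (cases "Q = P")
      case True
      then show ?thesis using P(2) by simp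
    next
      case False
      then have "u \<notin> Q" using uniq Q by blast
      then show ?thesis using False by simp
    qed
  qed
  also have "\<dots> = of_bool (v \<in> P)" using fin P(1) by simp
  finally have "separation W \<P> u v = 1 - of_bool (v \<in> P)"
    using True unfolding separation_def by simp
  moreover have "(\<forall>Q\<in>\<P>. u \<in> Q \<longrightarrow> v \<notin> Q) \<longleftrightarrow> v \<notin> P" using P uniq by blast
  ultimately show ?thesis using True by simp
next
  case False
  have "(\<Sum>P\<in>\<P>. of_bool (u \<in> P) * of_bool (v \<in> P) :: real) = 0"
    using False partition_onD1[OF assms(2)] by (intro sum.neutral) auto
  then show ?thesis using False unfolding separation_def by auto
qed

lemma quad_form_separation:
  assumes "finite V" "W \<subseteq> V" "partition_on W \<P>"
  shows "quad_form (\<lambda>u v. of_bool (u \<noteq> v) + separation W \<P> u v) V f =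
    (sum f V)\<^sup>2 - (\<Sum>v\<in>V. (f v)\<^sup>2) + (sum f W)\<^sup>2 - (\<Sum>P\<in>\<P>. (sum f P)\<^sup>2)"
proof -
  have rank1: "(\<Sum>u\<in>V. \<Sum>v\<in>V. of_bool (u \<in> P) * of_bool (v \<in> P) * f u * f v) = (sum f P)\<^sup>2"
    if "P \<subseteq> V" for P
  proof -
    have "(sum f P)\<^sup>2 = (\<Sum>u\<in>V. of_bool (u \<in> P) * f u) * (\<Sum>v\<in>V. of_bool (v \<in> P) * f v)"
      unfolding sum_ind_mult[OF assms(1) that] by (simp add: power2_eq_square)
    also have "\<dots> = (\<Sum>u\<in>V. \<Sum>v\<in>V. of_bool (u \<in> P) * of_bool (v \<in> P) * f u * f v)"
      unfolding sum_product by (intro sum.cong refl) simp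
    finally show ?thesis by simp
  qed
  have sub: "P \<subseteq> V" if "P \<in> \<P>" for P using that assms(2) partition_onD1[OF assms(3)] by blast
  have diag: "(\<Sum>u\<in>V. \<Sum>v\<in>V. of_bool (u \<noteq> v) * f u * f v) = (sum f V)\<^sup>2 - (\<Sum>v\<in>V. (f v)\<^sup>2)"
  proof -
    have "(\<Sum>v\<in>V. of_bool (u \<noteq> v) * f u * f v) = f u * sum f V - (f u)\<^sup>2" if "u \<in> V" for u
    proof -
      have "(\<Sum>v\<in>V. of_bool (u \<noteq> v) * f u * f v) = (\<Sum>v\<in>V. f u * f v - (if u = v then (f u)\<^sup>2 else 0))"
        by (intro sum.cong refl) (simp add: power2_eq_square)
      also have "\<dots> = f u * sum f V - (f u)\<^sup>2"
        using that assms(1) by (simp add: sum_subtractf sum_distrib_left)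
      finally show ?thesis .
    qed
    then have "(\<Sum>u\<in>V. \<Sum>v\<in>V. of_bool (u \<noteq> v) * f u * f v) = (\<Sum>u\<in>V. f u * sum f V - (f u)\<^sup>2)"
      by (intro sum.cong) auto
    also have "\<dots> = (sum f V)\<^sup>2 - (\<Sum>v\<in>V. (f v)\<^sup>2)"
      by (simp add: sum_subtractf power2_eq_square flip: sum_distrib_right)
    finally show ?thesis .
  qed
  have "quad_form (\<lambda>u v. of_bool (u \<noteq> v) + separation W \<P> u v) V f =
      (\<Sum>u\<in>V. \<Sum>v\<in>V. of_bool (u \<noteq> v) * f u * f v + of_bool (u \<in> W) * of_bool (v \<in> W) * f u * f v
        - (\<Sum>P\<in>\<P>. of_bool (u \<in> P) * of_bool (v \<in> P) * f u * f v))"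
    unfolding quad_form_def separation_def
    by (intro sum.cong refl) (simp add: algebra_simps sum_distrib_left)
  also have "\<dots> = (\<Sum>u\<in>V. \<Sum>v\<in>V. of_bool (u \<noteq> v) * f u * f v)
      + (\<Sum>u\<in>V. \<Sum>v\<in>V. of_bool (u \<in> W) * of_bool (v \<in> W) * f u * f v)
      - (\<Sum>u\<in>V. \<Sum>v\<in>V. \<Sum>P\<in>\<P>. of_bool (u \<in> P) * of_bool (v \<in> P) * f u * f v)"
    by (simp only: sum.distrib sum_subtractf)
  also have "(\<Sum>u\<in>V. \<Sum>v\<in>V. \<Sum>P\<in>\<P>. of_bool (u \<in> P) * of_bool (v \<in> P) * f u * f v) =
      (\<Sum>P\<in>\<P>. \<Sum>u\<in>V. \<Sum>v\<in>V. of_bool (u \<in> P) * of_bool (v \<in> P) * f u * f v)"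
    by (subst (2) sum.swap, subst sum.swap) (rule refl)
  also have "\<dots> = (\<Sum>P\<in>\<P>. (sum f P)\<^sup>2)" using rank1 sub by (intro sum.cong) auto
  finally show ?thesis using diag rank1[OF assms(2)] by simp
qed

text \<open>
Edges stay inside the parts, so vertices of different parts have distance at least \<open>2\<close>. As \<open>f\<close> is positive, equality
of the forms means equality of the kernels, and then vertices that are not separated are adjacent.
\<close>

lemma quad_form_dist_ge_separation:
  assumes "pair_graph G" "Digraph_Component.connected (with_proj G)"
    and W: "W \<subseteq> pverts G" "partition_on W \<P>" and closed: "\<And>P. P \<in> \<P> \<Longrightarrow> parcs G `` P \<inter> W \<subseteq> P"
    and f: "\<And>v. v \<in> pverts G \<Longrightarrow> 0 < f v"
  defines "bound \<equiv> (sum f (pverts G))\<^sup>2 - (\<Sum>v\<in>pverts G. (f v)\<^sup>2) + (sum f W)\<^sup>2 - (\<Sum>P\<in>\<P>. (sum f P)\<^sup>2)"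
  shows "bound \<le> quad_form (\<lambda>u v. real (graph_dist G u v)) (pverts G) f"
    and "\<lbrakk>quad_form (\<lambda>u v. real (graph_dist G u v)) (pverts G) f \<le> bound; u \<in> pverts G; v \<in> pverts G;
      u \<noteq> v; \<not> (u \<in> W \<and> v \<in> W \<and> (\<forall>P\<in>\<P>. u \<in> P \<longrightarrow> v \<notin> P))\<rbrakk> \<Longrightarrow> (u, v) \<in> parcs G"
proof -
  let ?V = "pverts G" and ?d = "\<lambda>u v. real (graph_dist G u v)"
  let ?c = "\<lambda>u v. of_bool (u \<noteq> v) + separation W \<P> u v"
  have fin: "finite ?V" using assms(1) by (simp add: pair_graph_iff)
  have finW: "finite W" by (rule finite_subset[OF W(1) fin])
  note sep = separation_eq[OF finW W(2)]
  have ge: "?c u v \<le> ?d u v" if uv: "u \<in> ?V" "v \<in> ?V" for u v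
  proof (cases "u = v")
    case True
    then have "separation W \<P> u v = 0" unfolding sep using partition_onD1[OF W(2)] by auto
    then show ?thesis using True by simp
  next
    case False
    have reach: "reachable (with_proj G) u v"
      by (rule pair_graph_connected_reachable[OF assms(1,2) uv])
    note dist = graph_dist_ge[OF assms(1) reach False]
    show ?thesis
    proof (cases "u \<in> W \<and> v \<in> W \<and> (\<forall>P\<in>\<P>. u \<in> P \<longrightarrow> v \<notin> P)")
      case True
      then obtain P where P: "P \<in> \<P>" "u \<in> P" "v \<notin> P" using partition_onD1[OF W(2)] by blast
      then have "(u, v) \<notin> parcs G" using closed[OF P(1)] True by blast
      then show ?thesis using dist(2) True False unfolding sep by simp
    next
      case False
      then have "separation W \<P> u v = 0" unfolding sep of_bool_def by (intro if_not_P)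
      then show ?thesis using dist(1) \<open>u \<noteq> v\<close> by simp
    qed
  qed
  have bound: "quad_form ?c ?V f = bound" unfolding bound_def by (rule quad_form_separation[OF fin W])
  let ?g = "\<lambda>u v. (?d u v - ?c u v) * f u * f v"
  have g0: "0 \<le> ?g u v" if "u \<in> ?V" "v \<in> ?V" for u v
    using ge[OF that] f[OF that(1)] f[OF that(2)] by (intro mult_nonneg_nonneg) auto
  have diff: "quad_form ?d ?V f - bound = (\<Sum>u\<in>?V. \<Sum>v\<in>?V. ?g u v)"
    unfolding bound[symmetric] quad_form_def sum_subtractf[symmetric]
    by (intro sum.cong refl) (simp add: algebra_simps)
  moreover have "0 \<le> (\<Sum>u\<in>?V. \<Sum>v\<in>?V. ?g u v)" by (intro sum_nonneg g0)
  ultimately show "bound \<le> quad_form ?d ?V f" by simp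
  assume le: "quad_form ?d ?V f \<le> bound" and uv: "u \<in> ?V" "v \<in> ?V" "u \<noteq> v"
    and ns: "\<not> (u \<in> W \<and> v \<in> W \<and> (\<forall>P\<in>\<P>. u \<in> P \<longrightarrow> v \<notin> P))"
  have "(\<Sum>u\<in>?V. \<Sum>v\<in>?V. ?g u v) = 0"
    using diff le \<open>0 \<le> (\<Sum>u\<in>?V. \<Sum>v\<in>?V. ?g u v)\<close> by simp
  then have "(\<Sum>v\<in>?V. ?g u v) = 0" if "u \<in> ?V" for u
    using that fin g0 by (subst (asm) sum_nonneg_eq_0_iff) (auto intro!: sum_nonneg)
  then have "?g u v = 0"
    using uv fin g0 sum_nonneg_eq_0_iff[of ?V "?g u"] by blast
  then have "?d u v = ?c u v" using f uv by (metis eq_iff_diff_eq_0 mult_eq_0_iff less_irrefl)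
  then have "?d u v = 1" using ns uv(3) unfolding sep by simp
  then have "\<not> 2 \<le> graph_dist G u v" by simp
  then show "(u, v) \<in> parcs G"
    using graph_dist_ge(2)[OF assms(1) pair_graph_connected_reachable[OF assms(1,2) uv(1,2)] uv(3)]
    by blast
qed

lemma sum_squares_le_square_sum:
  fixes e :: "'p \<Rightarrow> real"
  assumes "finite A" "\<And>p. p \<in> A \<Longrightarrow> 0 \<le> e p"
  shows "(\<Sum>p\<in>A. (e p)\<^sup>2) \<le> (sum e A)\<^sup>2"
proof -
  have "(\<Sum>p\<in>A. (e p)\<^sup>2) \<le> (\<Sum>p\<in>A. e p * sum e A)"
  proof (intro sum_mono)
    fix p assume p: "p \<in> A"
    then have "e p \<le> sum e A" using assms by (intro member_le_sum) auto
    then show "(e p)\<^sup>2 \<le> e p * sum e A"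
      using assms(2)[OF p] by (simp add: power2_eq_square mult_left_mono)
  qed
  then show ?thesis by (simp add: power2_eq_square sum_distrib_right)
qed

text \<open>
Both sides are weights of ordered pairs from different parts of a multipartite structure. On the right the
parts have the weights \<open>a p + e p\<close> and \<open>r\<close>; on the left all excess \<open>e p\<close> has moved to the last part. For
each \<open>p\<close> this move lowers the weight by \<open>2 e p (r - a p)\<close>; it also loses the separation of the excess weights
from each other, a nonnegative amount that the estimate drops.
\<close>

lemma multipartite_weight_concentrate:
  fixes a e :: "'p \<Rightarrow> real"
  assumes "finite A" and e: "\<And>p. p \<in> A \<Longrightarrow> 0 \<le> e p"
  defines "w \<equiv> \<lambda>p. a p + e p"
  shows "(sum a A)\<^sup>2 - (\<Sum>p\<in>A. (a p)\<^sup>2) + 2 * (r + sum e A) * sum a A + 2 * (\<Sum>p\<in>A. e p * (r - a p))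
    \<le> (sum w A + r)\<^sup>2 - ((\<Sum>p\<in>A. (w p)\<^sup>2) + r\<^sup>2)"
proof -
  have w2: "(\<Sum>p\<in>A. (w p)\<^sup>2) = (\<Sum>p\<in>A. (a p)\<^sup>2) + 2 * (\<Sum>p\<in>A. e p * a p) + (\<Sum>p\<in>A. (e p)\<^sup>2)"
    unfolding w_def by (simp add: power2_sum sum.distrib sum_distrib_left algebra_simps)
  have w1: "sum w A = sum a A + sum e A" unfolding w_def by (simp add: sum.distrib)
  have er: "(\<Sum>p\<in>A. e p * (r - a p)) = r * sum e A - (\<Sum>p\<in>A. e p * a p)"
    by (simp add: right_diff_distrib sum_subtractf sum_distrib_left mult.commute)
  show ?thesis
    using sum_squares_le_square_sum[OF assms(1) e] unfolding w1 w2 er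
    by (simp add: power2_eq_square algebra_simps)
qed

section \<open>Numerical estimates\<close>

text \<open>
The decisive inequality for a barrier with \<open>d + u\<close> vertices, where \<open>u > 0\<close> and \<open>r\<close> is the size of the last part
when all others are single vertices. For fixed \<open>n\<close> the right-hand side grows with \<open>r\<close>, so the worst case is
\<open>r = 1\<close>, and there the inequality (with \<open>z\<close> replaced by \<open>2\<close>) is linear in \<open>n\<close>. The second bound on \<open>n\<close> misses it by
one for \<open>b = 1\<close>, where the evenness of \<open>n\<close> has to help.
\<close>

lemma large_barrier_margin:
  fixes b d u r t z :: real and n :: nat
  assumes b: "1 \<le> b" "b = 1 \<or> 3 \<le> b" and d: "3 \<le> d" and z: "0 < z" "z < 2"
    and t: "t = b * d + 1" and r: "1 \<le> r" and n: "real n = (b + 1) * (d + u) + 1 + r"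
    and size: "(3 / b + 5 + 2 * b) * d + 1 + 3 * (b + 1) / b\<^sup>2 \<le> real n"
    and even: "b = 1 \<Longrightarrow> 10 * d + 8 \<le> real n"
  shows "2 * t * z < b * (2 * r + b * u - 1)"
proof -
  have "b\<^sup>2 * ((3 / b + 5 + 2 * b) * d + 1 + 3 * (b + 1) / b\<^sup>2) \<le> b\<^sup>2 * real n"
    using size by (intro mult_left_mono) auto
  moreover have "b\<^sup>2 * ((3 / b + 5 + 2 * b) * d + 1 + 3 * (b + 1) / b\<^sup>2) =
      3 * b * d + 5 * b\<^sup>2 * d + 2 * b^3 * d + b\<^sup>2 + 3 * (b + 1)"
    using b(1) by (simp add: field_simps power2_eq_square power3_eq_cube)
  ultimately have size': "3 * b * d + 5 * b\<^sup>2 * d + 2 * b^3 * d + b\<^sup>2 + 3 * (b + 1) \<le> b\<^sup>2 * real n"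
    by simp
  have key: "b^3 * d + 5 * b\<^sup>2 * d + 4 * b * d + b\<^sup>2 + 5 * b + 4 \<le> b\<^sup>2 * (real n - 1) + b\<^sup>2 + 2 * b"
  proof (cases "b = 1")
    case True
    then show ?thesis using even by simp
  next
    case False
    then have b3: "3 \<le> b" using b(2) by simp
    have "9 * (b * d) \<le> b\<^sup>2 * (b * d)" using b3 d power_mono[of 3 b 2] by (intro mult_right_mono) auto
    moreover have "9 \<le> b * d" using mult_mono[of 3 b 3 d] b3 d by simp
    ultimately have "b * d + 1 \<le> b^3 * d" by (simp add: power3_eq_cube power2_eq_square)
    then show ?thesis using size' by (simp add: algebra_simps)
  qed
  \<comment> \<open>Eliminate \<open>u\<close> by means of \<open>n\<close> to make the dependence on \<open>r\<close> visible.\<close>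
  have "b * (2 * r + b * u - 1) * (b + 1) = b * ((b + 2) * r + b * (real n - 1) - (b + 1) * (b * d + 1))"
    unfolding n by (simp add: algebra_simps power2_eq_square)
  moreover have "b * ((b + 2) * 1 + b * (real n - 1) - (b + 1) * (b * d + 1))
      \<le> b * ((b + 2) * r + b * (real n - 1) - (b + 1) * (b * d + 1))"
    using b(1) r by (intro mult_left_mono diff_right_mono add_right_mono) auto
  moreover have "4 * t * (b + 1) \<le> b * ((b + 2) * 1 + b * (real n - 1) - (b + 1) * (b * d + 1))"
    using key unfolding t by (simp add: algebra_simps power2_eq_square power3_eq_cube)
  ultimately have "4 * t * (b + 1) \<le> b * (2 * r + b * u - 1) * (b + 1)" by linarith
  then have "4 * t \<le> b * (2 * r + b * u - 1)" using b(1) by simp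
  moreover have "0 < t" unfolding t using b d by (simp add: add_pos_pos)
  then have "2 * t * z < 4 * t" using z by simp
  ultimately show ?thesis by linarith
qed

lemma size_bounds:
  fixes b d n :: real
  assumes b: "1 \<le> b" and d: "3 \<le> d" and n1: "2 * b * d\<^sup>2 \<le> n"
    and n2: "(3 / b + 5 + 2 * b) * d + 1 + 3 * (b + 1) / b\<^sup>2 \<le> n"
  shows "6 * b * d \<le> n" "(5 + 2 * b) * d + 1 \<le> n"
proof -
  have "6 * (b * d) \<le> 2 * d * (b * d)" using b d by (intro mult_right_mono) auto
  then show "6 * b * d \<le> n" using n1 by (simp add: power2_eq_square algebra_simps)
  have "0 \<le> 3 / b * d" "0 \<le> 3 * (b + 1) / b\<^sup>2" using b d by simp_all
  then show "(5 + 2 * b) * d + 1 \<le> n" using n2 by (simp add: algebra_simps)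
qed

text \<open>
The decisive inequality for a barrier with \<open>d - k\<close> vertices. The difference of the two sides is
\<open>k (x (2 m - x) - t z (z - 2 x)) + g (2 m - g - k - 1)\<close>: the \<open>k\<close> vertices of value \<open>x\<close> gain about \<open>2 m\<close> each, while
replacing separated \<open>z\<close>-pairs inside a part costs little because \<open>x\<close> is at least \<open>1/2\<close> and \<open>z\<close> less than \<open>2\<close>.
\<close>

lemma small_barrier_margin:
  fixes b d m t x z k g :: real
  assumes b: "1 \<le> b" and d: "3 \<le> d" and t: "t = b * d + 1" and m: "n = m + (b + 1) * d + 1"
    and n1: "6 * b * d \<le> n" and n2: "(5 + 2 * b) * d + 1 \<le> n"
    and x: "0 < x" "x \<le> 1" and z: "1 \<le> z" "z < 2" and xz: "(1 - x) * n \<le> t * z"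
    and k: "1 \<le> k" and g: "0 \<le> g" "g + k + 1 \<le> 2 * m"
  shows "2 * m * t * z + t\<^sup>2 * z\<^sup>2 - t * z\<^sup>2 <
    (t * z + k * x + g)\<^sup>2 - (k + 1) * (t * z\<^sup>2 + k * x\<^sup>2 + g) + 2 * (m - g) * (t * z + k * x + g)"
proof -
  have bd: "3 \<le> b * d" using mult_mono[of 1 b 3 d] b d by simp
  have t0: "0 < t" unfolding t using bd by simp
  have n4: "4 * t \<le> n" using n1 bd unfolding t by simp
  have tz: "t * z \<le> t * 2" using z t0 by (intro mult_left_mono) auto
  have "(1 - x) * (4 * t) \<le> (1 - x) * n" using n4 x by (intro mult_left_mono) auto
  then have "(1 - x) * (4 * t) \<le> 2 * t" using xz tz by linarith
  then have half: "1 - x \<le> 1 / 2" using t0 by (simp add: field_simps)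
  have "z * (z - 2 * x) \<le> 4 * (1 - x)"
  proof -
    \<comment> \<open>The function \<open>z (z - 2 x)\<close> increases for \<open>z \<ge> x\<close>, so its bound is the value at \<open>z = 2\<close>.\<close>
    have "0 \<le> (2 - z) * (2 + z - 2 * x)" using z x by (intro mult_nonneg_nonneg) auto
    then show ?thesis by (simp add: algebra_simps)
  qed
  also have "\<dots> \<le> 2" using half by simp
  finally have "t * (z * (z - 2 * x)) \<le> t * 2" using t0 by (intro mult_left_mono) auto
  moreover have "2 * t < x * (2 * m - x)"
  proof -
    \<comment> \<open>The mean of the two lower bounds on \<open>n\<close>.\<close>
    have "3 * b * d + ((5 + 2 * b) * d + 1) / 2 \<le> n" using n1 n2 by (simp add: field_simps)
    moreover have "d * 1 \<le> d * b" using b d by (intro mult_left_mono) auto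
    ultimately have m2: "2 * t + 1 / 2 < m" using d bd unfolding t m by (simp add: field_simps)
    then have "1 / 2 * (2 * m - 1) \<le> x * (2 * m - x)"
      using half x t0 by (intro mult_mono) auto
    then show ?thesis using m2 by (simp add: field_simps)
  qed
  ultimately have "0 < x * (2 * m - x) - t * (z * (z - 2 * x))" by linarith
  then have "0 < k * (x * (2 * m - x) - t * (z * (z - 2 * x)))" using k by simp
  moreover have "0 \<le> g * (2 * m - g - k - 1)" using g by (intro mult_nonneg_nonneg) auto
  moreover have "(t * z + k * x + g)\<^sup>2 - (k + 1) * (t * z\<^sup>2 + k * x\<^sup>2 + g) + 2 * (m - g) * (t * z + k * x + g)
      - (2 * m * t * z + t\<^sup>2 * z\<^sup>2 - t * z\<^sup>2)
    = k * (x * (2 * m - x) - t * (z * (z - 2 * x))) + g * (2 * m - g - k - 1)"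
    by (simp add: algebra_simps power2_eq_square)
  ultimately show ?thesis by linarith
qed

text \<open>
The difference between the weight of the separated pairs for a barrier of \<open>d + u\<close> vertices with singleton parts and
the corresponding weight in the extremal graph.
\<close>

lemma large_barrier_gap:
  fixes b d u m t z :: real
  assumes "t = b * d + 1"
  shows "(t * z + b * u)\<^sup>2 - (t * z\<^sup>2 + b * u) + 2 * (m - u * (b + 1)) * (t * z + b * u)
      - (2 * m * t * z + t\<^sup>2 * z\<^sup>2 - t * z\<^sup>2)
    = u * (b * (2 * (m - u * (b + 1)) + b * u - 1) - 2 * t * z)"
  by (simp add: algebra_simps power2_eq_square)

text \<open>
The largest of \<open>b s + 2\<close> parts has at least average size, and \<open>s (d + 1 - s)\<close> is at most \<open>(d + 1)\<^sup>2 / 4\<close>. The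
resulting requirement follows from the first bound on \<open>n\<close>, except for \<open>b = 1\<close> and \<open>d = 3\<close>, where the second one takes over.
\<close>

lemma largest_part_size:
  fixes b d s r n :: real
  assumes b: "1 \<le> b" "b = 1 \<or> 3 \<le> b" and d: "d = 3 \<or> 4 \<le> d" and s: "1 \<le> s" "s \<le> d"
    and n1: "2 * b * d\<^sup>2 \<le> n" and n2: "(5 + 2 * b) * d + 1 \<le> n"
    and r: "n - s \<le> (b * s + 2) * r"
  shows "2 * (d + 1 - s) \<le> r"
proof -
  have "s * (d + 1 - s) \<le> (d + 1)\<^sup>2 / 4"
  proof -
    have "0 \<le> (2 * s - (d + 1))\<^sup>2" by simp
    then show ?thesis by (simp add: power2_eq_square algebra_simps)
  qed
  then have "2 * b * (s * (d + 1 - s)) \<le> 2 * b * ((d + 1)\<^sup>2 / 4)" using b by (intro mult_left_mono) auto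
  then have 1: "2 * (b * s + 2) * (d + 1 - s) + s \<le> b * (d + 1)\<^sup>2 / 2 + 4 * d + 1"
    using s by (simp add: algebra_simps)
  have "b * (d + 1)\<^sup>2 / 2 + 4 * d + 1 \<le> n"
  proof (cases "d = 3")
    case True
    show ?thesis
    proof (cases "b = 1")
      case True
      then show ?thesis using n2 \<open>d = 3\<close> by simp
    next
      case False
      then show ?thesis using n1 \<open>d = 3\<close> b by simp
    qed
  next
    case False
    then have d4: "4 \<le> d" using d by simp
    have "(3 * d + 1) * 3 \<le> (3 * d + 1) * (d - 1)" using d4 by (intro mult_left_mono) auto
    then have "8 * d + 2 \<le> 1 * ((3 * d + 1) * (d - 1))" using d4 by simp
    also have "\<dots> \<le> b * ((3 * d + 1) * (d - 1))" using b d4 by (intro mult_right_mono) auto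
    also have "b * ((3 * d + 1) * (d - 1)) = 2 * (2 * b * d\<^sup>2) - b * (d + 1)\<^sup>2"
      by (simp add: power2_eq_square algebra_simps)
    finally have "b * (d + 1)\<^sup>2 + (8 * d + 2) \<le> 2 * n" using n1 by linarith
    then show ?thesis by simp
  qed
  then have "(b * s + 2) * (2 * (d + 1 - s)) \<le> (b * s + 2) * r" using 1 r by (simp add: algebra_simps)
  moreover have "0 < b * s + 2" using b s by (simp add: add_pos_pos)
  ultimately show ?thesis by simp
qed

section \<open>Barriers against odd factors\<close>

lemma vertex_degree_eq: "vertex_degree G v = card (parcs G `` {v})"
proof -
  have "out_arcs (with_proj G) v = Pair v ` (parcs G `` {v})"
    unfolding out_arcs_def by auto
  then show ?thesis unfolding out_degree_def by (simp add: card_image inj_on_def)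
qed

lemma parity_factor_odd_factor:
  assumes "pair_graph G" "odd b" and H: "parity_factor (parcs G) (\<lambda>_. b) (pverts G) H"
  shows "odd_factor b G \<lparr>pverts = pverts G, parcs = H\<rparr>"
proof -
  let ?H = "\<lparr>pverts = pverts G, parcs = H\<rparr>"
  have sub: "H \<subseteq> parcs G" "H \<subseteq> pverts G \<times> pverts G" and "sym H"
    and deg: "\<forall>v\<in>pverts G. card (H `` {v}) \<le> b \<and> (even (card (H `` {v})) \<longleftrightarrow> even b)"
    using H unfolding parity_factor_def by auto
  have G: "finite (pverts G)" "irrefl (parcs G)" using assms(1) by (auto simp: pair_graph_iff)
  have pg: "pair_graph ?H"
    using sub \<open>sym H\<close> G unfolding pair_graph_iff by (auto simp: irrefl_def)
  interpret G: pair_graph G by (rule assms(1))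
  interpret H: pair_graph ?H by (rule pg)
  have "spanning (with_proj ?H) (with_proj G)"
    using sub(1) G.wf_digraph_axioms H.wf_digraph_axioms
    unfolding spanning_def subgraph_def compatible_def by simp
  moreover have "odd (card (H `` {v}))" "card (H `` {v}) \<le> b" if "v \<in> pverts G" for v
    using deg that assms(2) by auto
  ultimately show ?thesis
    using pg unfolding odd_factor_def vertex_degree_eq by (simp add: odd_pos Suc_leI)
qed

text \<open>
More than \<open>b |S|\<close> islands exist by the factor theorem. Keeping \<open>b |S| + 1\<close> of them, the rest of \<open>V - S\<close> has odd
weight by parity, so it is one more nonempty part. The largest of the \<open>b |S| + 2\<close> parts is singled out as \<open>R\<close>.
\<close>

lemma odd_barrier_partition:
  assumes "pair_graph G" "Digraph_Component.connected (with_proj G)" "even (card (pverts G))" "odd b"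
    and "\<not> parity_tough (parcs G) (\<lambda>_. b) (pverts G)"
  obtains S \<O> R where "S \<subseteq> pverts G" "S \<noteq> {}" "partition_on (pverts G - S) (insert R \<O>)"
    "R \<notin> \<O>" "card \<O> = b * card S + 1"
    "\<forall>P\<in>insert R \<O>. parcs G `` P \<inter> (pverts G - S) \<subseteq> P" "\<forall>P\<in>\<O>. card P \<le> card R"
proof -
  let ?V = "pverts G" and ?E = "parcs G" and ?f = "\<lambda>_ :: 'a. b"
  have fin: "finite ?V" and sym: "sym ?E" and sub: "?E \<subseteq> ?V \<times> ?V"
    using assms(1) by (simp_all add: pair_graph_iff)
  obtain S \<O>\<^sub>1 where S: "S \<subseteq> ?V" and isl1: "odd_islands ?E ?f (?V - S) \<O>\<^sub>1"
    and gt: "\<not> card \<O>\<^sub>1 \<le> sum ?f S"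
    using assms(5) unfolding parity_tough_def by blast
  have finW: "finite (?V - S)" using fin by simp
  have finS: "finite S" by (rule finite_subset[OF S fin])
  have "b * card S + 1 \<le> card \<O>\<^sub>1" using gt by (simp add: mult.commute)
  then obtain \<O>\<^sub>0 where \<O>\<^sub>0: "\<O>\<^sub>0 \<subseteq> \<O>\<^sub>1" "card \<O>\<^sub>0 = b * card S + 1"
    by (rule obtain_subset_with_card_n)
  have isl: "odd_islands ?E ?f (?V - S) \<O>\<^sub>0"
  proof (rule odd_islandsI)
    show "\<Union>\<O>\<^sub>0 \<subseteq> ?V - S" using odd_islandsD(1)[OF isl1] \<O>\<^sub>0(1) by blast
    show "disjoint \<O>\<^sub>0" by (rule pairwise_subset[OF odd_islandsD(2)[OF isl1] \<O>\<^sub>0(1)])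
  qed (use \<O>\<^sub>0(1) odd_islandsD(3,4)[OF isl1] in blast)+
  have "card ?V = card (?V - S) + card S"
    using S fin finS by (simp add: card_Diff_subset card_mono)
  then have "odd (sum ?f (?V - S) + card \<O>\<^sub>0)"
    using assms(3,4) \<O>\<^sub>0(2) by auto
  then have odd_rest: "odd (sum ?f ((?V - S) - \<Union>\<O>\<^sub>0))" by (rule odd_islands_rest_odd[OF finW isl])
  define R\<^sub>0 where "R\<^sub>0 = (?V - S) - \<Union>\<O>\<^sub>0"
  define \<P> where "\<P> = insert R\<^sub>0 \<O>\<^sub>0"
  note ins = odd_islands_insert_rest[OF sym isl odd_rest, folded R\<^sub>0_def]
  have isl\<P>: "odd_islands ?E ?f (?V - S) \<P>" using ins(1) unfolding \<P>_def .
  have fin\<P>: "finite \<P>" by (rule odd_islands_finite[OF finW isl\<P>])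
  have "finite \<O>\<^sub>0" using fin\<P> unfolding \<P>_def by simp
  then have card\<P>: "card \<P> = b * card S + 2" using ins(2) \<O>\<^sub>0(2) unfolding \<P>_def by simp
  have part: "partition_on (?V - S) \<P>"
    unfolding partition_on_def
  proof (intro conjI)
    show "\<Union>\<P> = ?V - S" using odd_islandsD(1)[OF isl] unfolding \<P>_def R\<^sub>0_def by auto
    show "disjoint \<P>" by (rule odd_islandsD(2)[OF isl\<P>])
    show "{} \<notin> \<P>" using odd_islandsD(3)[OF isl\<P>, of "{}"] by auto
  qed
  have "card ` \<P> \<noteq> {}" unfolding \<P>_def by simp
  then have "Max (card ` \<P>) \<in> card ` \<P>" using fin\<P> by (intro Max_in) auto
  then obtain R where R: "R \<in> \<P>" "card R = Max (card ` \<P>)" by auto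
  define \<O> where "\<O> = \<P> - {R}"
  have \<P>: "\<P> = insert R \<O>" "R \<notin> \<O>" using R(1) unfolding \<O>_def by auto
  have card\<O>: "card \<O> = b * card S + 1" using fin\<P> R(1) card\<P> unfolding \<O>_def by simp
  have max: "\<forall>P\<in>\<O>. card P \<le> card R" unfolding R(2) \<O>_def using fin\<P> by simp
  have "S \<noteq> {}"
  proof
    assume "S = {}"
    then have "\<O> \<noteq> {}" using card\<O> by auto
    then obtain P where P: "P \<in> \<O>" by blast
    then have PP: "P \<in> \<P>" unfolding \<P>(1) by simp
    have "?E `` P \<subseteq> P" using odd_islandsD(4)[OF isl\<P> PP] sub \<open>S = {}\<close> by blast
    moreover have "P \<subseteq> ?V" "P \<noteq> {}"
      using odd_islandsD(5)[OF isl\<P> PP] partition_onD3[OF part] PP by auto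
    ultimately have "P = ?V" by (intro pair_graph_connected_closed[OF assms(1,2)])
    moreover have "R \<subseteq> ?V" "R \<noteq> {}"
      using odd_islandsD(5)[OF isl\<P> R(1)] partition_onD3[OF part] R(1) by auto
    moreover have "P \<inter> R = {}"
      using partition_onD2[OF part] PP R(1) P \<P>(2) unfolding disjoint_def by metis
    ultimately show False by blast
  qed
  moreover have "\<forall>P\<in>insert R \<O>. ?E `` P \<inter> (?V - S) \<subseteq> P"
    using odd_islandsD(4)[OF isl\<P>] unfolding \<P>(1) by blast
  ultimately show thesis using S part \<P> card\<O> max by (intro that[of S R \<O>]) auto
qed

text \<open>
A vertex of \<open>P\<close> has all its neighbours in \<open>P\<close> and \<open>S\<close>.
\<close>

lemma min_degree_part_size:
  assumes "pair_graph G" "S \<subseteq> pverts G" "P \<subseteq> pverts G - S" "P \<noteq> {}"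
    and closed: "parcs G `` P \<inter> (pverts G - S) \<subseteq> P"
  shows "min_degree G + 1 \<le> card P + card S"
proof -
  have G: "finite (pverts G)" "parcs G \<subseteq> pverts G \<times> pverts G" "irrefl (parcs G)"
    using assms(1) by (simp_all add: pair_graph_iff)
  have fin: "finite P" "finite S" using assms(2,3) G(1) by (meson finite_Diff finite_subset)+
  obtain v where v: "v \<in> P" using assms(4) by blast
  then have "v \<in> pverts G" using assms(3) by blast
  then have "min_degree G \<le> vertex_degree G v"
    unfolding min_degree_def using G(1) by (intro Min_le) auto
  also have "\<dots> \<le> card ((P - {v}) \<union> S)"
    unfolding vertex_degree_eq
  proof (rule card_mono)
    show "finite ((P - {v}) \<union> S)" using fin by simp
    show "parcs G `` {v} \<subseteq> (P - {v}) \<union> S"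
    proof
      fix w assume "w \<in> parcs G `` {v}"
      then have w: "(v, w) \<in> parcs G" by simp
      then have "w \<noteq> v" "w \<in> pverts G" using G(2,3) unfolding irrefl_def by blast+
      then show "w \<in> (P - {v}) \<union> S" using closed v w by blast
    qed
  qed
  also have "\<dots> \<le> card (P - {v}) + card S" by (rule card_Un_le)
  finally show ?thesis using v fin(1) by (simp add: card_Diff_singleton) (use card_gt_0_iff[of P] in auto)
qed

section \<open>Testing a barrier with the eigenvector of the extremal graph\<close>

lemma sum_three_values:
  fixes \<phi> :: "real \<Rightarrow> real"
  assumes "finite B" "X \<inter> Z = {}"
  shows "(\<Sum>v\<in>B. \<phi> (if v \<in> X then x else if v \<in> Z then z else 1)) =
    card (B \<inter> X) * \<phi> x + card (B \<inter> Z) * \<phi> z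
      + (real (card B) - card (B \<inter> X) - card (B \<inter> Z)) * \<phi> 1"
proof -
  let ?g = "\<lambda>v. \<phi> (if v \<in> X then x else if v \<in> Z then z else 1)"
  let ?Y = "B - (B \<inter> X) - (B \<inter> Z)"
  have "B = (B \<inter> X) \<union> ((B \<inter> Z) \<union> ?Y)" by blast
  then have "sum ?g B = sum ?g ((B \<inter> X) \<union> ((B \<inter> Z) \<union> ?Y))" by simp
  also have "\<dots> = sum ?g (B \<inter> X) + sum ?g ((B \<inter> Z) \<union> ?Y)"
    using assms by (intro sum.union_disjoint) auto
  also have "sum ?g ((B \<inter> Z) \<union> ?Y) = sum ?g (B \<inter> Z) + sum ?g ?Y"
    using assms by (intro sum.union_disjoint) auto
  also have "sum ?g (B \<inter> X) = (\<Sum>v\<in>B \<inter> X. \<phi> x)" by (intro sum.cong) auto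
  also have "sum ?g (B \<inter> Z) = (\<Sum>v\<in>B \<inter> Z. \<phi> z)" using assms(2) by (intro sum.cong) auto
  also have "sum ?g ?Y = (\<Sum>v\<in>?Y. \<phi> 1)" by (intro sum.cong) auto
  also have "real (card ?Y) = real (card B) - card (B \<inter> X) - card (B \<inter> Z)"
  proof -
    have "B \<inter> Z \<subseteq> B - (B \<inter> X)" using assms(2) by blast
    then have "card ?Y = card (B - (B \<inter> X)) - card (B \<inter> Z)" "card (B \<inter> Z) \<le> card (B - (B \<inter> X))"
      using assms(1) by (intro card_Diff_subset card_mono; simp)+
    moreover have "card (B - (B \<inter> X)) = card B - card (B \<inter> X)" "card (B \<inter> X) \<le> card B"
      using assms(1) by (simp_all add: card_Diff_subset card_mono)
    ultimately show ?thesis by linarith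
  qed
  ultimately show ?thesis by simp
qed

text \<open>
Each part \<open>P \<in> \<O>\<close> has a set \<open>H P\<close> of \<open>h\<close> representatives, and \<open>f\<close> is \<open>1\<close> on all other vertices of \<open>V - S\<close>. Concentrating these
other vertices in \<open>R\<close> and bounding \<open>f(H P)\<^sup>2\<close> by the Cauchy-Schwarz inequality gives a bound that depends only on \<open>A\<close>
and \<open>F\<close>, not on the distribution of the values of \<open>f\<close> among the parts. The term \<open>slack\<close> records what the
concentration loses, for the discussion of equality.
\<close>

lemma quad_form_dist_ge_representatives:
  fixes f :: "'a \<Rightarrow> real" and h :: nat and A F r\<^sub>0 slack bound :: real
  assumes G: "pair_graph G" "Digraph_Component.connected (with_proj G)" and S: "S \<subseteq> pverts G"
    and part: "partition_on (pverts G - S) (insert R \<O>)" and R: "R \<notin> \<O>"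
    and closed': "\<forall>P\<in>insert R \<O>. parcs G `` P \<inter> (pverts G - S) \<subseteq> P"
    and H': "\<forall>P\<in>\<O>. H P \<subseteq> P" "\<forall>P\<in>\<O>. card (H P) = h"
    and f': "\<forall>v\<in>pverts G. 0 < f v" "\<forall>v\<in>pverts G - S - \<Union>(H ` \<O>). f v = 1"
  defines "A \<equiv> sum f (\<Union>(H ` \<O>))" and "F \<equiv> \<Sum>v\<in>\<Union>(H ` \<O>). (f v)\<^sup>2"
    and "r\<^sub>0 \<equiv> real (card (pverts G)) - card S - card \<O> * h"
    and "slack \<equiv> \<Sum>P\<in>\<O>. (real (card P) - h) * (real (card R) - sum f (H P))"
    and "V \<equiv> pverts G"
  defines "bound \<equiv> (sum f V)\<^sup>2 - (\<Sum>v\<in>V. (f v)\<^sup>2) + A\<^sup>2 - real h * F + 2 * r\<^sub>0 * A + 2 * slack"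
  shows "bound \<le> quad_form (\<lambda>u v. real (graph_dist G u v)) V f"
    and "\<lbrakk>quad_form (\<lambda>u v. real (graph_dist G u v)) V f \<le> bound; u \<in> V; v \<in> V; u \<noteq> v;
      \<not> (u \<in> V - S \<and> v \<in> V - S \<and> (\<forall>P\<in>insert R \<O>. u \<in> P \<longrightarrow> v \<notin> P))\<rbrakk> \<Longrightarrow> (u, v) \<in> parcs G"
    and "real (card V) - card S = (\<Sum>P\<in>\<O>. real (card P)) + card R"
proof -
  note closed = closed'[rule_format] and H = H'[rule_format] and f = f'[rule_format]
  have fin: "finite V" unfolding V_def using G(1) by (simp add: pair_graph_iff)
  have finW: "finite (V - S)" using fin by simp
  have fin\<O>: "finite \<O>" using finite_elements[OF _ part] finW unfolding V_def by simp
  have sub: "P \<subseteq> V - S" if "P \<in> insert R \<O>" for P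
    using partition_onD1[OF part] that unfolding V_def by blast
  have finP: "finite P" if "P \<in> insert R \<O>" for P using finite_subset[OF sub[OF that] finW] .
  have disj: "P \<inter> Q = {}" if "P \<in> insert R \<O>" "Q \<in> insert R \<O>" "P \<noteq> Q" for P Q
    using partition_onD2[OF part] that unfolding disjoint_def by blast
  have finH: "finite (H P)" if "P \<in> \<O>" for P using finite_subset[OF H(1)[OF that]] finP that by simp
  have Hdisj: "H P \<inter> H Q = {}" if "P \<in> \<O>" "Q \<in> \<O>" "P \<noteq> Q" for P Q
    using disj[of P Q] H(1)[OF that(1)] H(1)[OF that(2)] that by auto
  have sumH: "sum g (\<Union>(H ` \<O>)) = (\<Sum>P\<in>\<O>. sum g (H P))" for g :: "'a \<Rightarrow> real"
    using fin\<O> finH Hdisj by (intro sum.UNION_disjoint) auto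
  have sumV: "sum g (V - S) = (\<Sum>P\<in>\<O>. sum g P) + sum g R" for g :: "'a \<Rightarrow> real"
  proof -
    have "V - S = \<Union>(insert R \<O>)" using partition_onD1[OF part] unfolding V_def .
    then have "sum g (V - S) = (\<Sum>P\<in>insert R \<O>. sum g P)"
      using finP disj by (simp only:) (subst sum.Union_disjoint, auto)
    then show ?thesis using fin\<O> R by simp
  qed
  have cardV: "real (card V) - card S = real (card (V - S))"
    using S fin finite_subset[OF S] unfolding V_def by (simp add: card_Diff_subset card_mono of_nat_diff)
  show count: "real (card V) - card S = (\<Sum>P\<in>\<O>. real (card P)) + card R"
    using sumV[of "\<lambda>_. 1"] unfolding cardV by simp
  define a where "a P = sum f (H P)" for P
  define e where "e P = real (card P) - h" for P :: "'a set"
  have e0: "0 \<le> e P" if "P \<in> \<O>" for P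
    using card_mono[OF finP H(1)[OF that]] H(2)[OF that] that unfolding e_def by simp
  have f1: "f v = 1" if "v \<in> P - H P" "P \<in> \<O>" for P v
  proof (rule f(2))
    have "v \<notin> H Q" if "Q \<in> \<O>" for Q
    proof (cases "Q = P")
      case False
      then show ?thesis using disj[of P Q] H(1)[OF \<open>Q \<in> \<O>\<close>] \<open>P \<in> \<O>\<close> \<open>Q \<in> \<O>\<close> \<open>v \<in> P - H P\<close> by auto
    qed (use \<open>v \<in> P - H P\<close> in simp)
    then show "v \<in> pverts G - S - \<Union>(H ` \<O>)" using sub[of P] that unfolding V_def by blast
  qed
  have wP: "sum f P = a P + e P" if "P \<in> \<O>" for P
  proof -
    have "sum f P = sum f (P - H P) + sum f (H P)"
      using H(1)[OF that] finP that by (simp add: sum.subset_diff)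
    also have "sum f (P - H P) = (\<Sum>v\<in>P - H P. 1)" using f1 that by (intro sum.cong) auto
    also have "\<dots> = e P"
    proof -
      have "card (P - H P) = card P - h"
        using card_Diff_subset[OF finH[OF that] H(1)[OF that]] H(2)[OF that] by simp
      moreover have "h \<le> card P" using e0[OF that] unfolding e_def by simp
      ultimately show ?thesis unfolding e_def by simp
    qed
    finally show ?thesis unfolding a_def by simp
  qed
  have wR: "sum f R = card R"
  proof -
    have "f v = 1" if "v \<in> R" for v
    proof (rule f(2))
      have "v \<notin> H P" if "P \<in> \<O>" for P using disj[of R P] H(1)[OF that] \<open>v \<in> R\<close> that R by auto
      then show "v \<in> pverts G - S - \<Union>(H ` \<O>)" using sub[of R] that unfolding V_def by blast
    qed
    then show ?thesis by simp
  qed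
  have A: "A = sum a \<O>" unfolding A_def a_def by (rule sumH)
  have F: "(\<Sum>P\<in>\<O>. (a P)\<^sup>2) \<le> real h * F"
  proof -
    have "(a P)\<^sup>2 \<le> h * (\<Sum>v\<in>H P. (f v)\<^sup>2)" if "P \<in> \<O>" for P
      using sum_squared_le_sum_of_squares[of f "H P"] H(2)[OF that] unfolding a_def by (simp add: mult.commute)
    then have "(\<Sum>P\<in>\<O>. (a P)\<^sup>2) \<le> (\<Sum>P\<in>\<O>. h * (\<Sum>v\<in>H P. (f v)\<^sup>2))" by (rule sum_mono)
    then show ?thesis unfolding F_def sumH by (simp add: sum_distrib_left)
  qed
  have r0: "r\<^sub>0 = card R + sum e \<O>"
    using count unfolding r\<^sub>0_def e_def V_def by (simp add: sum_subtractf)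
  note conc = multipartite_weight_concentrate[where e = e and a = a and r = "real (card R)", OF fin\<O> e0]
  have sW: "sum f (V - S) = (\<Sum>P\<in>\<O>. a P + e P) + card R"
    unfolding sumV wR using wP by (intro arg_cong2[where f = "(+)"] sum.cong) auto
  have sq: "(\<Sum>P\<in>insert R \<O>. (sum f P)\<^sup>2) = (\<Sum>P\<in>\<O>. (a P + e P)\<^sup>2) + (real (card R))\<^sup>2"
    using fin\<O> R wR wP by simp
  let ?b = "(sum f V)\<^sup>2 - (\<Sum>v\<in>V. (f v)\<^sup>2) + (sum f (V - S))\<^sup>2 - (\<Sum>P\<in>insert R \<O>. (sum f P)\<^sup>2)"
  have le: "bound \<le> ?b"
    using conc F unfolding bound_def sW sq A r0 slack_def a_def[symmetric] e_def[symmetric] by simp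
  have "?b \<le> quad_form (\<lambda>u v. real (graph_dist G u v)) V f"
    unfolding V_def by (rule quad_form_dist_ge_separation(1)[OF G Diff_subset part closed f(1)])
  then show "bound \<le> quad_form (\<lambda>u v. real (graph_dist G u v)) V f" using le by linarith
  assume small: "quad_form (\<lambda>u v. real (graph_dist G u v)) V f \<le> bound" and uv: "u \<in> V" "v \<in> V" "u \<noteq> v"
    "\<not> (u \<in> V - S \<and> v \<in> V - S \<and> (\<forall>P\<in>insert R \<O>. u \<in> P \<longrightarrow> v \<notin> P))"
  have "quad_form (\<lambda>u v. real (graph_dist G u v)) V f \<le> ?b" using small le by linarith
  from quad_form_dist_ge_separation(2)[OF G Diff_subset part closed f(1) this[unfolded V_def] uv[unfolded V_def]]
  show "(u, v) \<in> parcs G" .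
qed

lemma odd_imp_one_or_ge_3: "odd (b :: nat) \<Longrightarrow> b = 1 \<or> 3 \<le> b"
  by presburger

lemma transversal_subsets:
  assumes "\<And>P. P \<in> \<O> \<Longrightarrow> h \<le> card P"
  obtains H where "\<forall>P\<in>\<O>. H P \<subseteq> P" "\<forall>P\<in>\<O>. card (H P) = h"
proof -
  have "\<forall>P\<in>\<O>. \<exists>T. T \<subseteq> P \<and> card T = h"
    using obtain_subset_with_card_n[OF assms] by metis
  then show thesis using that by metis
qed

lemma transversal_card:
  assumes "finite A" "partition_on A \<P>" "\<O> \<subseteq> \<P>"
    and H': "\<forall>P\<in>\<O>. H P \<subseteq> P" "\<forall>P\<in>\<O>. card (H P) = h"
  shows "card (\<Union>(H ` \<O>)) = card \<O> * h"
proof -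
  note H = H'[rule_format]
  have "finite \<O>" using finite_elements[OF assms(1,2)] assms(3) finite_subset by blast
  moreover have "finite (H P)" if "P \<in> \<O>" for P
  proof (rule finite_subset[OF _ assms(1)])
    show "H P \<subseteq> A" using H(1)[OF that] partition_onD1[OF assms(2)] assms(3) that by blast
  qed
  moreover have "H P \<inter> H Q = {}" if "P \<in> \<O>" "Q \<in> \<O>" "P \<noteq> Q" for P Q
  proof -
    have "P \<in> \<P>" "Q \<in> \<P>" using that assms(3) by auto
    then have "P \<inter> Q = {}" using partition_onD2[OF assms(2)] that(3) by (simp add: disjointD)
    then show ?thesis using H(1)[OF that(1)] H(1)[OF that(2)] by blast
  qed
  ultimately show ?thesis using H(2) by (subst card_UN_disjoint) auto
qed

text \<open>
The test vector has the value \<open>x\<close> on \<open>X\<close>, \<open>z\<close> on \<open>Z\<close> and \<open>1\<close> elsewhere, with the multiplicities of the extremal graph. Thus the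
squared norm and the sum of all entries agree with those of the eigenvector, and in the Rayleigh comparison only
the weights of separated pairs remain: \<open>N\<close> stands for that of the extremal graph, and that of \<open>G\<close> is at least \<open>gap\<close>. If
\<open>N \<le> gap\<close>, nothing may be lost anywhere, which fixes the sizes of the parts and the adjacencies.
\<close>

lemma spectral_barrier_inequality:
  fixes x z :: real and h d m t :: nat
  assumes G: "pair_graph G" "Digraph_Component.connected (with_proj G)" and S: "S \<subseteq> pverts G"
    and part: "partition_on (pverts G - S) (insert R \<O>)" and R: "R \<notin> \<O>"
    and closed: "\<forall>P\<in>insert R \<O>. parcs G `` P \<inter> (pverts G - S) \<subseteq> P"
    and H': "\<forall>P\<in>\<O>. H P \<subseteq> P" "\<forall>P\<in>\<O>. card (H P) = h" and h: "0 < h"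
    and big: "\<forall>P\<in>\<O>. h < card P \<longrightarrow> 2 * h \<le> card R"
    and X: "X \<subseteq> S \<union> \<Union>(H ` \<O>)" "card X = d" and Z: "Z \<subseteq> \<Union>(H ` \<O>)" "card Z = t" "X \<inter> Z = {}"
    and n: "card (pverts G) = d + m + t"
    and xz: "0 < x" "x \<le> 1" "1 \<le> z" "z < 2"
    and rad: "distance_spectral_radius G * (d * x\<^sup>2 + m + t * z\<^sup>2) \<le>
       (d * x + m + t * z)\<^sup>2 - (d * x\<^sup>2 + m + t * z\<^sup>2) + N"
  defines "k \<equiv> card (X \<inter> \<Union>(H ` \<O>))" and "r\<^sub>0 \<equiv> real (card (pverts G)) - card S - card \<O> * h"
  defines "gap \<equiv> (t * z + k * x + (real (card \<O> * h) - t - k))\<^sup>2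
      - h * (t * z\<^sup>2 + k * x\<^sup>2 + (real (card \<O> * h) - t - k))
      + 2 * r\<^sub>0 * (t * z + k * x + (real (card \<O> * h) - t - k))"
  shows "gap \<le> N"
    and "\<lbrakk>N \<le> gap; P \<in> \<O>\<rbrakk> \<Longrightarrow> card P = h"
    and "\<lbrakk>N \<le> gap; u \<in> pverts G; v \<in> pverts G; u \<noteq> v;
      \<not> (u \<in> pverts G - S \<and> v \<in> pverts G - S \<and> (\<forall>P\<in>insert R \<O>. u \<in> P \<longrightarrow> v \<notin> P))\<rbrakk>
      \<Longrightarrow> (u, v) \<in> parcs G"
    and "real (card (pverts G)) - card S = (\<Sum>P\<in>\<O>. real (card P)) + card R"
proof -
  let ?V = "pverts G" and ?W = "\<Union>(H ` \<O>)"
  note H = H'[rule_format]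
  have fin: "finite ?V" using G(1) by (simp add: pair_graph_iff)
  have sub: "P \<subseteq> ?V - S" if "P \<in> insert R \<O>" for P using partition_onD1[OF part] that by blast
  have W: "?W \<subseteq> ?V - S" using sub H(1) by blast
  have finW: "finite ?W" using finite_subset[OF W] fin by simp
  have fin\<O>: "finite \<O>" using finite_elements[OF _ part] fin by simp
  have finP: "finite P" if "P \<in> insert R \<O>" for P using finite_subset[OF sub[OF that]] fin by simp
  have finH: "finite (H P)" if "P \<in> \<O>" for P using finite_subset[OF H(1)[OF that]] finP that by simp
  have cardW: "card ?W = card \<O> * h"
    by (rule transversal_card[OF _ part _ H']) (use fin in auto)
  define f where "f v = (if v \<in> X then x else if v \<in> Z then z else 1)" for v
  have fpos: "\<forall>v\<in>?V. 0 < f v" unfolding f_def using xz by simp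
  have f2: "f v < 2" for v unfolding f_def using xz by simp
  have f1: "\<forall>v\<in>?V - S - ?W. f v = 1"
    using X(1) Z(1) unfolding f_def by auto
  have XV: "?V \<inter> X = X" "?V \<inter> Z = Z" using X(1) Z(1) S W by blast+
  have WXZ: "?W \<inter> X = X \<inter> ?W" "?W \<inter> Z = Z" using Z(1) by blast+
  have sumV: "sum f ?V = d * x + m + t * z" "(\<Sum>v\<in>?V. (f v)\<^sup>2) = d * x\<^sup>2 + m + t * z\<^sup>2"
    using sum_three_values[OF fin Z(3), of "\<lambda>y. y" x z] sum_three_values[OF fin Z(3), of "\<lambda>y. y\<^sup>2" x z]
    unfolding XV X(2) Z(2) n f_def by simp_all
  have sumW: "sum f ?W = t * z + k * x + (real (card \<O> * h) - t - k)"
    "(\<Sum>v\<in>?W. (f v)\<^sup>2) = t * z\<^sup>2 + k * x\<^sup>2 + (real (card \<O> * h) - t - k)"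
    using sum_three_values[OF finW Z(3), of "\<lambda>y. y" x z] sum_three_values[OF finW Z(3), of "\<lambda>y. y\<^sup>2" x z]
    unfolding WXZ Z(2) cardW k_def f_def by simp_all
  define slack where "slack = (\<Sum>P\<in>\<O>. (real (card P) - h) * (real (card R) - sum f (H P)))"
  have aP: "sum f (H P) < 2 * real h" if "P \<in> \<O>" for P
  proof -
    have "H P \<noteq> {}" using H(2)[OF that] h by auto
    then have "sum f (H P) < (\<Sum>v\<in>H P. 2)" using finH[OF that] f2 by (intro sum_strict_mono) auto
    then show ?thesis using H(2)[OF that] by simp
  qed
  have hP: "h \<le> card P" if "P \<in> \<O>" for P
    using card_mono[OF finP H(1)[OF that]] H(2)[OF that] that by simp
  have term0: "0 < (real (card P) - h) * (real (card R) - sum f (H P))" if "P \<in> \<O>" "h < card P" for P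
  proof -
    have "2 * real h \<le> real (card R)" using big that by fastforce
    then show ?thesis using aP[OF that(1)] that(2) by (intro mult_pos_pos) auto
  qed
  have term1: "0 \<le> (real (card P) - h) * (real (card R) - sum f (H P))" if "P \<in> \<O>" for P
  proof (cases "h < card P")
    case True
    then show ?thesis using term0[OF that] by simp
  next
    case False
    then have "card P = h" using hP[OF that] by simp
    then show ?thesis by simp
  qed
  have slack0: "0 \<le> slack" unfolding slack_def by (intro sum_nonneg term1)
  let ?Q = "quad_form (\<lambda>u v. real (graph_dist G u v)) ?V f"
  let ?B = "(d * x + m + t * z)\<^sup>2 - (d * x\<^sup>2 + m + t * z\<^sup>2)"
  note rep = quad_form_dist_ge_representatives[where f = f and H = H, OF G S part R closed H' fpos f1, folded slack_def,
      unfolded sumV sumW, folded r\<^sub>0_def]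
  have Q1: "?B + gap + 2 * slack \<le> ?Q"
    using rep(1) unfolding gap_def by (simp add: algebra_simps)
  have ne: "?V \<noteq> {}" using partition_onD1[OF part] partition_onD3[OF part] by auto
  have "?Q \<le> distance_spectral_radius G * (d * x\<^sup>2 + m + t * z\<^sup>2)"
    using distance_spectral_radius_principal(1)[OF G(1) ne, of f] unfolding sumV .
  then have Q2: "?Q \<le> ?B + N" using rad by linarith
  show "gap \<le> N" using Q1 Q2 slack0 by linarith
  show "card P = h" if "N \<le> gap" "P \<in> \<O>"
  proof (rule ccontr)
    assume "card P \<noteq> h"
    then have "h < card P" using hP[OF that(2)] by simp
    then have "0 < slack" unfolding slack_def
      using term0[OF that(2)] term1 that(2) fin\<O> by (intro sum_pos2) auto
    then show False using Q1 Q2 that(1) by linarith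
  qed
  show "real (card ?V) - card S = (\<Sum>P\<in>\<O>. real (card P)) + card R" by (rule rep(3))
  assume "N \<le> gap" and uv: "u \<in> ?V" "v \<in> ?V" "u \<noteq> v"
    "\<not> (u \<in> ?V - S \<and> v \<in> ?V - S \<and> (\<forall>P\<in>insert R \<O>. u \<in> P \<longrightarrow> v \<notin> P))"
  then have "?Q \<le> ?B + gap + 2 * slack" using Q2 slack0 by linarith
  then show "(u, v) \<in> parcs G"
    using rep(2)[OF _ uv] unfolding gap_def by (simp add: algebra_simps)
qed

lemma split_join_of_singleton_parts:
  assumes "pair_graph G" and S: "S \<subseteq> pverts G"
    and part: "partition_on (pverts G - S) (insert R \<O>)" and R: "R \<notin> \<O>"
    and closed: "\<forall>P\<in>insert R \<O>. parcs G `` P \<inter> (pverts G - S) \<subseteq> P"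
    and single: "\<And>P. P \<in> \<O> \<Longrightarrow> card P = 1"
    and adj: "\<And>u v. \<lbrakk>u \<in> pverts G; v \<in> pverts G; u \<noteq> v;
      \<not> (u \<in> pverts G - S \<and> v \<in> pverts G - S \<and> (\<forall>P\<in>insert R \<O>. u \<in> P \<longrightarrow> v \<notin> P))\<rbrakk>
      \<Longrightarrow> (u, v) \<in> parcs G"
  shows "split_join G S R (\<Union>\<O>)"
proof -
  have G: "parcs G \<subseteq> pverts G \<times> pverts G" "irrefl (parcs G)"
    using assms(1) by (simp_all add: pair_graph_iff)
  have V: "pverts G - S = R \<union> \<Union>\<O>" using partition_onD1[OF part] by simp
  have disj: "P \<inter> R = {}" if "P \<in> \<O>" for P
    by (rule disjointD[OF partition_onD2[OF part]]) (use that R in auto)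
  then have RO: "R \<inter> \<Union>\<O> = {}" by blast
  have arc: "(u, v) \<in> parcs G \<longleftrightarrow> u \<in> pverts G \<and> v \<in> pverts G \<and> u \<noteq> v \<and>
      (u \<in> S \<or> v \<in> S \<or> u \<in> R \<and> v \<in> R)" for u v
  proof
    assume uv: "(u, v) \<in> parcs G"
    then have 1: "u \<in> pverts G" "v \<in> pverts G" "u \<noteq> v" using G unfolding irrefl_def by blast+
    moreover have "u \<in> S \<or> v \<in> S \<or> u \<in> R \<and> v \<in> R"
    proof (rule ccontr)
      assume neg: "\<not> ?thesis"
      then have W: "u \<in> R \<union> \<Union>\<O>" "v \<in> pverts G - S" using 1 V by blast+
      then obtain P where P: "P \<in> insert R \<O>" "u \<in> P" by blast
      then have "v \<in> P" using closed uv W(2) by blast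
      then have "P \<in> \<O>" using neg P by blast
      then obtain w where "P = {w}" using single card_1_singletonE by metis
      then show False using P(2) \<open>v \<in> P\<close> 1(3) by simp
    qed
    ultimately show "u \<in> pverts G \<and> v \<in> pverts G \<and> u \<noteq> v \<and> (u \<in> S \<or> v \<in> S \<or> u \<in> R \<and> v \<in> R)" by blast
  next
    assume uv: "u \<in> pverts G \<and> v \<in> pverts G \<and> u \<noteq> v \<and> (u \<in> S \<or> v \<in> S \<or> u \<in> R \<and> v \<in> R)"
    show "(u, v) \<in> parcs G" by (rule adj) (use uv in auto)
  qed
  have "pverts G = S \<union> R \<union> \<Union>\<O>" using V S by blast
  moreover have "S \<inter> R = {}" "S \<inter> \<Union>\<O> = {}" using V by blast+
  ultimately show ?thesis using RO arc unfolding split_join_def by blast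
qed

section \<open>The spectral condition for odd factors\<close>

theorem theorem4p1:
  fixes G :: "'a pair_pre_digraph" and b n \<delta> :: nat
  assumes "b > 0" and "odd b"
    and "pair_graph G" and "Digraph_Component.connected (with_proj G)"
    and "card (pverts G) = n" and "even n"
    and "min_degree G = \<delta>" and "\<delta> \<ge> 3"
    and "real n \<ge> max (2 * real b * (real \<delta>)^2)
           ((3 / real b + 5 + 2 * real b) * real \<delta> + 1 + 3 * (real b + 1) / (real b)^2)"
    and "distance_spectral_radius G \<le> distance_spectral_radius (extremal_graph b \<delta> n)"
    and "\<not> digraph_iso (with_proj G) (with_proj (extremal_graph b \<delta> n))"
  shows "\<exists>H. odd_factor b G H"
proof (rule ccontr)
  assume none: "\<not> (\<exists>H. odd_factor b G H)"
  let ?V = "pverts G" and ?E = "parcs G"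
  note G = assms(3,4)
  have fin: "finite ?V" and sym: "sym ?E" using G(1) by (simp_all add: pair_graph_iff)
  \<comment> \<open>Without a factor there is a barrier; \<open>s\<close> denotes its size.\<close>
  have "\<not> parity_tough ?E (\<lambda>_. b) ?V"
    using parity_tough_imp_parity_factor[OF sym fin] parity_factor_odd_factor[OF G(1) assms(2)] none by blast
  then obtain S \<O> R where S: "S \<subseteq> ?V" "S \<noteq> {}"
    and part: "partition_on (?V - S) (insert R \<O>)" and R: "R \<notin> \<O>"
    and card\<O>: "card \<O> = b * card S + 1"
    and closed: "\<forall>P\<in>insert R \<O>. ?E `` P \<inter> (?V - S) \<subseteq> P" and largest: "\<forall>P\<in>\<O>. card P \<le> card R"
    using odd_barrier_partition[OF G, of b] assms(2,5,6) by metis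
  define s t where "s = card S" and "t = b * \<delta> + 1"
  define \<beta> d where "\<beta> = real b" and "d = real \<delta>"
  have \<beta>: "1 \<le> \<beta>" "\<beta> = 1 \<or> 3 \<le> \<beta>"
    using odd_imp_one_or_ge_3[OF assms(2)] unfolding \<beta>_def by auto
  have d: "3 \<le> d" "d = 3 \<or> 4 \<le> d" using assms(8) unfolding d_def by auto
  have size: "2 * \<beta> * d\<^sup>2 \<le> n" "(3 / \<beta> + 5 + 2 * \<beta>) * d + 1 + 3 * (\<beta> + 1) / \<beta>\<^sup>2 \<le> n"
    using assms(9) unfolding \<beta>_def d_def by simp_all
  note size' = size_bounds[OF \<beta>(1) d(1) size]
  have "3 \<le> \<beta> * d" using mult_mono[of 1 \<beta> 3 d] \<beta>(1) d(1) by simp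
  moreover have "d \<le> \<beta> * d" using \<beta>(1) d(1) by simp
  moreover have "6 * (\<beta> * d) \<le> n" using size'(1) by (simp add: mult.assoc)
  ultimately have "\<beta> * d + d + 2 \<le> n" by linarith
  then have "real ((b + 1) * \<delta> + 2) \<le> real n" unfolding \<beta>_def d_def by (simp add: algebra_simps)
  then have n_ge: "(b + 1) * \<delta> + 2 \<le> n" by linarith
  define m where "m = n - (b + 1) * \<delta> - 1"
  have n_eq: "n = m + (b + 1) * \<delta> + 1" and m_pos: "0 < m" using n_ge unfolding m_def by simp_all
  have n_real: "real n = m + (\<beta> + 1) * d + 1" unfolding n_eq \<beta>_def d_def by (simp add: algebra_simps)
  have n_split: "n = \<delta> + m + t" unfolding t_def n_eq by simp
  have t_real: "real t = \<beta> * d + 1" unfolding t_def \<beta>_def d_def by simp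
  \<comment> \<open>The test values \<open>x\<close>, \<open>1\<close>, \<open>z\<close> come from the extremal graph.\<close>
  obtain X' Y' Z' where ext: "split_join (extremal_graph b \<delta> n) X' Y' Z'"
    "card X' = \<delta>" "card Y' = m" "card Z' = t"
    unfolding m_def t_def by (rule extremal_graph_split_join)
  obtain x z :: real where xz: "0 < x" "x \<le> 1" "1 \<le> z" "z < 2"
    and xz_n: "(1 - x) * (real \<delta> + m + t) \<le> t * z"
    and ext_rad: "distance_spectral_radius (extremal_graph b \<delta> n) * (\<delta> * x\<^sup>2 + m + t * z\<^sup>2) =
       (\<delta> * x + m + t * z)\<^sup>2 - (\<delta> * x\<^sup>2 + m + t * z\<^sup>2)
        + (2 * real m * real t * z + (real t)\<^sup>2 * z\<^sup>2 - t * z\<^sup>2)"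
    using split_join_principal_values[OF extremal_graph_pair_graph ext] assms(8) m_pos
    unfolding t_def by auto
  define N where "N = 2 * real m * real t * z + (real t)\<^sup>2 * z\<^sup>2 - t * z\<^sup>2"
  have "0 \<le> \<delta> * x\<^sup>2 + m + t * z\<^sup>2" by simp
  then have rad: "distance_spectral_radius G * (\<delta> * x\<^sup>2 + m + t * z\<^sup>2) \<le>
       (\<delta> * x + m + t * z)\<^sup>2 - (\<delta> * x\<^sup>2 + m + t * z\<^sup>2) + N"
    using mult_right_mono[OF assms(10)] unfolding ext_rad[folded N_def, symmetric] by blast
  have V: "card ?V = \<delta> + m + t" using assms(5) n_split by simp
  have fin_parts: "finite P" "P \<noteq> {}" "P \<subseteq> ?V - S" if "P \<in> insert R \<O>" for P
  proof -
    show "P \<subseteq> ?V - S" using partition_onD1[OF part] that by blast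
    then show "finite P" using fin by (metis finite_Diff finite_subset)
    show "P \<noteq> {}" using partition_onD3[OF part] that by blast
  qed
  have fin\<O>: "finite \<O>" using finite_elements[OF _ part] fin by simp
  have finS: "finite S" by (rule finite_subset[OF S(1) fin])
  have card_pos: "0 < card P" if "P \<in> insert R \<O>" for P
    using fin_parts(1,2)[OF that] by (simp add: card_gt_0_iff)
  have s_pos: "1 \<le> s" using S(2) finS unfolding s_def by (simp add: Suc_le_eq card_gt_0_iff)
  have \<O>_real: "real (card \<O>) = \<beta> * s + 1" unfolding card\<O> s_def \<beta>_def by simp
  show False
  proof (cases "\<delta> \<le> s")
    case True
    obtain H where H: "\<forall>P\<in>\<O>. H P \<subseteq> P" "\<forall>P\<in>\<O>. card (H P) = 1"
      by (rule transversal_subsets[of \<O> 1]) (use card_pos in \<open>auto simp: Suc_le_eq\<close>)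
    \<comment> \<open>Single representatives suffice; \<open>R\<close> is at least as large as any other part.\<close>
    have big: "\<forall>P\<in>\<O>. 1 < card P \<longrightarrow> 2 * 1 \<le> card R"
      using largest by fastforce
    let ?W = "\<Union>(H ` \<O>)"
    have cardW: "card ?W = card \<O> * 1"
      by (rule transversal_card[OF _ part _ H]) (use fin in auto)
    have WS: "?W \<inter> S = {}" using H(1) fin_parts(3) by blast
    obtain X where X: "X \<subseteq> S" "card X = \<delta>"
      using obtain_subset_with_card_n[of \<delta> S] True unfolding s_def by blast
    have "t \<le> card ?W"
      using mult_le_mono2[OF True, of b] unfolding cardW card\<O> t_def s_def by simp
    then obtain Z where Z: "Z \<subseteq> ?W" "card Z = t" by (rule obtain_subset_with_card_n)
    have XW: "X \<inter> ?W = {}" "X \<subseteq> S \<union> ?W" "X \<inter> Z = {}" using X(1) WS Z(1) by blast+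
    have h: "(0 :: nat) < 1" by simp
    define u where "u = real s - d"
    have s_real: "real s = d + u" unfolding u_def by simp
    define r where "r = m - u * (\<beta> + 1)"
    have Z_rest: "real (card \<O> * 1) - t - card (X \<inter> ?W) = \<beta> * u"
      using \<O>_real unfolding XW(1) t_real s_real by (simp add: algebra_simps)
    have r_eq: "real (card ?V) - card S - real (card \<O> * 1) = r"
      unfolding assms(5) n_real s_def[symmetric] mult_1_right \<O>_real s_real r_def by (simp add: algebra_simps)
    note bound = spectral_barrier_inequality[where h = 1 and H = H, OF G S(1) part R closed H h big XW(2) X(2) Z XW(3) V xz rad,
        unfolded Z_rest r_eq]
    let ?gap = "(t * z + real (card (X \<inter> ?W)) * x + \<beta> * u)\<^sup>2
      - real 1 * (t * z\<^sup>2 + real (card (X \<inter> ?W)) * x\<^sup>2 + \<beta> * u)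
      + 2 * r * (t * z + real (card (X \<inter> ?W)) * x + \<beta> * u)"
    have gap: "?gap - N = u * (\<beta> * (2 * r + \<beta> * u - 1) - 2 * t * z)"
      using large_barrier_gap[OF t_real, of z u m] unfolding XW(1) N_def r_def by simp
    show False
    proof (cases "s = \<delta>")
      case False
      then have u: "0 < u" using True unfolding u_def d_def by simp
      have "real (card \<O>) = (\<Sum>P\<in>\<O>. 1)" by simp
      also have "\<dots> \<le> (\<Sum>P\<in>\<O>. real (card P))"
        using card_pos by (intro sum_mono) (simp add: Suc_le_eq)
      finally have "real (card \<O>) + 1 \<le> real (card ?V) - card S"
        unfolding bound(4) using card_pos[of R] by simp
      then have r1: "1 \<le> r" using r_eq by simp
      have n_r: "real n = (\<beta> + 1) * (d + u) + 1 + r" unfolding r_def n_real by (simp add: algebra_simps)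
      \<comment> \<open>For \<open>b = 1\<close> the size bound is the odd number \<open>10 \<delta> + 7\<close>, and \<open>n\<close> is even.\<close>
      have "10 * d + 8 \<le> real n" if "\<beta> = 1"
      proof -
        have "real (10 * \<delta> + 7) \<le> real n" using size(2) that unfolding d_def by simp
        then have "10 * \<delta> + 7 \<le> n" by linarith
        then have "10 * \<delta> + 8 \<le> n" using assms(6) by (cases "n = 10 * \<delta> + 7") auto
        then show ?thesis unfolding d_def by linarith
      qed
      then have "2 * t * z < \<beta> * (2 * r + \<beta> * u - 1)"
        using large_barrier_margin[OF \<beta> d(1) _ xz(4) t_real r1 n_r size(2)] xz(3) by simp
      then have "0 < u * (\<beta> * (2 * r + \<beta> * u - 1) - 2 * t * z)" using u by simp
      then show False using bound(1) gap by simp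
    next
      case True
      then have "u = 0" unfolding u_def d_def by simp
      \<comment> \<open>For \<open>s = \<delta>\<close> there is no gap, so equality holds throughout and \<open>G\<close> is the extremal graph.\<close>
      then have le: "N \<le> ?gap" using gap by simp
      have single: "card P = 1" if "P \<in> \<O>" for P by (rule bound(2)[OF le that])
      have join: "split_join G S R (\<Union>\<O>)"
        by (rule split_join_of_singleton_parts[OF G(1) S(1) part R closed single bound(3)[OF le]])
      have "card (\<Union>\<O>) = card \<O> * 1"
        using transversal_card[OF _ part, of \<O> "\<lambda>P. P" 1] single fin by auto
      then have cardO: "card (\<Union>\<O>) = t" unfolding card\<O> t_def using True s_def by simp
      have "(\<Sum>P\<in>\<O>. real (card P)) = real (card \<O>)" using single by simp
      then have "real (card R) = m"
        using bound(4) r_eq \<open>u = 0\<close> unfolding r_def by simp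
      then have "digraph_iso (with_proj G) (with_proj (extremal_graph b \<delta> n))"
        using split_join_iso[OF G(1) extremal_graph_pair_graph join ext(1)] ext(2-4) cardO True
        unfolding s_def by simp
      then show False using assms(11) by contradiction
    qed
  next
    case False
    \<comment> \<open>By the minimum degree every part has at least \<open>h = \<delta> + 1 - s\<close> vertices.\<close>
    define k h where "k = \<delta> - s" and "h = k + 1"
    have k: "1 \<le> k" "\<delta> = s + k" using False unfolding k_def by auto
    have h: "0 < h" "real h = real k + 1" unfolding h_def by simp_all
    have d_real: "d = real s + k" unfolding d_def k(2) by simp
    have part_size: "h \<le> card P" if "P \<in> insert R \<O>" for P
    proof -
      have "\<delta> + 1 \<le> card P + s"
        using min_degree_part_size[OF G(1) S(1) fin_parts(3)[OF that] fin_parts(2)[OF that]]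
          closed that assms(7) unfolding s_def by blast
      then show ?thesis unfolding h_def k_def using False by simp
    qed
    obtain H where H: "\<forall>P\<in>\<O>. H P \<subseteq> P" "\<forall>P\<in>\<O>. card (H P) = h"
      by (rule transversal_subsets[of \<O> h]) (use part_size in auto)
    let ?W = "\<Union>(H ` \<O>)"
    have cardW: "card ?W = card \<O> * h"
      by (rule transversal_card[OF _ part _ H]) (use fin in auto)
    have WS: "?W \<inter> S = {}" and WV: "?W \<subseteq> ?V" using H(1) fin_parts(3) by blast+
    have finW: "finite ?W" by (rule finite_subset[OF WV fin])
    \<comment> \<open>The representatives make room for all \<open>t\<close> values \<open>z\<close> and for the \<open>k\<close> values \<open>x\<close> that do not fit into \<open>S\<close>; \<open>g\<close> of them keep the value \<open>1\<close>.\<close>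
    define g where "g = b * k * (s - 1)"
    have W_split: "card ?W = t + k + g"
    proof -
      obtain s' where s': "s = Suc s'" using s_pos by (cases s) auto
      show ?thesis unfolding cardW card\<O> t_def g_def h_def k(2) s_def[symmetric] s' by (simp add: algebra_simps)
    qed
    then obtain X\<^sub>2 where X2: "X\<^sub>2 \<subseteq> ?W" "card X\<^sub>2 = k"
      using obtain_subset_with_card_n[of k ?W] by auto
    have "t \<le> card (?W - X\<^sub>2)"
      using W_split X2 finite_subset[OF X2(1) finW] by (simp add: card_Diff_subset)
    then obtain Z where Z: "Z \<subseteq> ?W - X\<^sub>2" "card Z = t" by (rule obtain_subset_with_card_n)
    define X where "X = S \<union> X\<^sub>2"
    have X: "X \<subseteq> S \<union> ?W" "X \<inter> Z = {}" "X \<inter> ?W = X\<^sub>2" "Z \<subseteq> ?W"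
      using X2(1) Z(1) WS unfolding X_def by blast+
    have "S \<inter> X\<^sub>2 = {}" using X2(1) WS by blast
    then have cardX: "card X = \<delta>"
      using finS finite_subset[OF X2(1) finW] X2(2) k(2) unfolding X_def s_def by (simp add: card_Un_disjoint)
    have "card (?V - S) = (\<Sum>P\<in>insert R \<O>. card P)"
      by (rule product_partition[OF part fin_parts(1)])
    also have "\<dots> = (\<Sum>P\<in>\<O>. card P) + card R" using R fin\<O> by simp
    also have "\<dots> \<le> card \<O> * card R + card R"
      using sum_bounded_above[of \<O> card "card R"] largest by simp
    finally have "card (?V - S) \<le> (card \<O> + 1) * card R" by simp
    moreover have "card (?V - S) = n - s" using S(1) finS assms(5) unfolding s_def by (simp add: card_Diff_subset)
    ultimately have "real (n - s) \<le> real ((card \<O> + 1) * card R)" by linarith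
    then have "real n - s \<le> (\<beta> * s + 2) * card R" using \<O>_real by (simp add: algebra_simps)
    then have "2 * (d + 1 - s) \<le> card R"
      using s_pos d_real by (intro largest_part_size[OF \<beta> d(2) _ _ size(1) size'(2)]) auto
    then have "real (2 * h) \<le> real (card R)" unfolding d_real h_def by simp
    then have R_big: "2 * h \<le> card R" by linarith
    then have big: "\<forall>P\<in>\<O>. h < card P \<longrightarrow> 2 * h \<le> card R" by simp
    have W_real: "real (card \<O> * h) = real t + k + g" using W_split unfolding cardW by simp
    have Z_rest: "real (card \<O> * h) - t - card (X \<inter> ?W) = g" unfolding X(3) X2(2) W_real by simp
    have r_eq: "real (card ?V) - card S - real (card \<O> * h) = real m - g"
      using W_real n_split k(2) unfolding assms(5) s_def[symmetric] by simp
    note bound = spectral_barrier_inequality[where h = h and H = H, OF G S(1) part R closed H h(1) big X(1) cardX X(4) Z(2) X(2) V xz rad,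
        unfolded Z_rest r_eq]
    have "real (card \<O> * h) \<le> (\<Sum>P\<in>\<O>. real (card P))"
    proof -
      have "real (card \<O> * h) = (\<Sum>P\<in>\<O>. real h)" by simp
      also have "\<dots> \<le> (\<Sum>P\<in>\<O>. real (card P))" using part_size by (intro sum_mono) simp
      finally show ?thesis .
    qed
    then have "card R \<le> real m - g" using bound(4) r_eq by linarith
    then have "real g + k + 1 \<le> 2 * real m" using R_big unfolding h_def by simp
    moreover have "(1 - x) * real n \<le> t * z" using xz_n n_split by simp
    ultimately have "N < (t * z + k * x + g)\<^sup>2 - (real k + 1) * (t * z\<^sup>2 + k * x\<^sup>2 + g)
        + 2 * (real m - g) * (t * z + k * x + g)"
      unfolding N_def using k(1)
      by (intro small_barrier_margin[OF \<beta>(1) d(1) t_real n_real size' xz]) auto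
    then show False using bound(1) unfolding X(3) X2(2) h(2) by linarith
  qed
qed

end
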